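(* Let $X$ be a compact complex manifold of complex dimension $n$. Suppose $c_1^{\mathrm{AC}}(X)=0$ in $H^{1,1}_{\mathrm A}(X)$. Then the top intersection number $c_1^n(X)=\int_X c_1(X)^n$ is $0$. In particular, if $X$ has a Levi-Civita Ricci-flat Hermitian metric $\omega$ (i.e. $\mathfrak{Ric}(\omega)=0$), then $c_1^n(X)=0$.
   Context: Aeppli cohomology of $X$: with $\Omega^{p,q}(X)$ the smooth $(p,q)$-forms, $$H^{p,q}_{\mathrm A}(X)=\frac{\mathrm{Ker}\,\partial\bar\partial\cap\Omega^{p,q}(X)}{\mathrm{Im}\,\partial\cap\Omega^{p,q}(X)+\mathrm{Im}\,\bar\partial\cap\Omega^{p,q}(X)}.$$ The first Aeppli-Chern class $c_1^{\mathrm{AC}}(X)\in H^{1,1}_{\mathrm A}(X)$ is the Aeppli class of the curvature form, locally $-\sqrt{-1}\,\partial\bar\partial\log h$, of any smooth Hermitian metric $h$ on the anti-canonical bundle $K_X^{-1}$ (it is independent of $h$). The first Chern class $c_1(X)\in H^2(X,\mathbb R)$ is represented (normalization by $2\pi$ ignored) by the same form. Levi-Civita Ricci curvature: let $(X,\omega)$ be a Hermitian manifold with $\omega=\sqrt{-1}\,h_{i\bar j}\,dz^i\wedge d\bar z^j$ in local holomorphic coordinates, and extend the Levi-Civita connection of the background Riemannian metric $\mathbb{C}$-linearly to $T_{\mathbb C}X=T^{1,0}X\oplus T^{0,1}X$. Composing it with the projection to $T^{1,0}X$ gives the Levi-Civita connection $\nabla^{\mathrm{LC}}$ on $T^{1,0}X$,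 with coefficients $\nabla^{\mathrm{LC}}_{\partial/\partial z^i}\frac{\partial}{\partial z^k}=\Gamma_{ik}^p\frac{\partial}{\partial z^p}$ and $\nabla^{\mathrm{LC}}_{\partial/\partial\bar z^j}\frac{\partial}{\partial z^k}=\Gamma_{\bar jk}^p\frac{\partial}{\partial z^p}$, where $$\Gamma_{ij}^k=\tfrac12 h^{k\bar\ell}\Big(\frac{\partial h_{j\bar\ell}}{\partial z^i}+\frac{\partial h_{i\bar\ell}}{\partial z^j}\Big),\qquad \Gamma_{\bar ij}^k=\tfrac12 h^{k\bar\ell}\Big(\frac{\partial h_{j\bar\ell}}{\partial\bar z^i}-\frac{\partial h_{j\bar i}}{\partial\bar z^\ell}\Big).$$ The $(1,1)$ components of its curvature are $$\mathfrak R_{i\bar jk}^{\ell}=-\Big(\frac{\partial\Gamma_{ik}^\ell}{\partial\bar z^j}-\frac{\partial\Gamma_{\bar jk}^\ell}{\partial z^i}+\Gamma_{ik}^s\Gamma_{\bar js}^\ell-\Gamma_{\bar jk}^s\Gamma_{si}^\ell\Big).$$ The (first) Levi-Civita Ricci curvature is $\mathfrak{Ric}(\omega)=\sqrt{-1}\,\mathfrak R_{i\bar jk}^{k}\,dz^i\wedge d\bar z^j$ (sum over $k$). The metric $\omega$ is Levi-Civita Ricci-flat if $\mathfrak{Ric}(\omega)=0$. *)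

theory Defs
  imports
    "HOL-Analysis.Analysis"
    "HOL-Library.Function_Algebras"
    "HOL-Library.Set_Algebras"
begin

section \<open>Smooth functions and Wirtinger derivatives on \<open>\<complex>\<^sup>n\<close>\<close>

text \<open>The dimension is \<open>n = CARD('n)\<close>, so \<open>n \<ge> 1\<close>. The two predicates below are meant for
  open sets only.\<close>

primrec ck_on :: "nat \<Rightarrow> 'a::real_normed_vector set \<Rightarrow> ('a \<Rightarrow> 'b::real_normed_vector) \<Rightarrow> bool" where
  "ck_on 0 S f \<longleftrightarrow> continuous_on S f"
| "ck_on (Suc k) S f \<longleftrightarrow>
     (\<forall>x\<in>S. f differentiable (at x)) \<and> (\<forall>v. ck_on k S (\<lambda>x. frechet_derivative f (at x) v))"

definition smooth_on :: "'a::real_normed_vector set \<Rightarrow> ('a \<Rightarrow> 'b::real_normed_vector) \<Rightarrow> bool" where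
  "smooth_on S f \<longleftrightarrow> (\<forall>k. ck_on k S f)"

text \<open>The complexified tangent space of \<open>\<complex>\<^sup>n\<close> has the basis \<open>\<partial>/\<partial>z\<^sup>i\<close>, \<open>\<partial>/\<partial>z\<bar>\<^sup>j\<close>. It is
  indexed by \<^typ>\<open>'n + 'n\<close>: \<^term>\<open>Inl i\<close> stands for \<open>\<partial>/\<partial>z\<^sup>i\<close> and \<^term>\<open>Inr j\<close> for the
  conjugate direction \<open>\<partial>/\<partial>z\<bar>\<^sup>j\<close>.\<close>

definition wirtinger :: "'n + 'n \<Rightarrow> (complex^'n::finite \<Rightarrow> complex) \<Rightarrow> complex^'n \<Rightarrow> complex" where
  "wirtinger a f z =
     (let D = frechet_derivative f (at z) in
      case a of
        Inl i \<Rightarrow> (D (axis i 1) - \<i> * D (axis i \<i>)) / 2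
      | Inr i \<Rightarrow> (D (axis i 1) + \<i> * D (axis i \<i>)) / 2)"

definition holomorphic_map_on :: "(complex^'n::finite) set \<Rightarrow> (complex^'n \<Rightarrow> complex^'n) \<Rightarrow> bool" where
  "holomorphic_map_on S f \<longleftrightarrow>
     smooth_on S f \<and> (\<forall>z\<in>S. \<forall>j k. wirtinger (Inr j) (\<lambda>w. f w $ k) z = 0)"

section \<open>Complex manifolds\<close>

text \<open>A chart is a pair of a domain and a coordinate map; the values of the map outside the
  domain are irrelevant.\<close>

type_synonym ('a, 'n) chart = "'a set \<times> ('a \<Rightarrow> complex^'n)"

definition chart_image :: "('a, 'n) chart \<Rightarrow> (complex^'n::finite) set" where
  "chart_image c = snd c ` fst c"

definition chart_inv :: "('a, 'n) chart \<Rightarrow> complex^'n::finite \<Rightarrow> 'a" where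
  "chart_inv c = inv_into (fst c) (snd c)"

text \<open>The change of coordinates from \<open>c\<close> to \<open>d\<close>, and the image in \<open>c\<close> of the overlap.\<close>

definition transition :: "('a, 'n) chart \<Rightarrow> ('a, 'n) chart \<Rightarrow> complex^'n::finite \<Rightarrow> complex^'n" where
  "transition c d = snd d \<circ> chart_inv c"

definition overlap :: "('a, 'n) chart \<Rightarrow> ('a, 'n) chart \<Rightarrow> (complex^'n::finite) set" where
  "overlap c d = snd c ` (fst c \<inter> fst d)"

definition complex_manifold :: "'a topology \<Rightarrow> ('a, 'n::finite) chart set \<Rightarrow> bool" where
  "complex_manifold X A \<longleftrightarrow>
     Hausdorff_space X \<and> second_countable X \<and>
     (\<Union>c\<in>A. fst c) = topspace X \<and>
     (\<forall>c\<in>A. openin X (fst c) \<and> open (chart_image c) \<and>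
        homeomorphic_map (subtopology X (fst c)) (top_of_set (chart_image c)) (snd c)) \<and>
     (\<forall>c\<in>A. \<forall>d\<in>A. holomorphic_map_on (overlap c d) (transition c d))"

section \<open>Differential forms\<close>

text \<open>An element of the complexified exterior algebra at a point is given by its components:
  \<open>\<omega> [a\<^sub>1,\<dots>,a\<^sub>k]\<close> is the value of the degree \<open>k\<close> part on the basis vectors with these indices.
  Forms are not assumed homogeneous. The wedge product is the shuffle product: \<open>S\<close> is the set
  of positions fed to the first factor. With this normalization \<open>dz \<and> dw = dz \<otimes> dw - dw \<otimes> dz\<close>.\<close>

type_synonym 'n covec = "('n + 'n) list \<Rightarrow> complex"

definition wedge :: "'n covec \<Rightarrow> 'n covec \<Rightarrow> 'n covec" where
  "wedge \<alpha> \<beta> xs =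
     (\<Sum>S\<in>Pow {..<length xs}.
        (-1) ^ card {(i, j). i \<in> S \<and> j \<in> {..<length xs} - S \<and> j < i} *
        \<alpha> (nths xs S) * \<beta> (nths xs (- S)))"

definition covec_one :: "'n covec" where
  "covec_one xs = (if xs = [] then 1 else 0)"

definition coord_covec :: "'n + 'n \<Rightarrow> 'n covec" where
  "coord_covec a xs = (if xs = [a] then 1 else 0)"

text \<open>A form on the manifold is the family of its local expressions: \<open>\<omega> c z\<close> is the form in the
  chart \<open>c\<close> at the point with coordinates \<open>z\<close>. Local expressions are set to zero
  outside the chart images (and for non-charts), so that forms are equal iff they are equal as
  functions, and the pointwise operations of \<open>Function_Algebras\<close> are those on forms.\<close>

type_synonym ('a, 'n) mform = "('a, 'n) chart \<Rightarrow> complex^'n \<Rightarrow> 'n covec"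

text \<open>The index \<open>a\<close> also denotes the coordinate function \<open>z\<^sup>k\<close> or its conjugate, so \<open>jacobian\<close> is
  the matrix of the complexified differential of \<open>\<tau>\<close>.\<close>

definition coord_fun :: "'n + 'n \<Rightarrow> complex^'n::finite \<Rightarrow> complex" where
  "coord_fun a z = (case a of Inl k \<Rightarrow> z $ k | Inr k \<Rightarrow> cnj (z $ k))"

definition jacobian ::
    "(complex^'n::finite \<Rightarrow> complex^'n) \<Rightarrow> complex^'n \<Rightarrow> 'n + 'n \<Rightarrow> 'n + 'n \<Rightarrow> complex" where
  "jacobian \<tau> z a b = wirtinger b (\<lambda>w. coord_fun a (\<tau> w)) z"

definition pullback_at ::
    "(complex^'n::finite \<Rightarrow> complex^'n) \<Rightarrow> complex^'n \<Rightarrow> 'n covec \<Rightarrow> 'n covec" where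
  "pullback_at \<tau> z \<alpha> bs =
     (\<Sum>as\<in>{as. length as = length bs}.
        \<alpha> as * (\<Prod>i<length bs. jacobian \<tau> z (as ! i) (bs ! i)))"

definition alternating :: "'n covec \<Rightarrow> bool" where
  "alternating \<alpha> \<longleftrightarrow> (\<forall>xs a b ys. \<alpha> (xs @ [a, b] @ ys) = - \<alpha> (xs @ [b, a] @ ys))"

definition forms :: "('a, 'n::finite) chart set \<Rightarrow> ('a, 'n) mform set" where
  "forms A = {\<omega>.
     (\<forall>c z. \<not> (c \<in> A \<and> z \<in> chart_image c) \<longrightarrow> \<omega> c z = 0) \<and>
     (\<forall>c\<in>A. \<forall>z\<in>chart_image c. alternating (\<omega> c z)) \<and>
     (\<forall>c\<in>A. \<forall>xs. smooth_on (chart_image c) (\<lambda>z. \<omega> c z xs)) \<and>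
     (\<forall>c\<in>A. \<forall>d\<in>A. \<forall>z\<in>overlap c d.
        \<omega> c z = pullback_at (transition c d) z (\<omega> d (transition c d z)))}"

definition k_forms :: "('a, 'n::finite) chart set \<Rightarrow> nat \<Rightarrow> ('a, 'n) mform set" where
  "k_forms A k = {\<omega> \<in> forms A. \<forall>c z xs. \<omega> c z xs \<noteq> 0 \<longrightarrow> length xs = k}"

definition pq_forms :: "('a, 'n::finite) chart set \<Rightarrow> nat \<Rightarrow> nat \<Rightarrow> ('a, 'n) mform set" where
  "pq_forms A p q = {\<omega> \<in> forms A. \<forall>c z xs. \<omega> c z xs \<noteq> 0 \<longrightarrow>
     length (filter isl xs) = p \<and> length (filter (\<lambda>a. \<not> isl a) xs) = q}"

definition conj_index :: "'n + 'n \<Rightarrow> 'n + 'n" where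
  "conj_index a = (case a of Inl i \<Rightarrow> Inr i | Inr i \<Rightarrow> Inl i)"

definition real_forms :: "('a, 'n::finite) chart set \<Rightarrow> ('a, 'n) mform set" where
  "real_forms A = {\<omega> \<in> forms A. \<forall>c z xs. \<omega> c z (map conj_index xs) = cnj (\<omega> c z xs)}"

text \<open>The alternating sum \<open>\<Sum>\<^sub>i (-1)\<^sup>i \<partial>\<^bsub>a\<^sub>i\<^esub> \<omega>[a\<^sub>0,\<dots>,omit a\<^sub>i,\<dots>,a\<^sub>k]\<close>, over those indices that
  satisfy \<open>P\<close>.\<close>

definition partial_ext ::
    "('n + 'n \<Rightarrow> bool) \<Rightarrow> ('a, 'n::finite) chart set \<Rightarrow> ('a, 'n) mform \<Rightarrow> ('a, 'n) mform" where
  "partial_ext P A \<omega> c z xs =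
     (if c \<in> A \<and> z \<in> chart_image c then
        (\<Sum>i | i < length xs \<and> P (xs ! i).
           (-1) ^ i * wirtinger (xs ! i) (\<lambda>w. \<omega> c w (take i xs @ drop (Suc i) xs)) z)
      else 0)"

definition del :: "('a, 'n::finite) chart set \<Rightarrow> ('a, 'n) mform \<Rightarrow> ('a, 'n) mform" where
  "del = partial_ext isl"

definition delbar :: "('a, 'n::finite) chart set \<Rightarrow> ('a, 'n) mform \<Rightarrow> ('a, 'n) mform" where
  "delbar = partial_ext (\<lambda>a. \<not> isl a)"

definition ext_d :: "('a, 'n::finite) chart set \<Rightarrow> ('a, 'n) mform \<Rightarrow> ('a, 'n) mform" where
  "ext_d = partial_ext (\<lambda>a. True)"

definition form_power :: "('a, 'n) mform \<Rightarrow> nat \<Rightarrow> ('a, 'n) mform" where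
  "form_power \<omega> k = (\<lambda>c z. (wedge (\<omega> c z) ^^ k) covec_one)"

section \<open>Integration over a compact complex manifold\<close>

text \<open>Since \<open>dz \<and> dz\<bar> = -2\<i> dx \<and> dy\<close>, this is the coefficient of
  \<open>dx\<^sub>1 \<and> dy\<^sub>1 \<and> \<dots> \<and> dx\<^sub>n \<and> dy\<^sub>n\<close> in the top degree part. The order of the pairs does not
  matter, so any enumeration of \<^typ>\<open>'n\<close> serves.\<close>

definition top_density :: "'n::finite covec \<Rightarrow> complex" where
  "top_density \<alpha> =
     (-2 * \<i>) ^ CARD('n) *
     \<alpha> (concat (map (\<lambda>i. [Inl i, Inr i]) (SOME ns. distinct ns \<and> set ns = UNIV)))"

definition partition_of_unity ::
    "'a topology \<Rightarrow> ('a, 'n::finite) chart set \<Rightarrow> ('a, 'n) chart set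
      \<Rightarrow> (('a, 'n) chart \<Rightarrow> 'a \<Rightarrow> real) \<Rightarrow> bool" where
  "partition_of_unity X A F \<rho> \<longleftrightarrow>
     finite F \<and> F \<subseteq> A \<and>
     (\<forall>c\<in>F. \<forall>p\<in>topspace X. 0 \<le> \<rho> c p) \<and>
     (\<forall>p\<in>topspace X. (\<Sum>c\<in>F. \<rho> c p) = 1) \<and>
     (\<forall>c\<in>F. X closure_of {p \<in> topspace X. \<rho> c p \<noteq> 0} \<subseteq> fst c) \<and>
     (\<forall>c\<in>F. \<forall>d\<in>A. smooth_on (chart_image d) (\<lambda>z. \<rho> c (chart_inv d z)))"

definition form_integral :: "'a topology \<Rightarrow> ('a, 'n::finite) chart set \<Rightarrow> ('a, 'n) mform \<Rightarrow> complex" where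
  "form_integral X A \<omega> =
     (THE I. \<exists>F \<rho>. partition_of_unity X A F \<rho> \<and>
        I = (\<Sum>c\<in>F. LINT z:chart_image c|lborel.
               complex_of_real (\<rho> c (chart_inv c z)) * top_density (\<omega> c z)))"

section \<open>Aeppli and de Rham cohomology\<close>

definition aeppli_cocycles :: "('a, 'n::finite) chart set \<Rightarrow> nat \<Rightarrow> nat \<Rightarrow> ('a, 'n) mform set" where
  "aeppli_cocycles A p q = {\<omega> \<in> pq_forms A p q. del A (delbar A \<omega>) = 0}"

definition aeppli_coboundaries :: "('a, 'n::finite) chart set \<Rightarrow> nat \<Rightarrow> nat \<Rightarrow> ('a, 'n) mform set" where
  "aeppli_coboundaries A p q =
     (del A ` forms A \<inter> pq_forms A p q) + (delbar A ` forms A \<inter> pq_forms A p q)"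

definition aeppli_rel ::
    "('a, 'n::finite) chart set \<Rightarrow> nat \<Rightarrow> nat \<Rightarrow> (('a, 'n) mform \<times> ('a, 'n) mform) set" where
  "aeppli_rel A p q = {(\<alpha>, \<beta>). \<alpha> \<in> aeppli_cocycles A p q \<and> \<beta> \<in> aeppli_cocycles A p q \<and>
     \<alpha> - \<beta> \<in> aeppli_coboundaries A p q}"

definition aeppli_cohomology :: "('a, 'n::finite) chart set \<Rightarrow> nat \<Rightarrow> nat \<Rightarrow> ('a, 'n) mform set set" where
  "aeppli_cohomology A p q = aeppli_cocycles A p q // aeppli_rel A p q"

definition aeppli_class :: "('a, 'n::finite) chart set \<Rightarrow> nat \<Rightarrow> nat \<Rightarrow> ('a, 'n) mform \<Rightarrow> ('a, 'n) mform set" where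
  "aeppli_class A p q \<omega> = aeppli_rel A p q `` {\<omega>}"

definition de_rham_cocycles :: "('a, 'n::finite) chart set \<Rightarrow> nat \<Rightarrow> ('a, 'n) mform set" where
  "de_rham_cocycles A k = {\<omega> \<in> real_forms A \<inter> k_forms A k. ext_d A \<omega> = 0}"

definition de_rham_rel ::
    "('a, 'n::finite) chart set \<Rightarrow> nat \<Rightarrow> (('a, 'n) mform \<times> ('a, 'n) mform) set" where
  "de_rham_rel A k = {(\<alpha>, \<beta>). \<alpha> \<in> de_rham_cocycles A k \<and> \<beta> \<in> de_rham_cocycles A k \<and>
     \<alpha> - \<beta> \<in> ext_d A ` real_forms A \<inter> k_forms A k}"

definition de_rham_class :: "('a, 'n::finite) chart set \<Rightarrow> nat \<Rightarrow> ('a, 'n) mform \<Rightarrow> ('a, 'n) mform set" where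
  "de_rham_class A k \<omega> = de_rham_rel A k `` {\<omega>}"

section \<open>The anti-canonical bundle and its Chern classes\<close>

text \<open>A Hermitian metric on \<open>K\<^sub>X\<^sup>-\<^sup>1 = \<Lambda>\<^sup>n T\<^sup>1\<^sup>,\<^sup>0X\<close> is given by its values
  \<open>h c = |\<partial>/\<partial>z\<^sup>1 \<and> \<dots> \<and> \<partial>/\<partial>z\<^sup>n|\<^sup>2\<close> on the local frames, which change by the Jacobian determinant.\<close>

definition anticanonical_metric ::
    "('a, 'n::finite) chart set \<Rightarrow> (('a, 'n) chart \<Rightarrow> complex^'n \<Rightarrow> real) \<Rightarrow> bool" where
  "anticanonical_metric A h \<longleftrightarrow>
     (\<forall>c\<in>A. smooth_on (chart_image c) (h c) \<and> (\<forall>z\<in>chart_image c. 0 < h c z)) \<and>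
     (\<forall>c\<in>A. \<forall>d\<in>A. \<forall>z\<in>overlap c d.
        h c z = (cmod (det (\<chi> k i. jacobian (transition c d) z (Inl k) (Inl i))))\<^sup>2 *
                h d (transition c d z))"

text \<open>The form \<open>-\<i> \<partial>\<partial>\<bar> log h\<close>. The local functions \<open>log (h c)\<close> do not glue to a global
  function, but \<^const>\<open>del\<close> and \<^const>\<open>delbar\<close> act chart by chart.\<close>

definition anticanonical_curvature ::
    "('a, 'n::finite) chart set \<Rightarrow> (('a, 'n) chart \<Rightarrow> complex^'n \<Rightarrow> real) \<Rightarrow> ('a, 'n) mform" where
  "anticanonical_curvature A h =
     (\<lambda>c z xs. - \<i> *
        del A (delbar A (\<lambda>c z xs. complex_of_real (ln (h c z)) * covec_one xs)) c z xs)"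

text \<open>The class of the curvature does not depend on \<open>h\<close>, so each of the following unions is a
  single cohomology class.\<close>

definition first_aeppli_chern_class :: "('a, 'n::finite) chart set \<Rightarrow> ('a, 'n) mform set" where
  "first_aeppli_chern_class A =
     (\<Union>h\<in>{h. anticanonical_metric A h}. aeppli_class A 1 1 (anticanonical_curvature A h))"

text \<open>Normalized without the factor \<open>1 / (2\<pi>)\<close>.\<close>

definition first_chern_class :: "('a, 'n::finite) chart set \<Rightarrow> ('a, 'n) mform set" where
  "first_chern_class A =
     (\<Union>h\<in>{h. anticanonical_metric A h}. de_rham_class A 2 (anticanonical_curvature A h))"

text \<open>The integral of the \<open>n\<close>-th power of any representative of \<open>c\<^sub>1(X)\<close>.\<close>

definition top_chern_number :: "'a topology \<Rightarrow> ('a, 'n::finite) chart set \<Rightarrow> complex" where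
  "top_chern_number X A =
     (THE r. \<exists>\<eta>\<in>first_chern_class A. r = form_integral X A (form_power \<eta> CARD('n)))"

section \<open>Hermitian metrics and the Levi-Civita Ricci curvature\<close>

text \<open>The matrix \<open>h\<^bsub>i j\<bar>\<^esub>\<close> with \<open>\<omega> = \<i> h\<^bsub>i j\<bar>\<^esub> dz\<^sup>i \<and> dz\<bar>\<^sup>j\<close>.\<close>

definition metric_matrix :: "('a, 'n::finite) mform \<Rightarrow> ('a, 'n) chart \<Rightarrow> complex^'n \<Rightarrow> complex^'n^'n" where
  "metric_matrix \<omega> c z = (\<chi> i j. - \<i> * \<omega> c z [Inl i, Inr j])"

definition hermitian_posdef :: "complex^'n::finite^'n \<Rightarrow> bool" where
  "hermitian_posdef H \<longleftrightarrow>
     (\<forall>i j. H $ j $ i = cnj (H $ i $ j)) \<and>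
     (\<forall>v. v \<noteq> 0 \<longrightarrow> 0 < Re (\<Sum>i\<in>UNIV. \<Sum>j\<in>UNIV. H $ i $ j * v $ i * cnj (v $ j)))"

definition hermitian_metric :: "('a, 'n::finite) chart set \<Rightarrow> ('a, 'n) mform \<Rightarrow> bool" where
  "hermitian_metric A \<omega> \<longleftrightarrow>
     \<omega> \<in> pq_forms A 1 1 \<and> (\<forall>c\<in>A. \<forall>z\<in>chart_image c. hermitian_posdef (metric_matrix \<omega> c z))"

text \<open>The inverse \<open>h\<^bsup>k l\<bar>\<^esup>\<close> is normalized by \<open>\<Sum>\<^sub>l h\<^bsup>k l\<bar>\<^esup> h\<^bsub>i l\<bar>\<^esub> = \<delta>\<^sub>i\<^sub>k\<close>, whence the transpose.\<close>

definition inverse_metric :: "(complex^'n::finite \<Rightarrow> complex^'n^'n) \<Rightarrow> 'n \<Rightarrow> 'n \<Rightarrow> complex^'n \<Rightarrow> complex" where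
  "inverse_metric H k l z = matrix_inv (transpose (H z)) $ k $ l"

text \<open>The coefficients \<open>\<Gamma>\<^bsub>ij\<^esub>\<^sup>k\<close> and \<open>\<Gamma>\<^bsub>i\<bar>j\<^esub>\<^sup>k\<close> of the Levi-Civita connection on \<open>T\<^sup>1\<^sup>,\<^sup>0X\<close>.\<close>

definition lc_gamma ::
    "(complex^'n::finite \<Rightarrow> complex^'n^'n) \<Rightarrow> 'n \<Rightarrow> 'n \<Rightarrow> 'n \<Rightarrow> complex^'n \<Rightarrow> complex" where
  "lc_gamma H i j k z = 1/2 *
     (\<Sum>l\<in>UNIV. inverse_metric H k l z *
        (wirtinger (Inl i) (\<lambda>w. H w $ j $ l) z + wirtinger (Inl j) (\<lambda>w. H w $ i $ l) z))"

definition lc_gamma_bar ::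
    "(complex^'n::finite \<Rightarrow> complex^'n^'n) \<Rightarrow> 'n \<Rightarrow> 'n \<Rightarrow> 'n \<Rightarrow> complex^'n \<Rightarrow> complex" where
  "lc_gamma_bar H i j k z = 1/2 *
     (\<Sum>l\<in>UNIV. inverse_metric H k l z *
        (wirtinger (Inr i) (\<lambda>w. H w $ j $ l) z - wirtinger (Inr l) (\<lambda>w. H w $ j $ i) z))"

text \<open>The curvature component \<open>R\<^bsub>i j\<bar> k\<^esub>\<^sup>l\<close>.\<close>

definition lc_curvature ::
    "(complex^'n::finite \<Rightarrow> complex^'n^'n) \<Rightarrow> 'n \<Rightarrow> 'n \<Rightarrow> 'n \<Rightarrow> 'n \<Rightarrow> complex^'n \<Rightarrow> complex" where
  "lc_curvature H i j k l z =
     - (wirtinger (Inr j) (lc_gamma H i k l) z - wirtinger (Inl i) (lc_gamma_bar H j k l) z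
        + (\<Sum>s\<in>UNIV. lc_gamma H i k s z * lc_gamma_bar H j s l z)
        - (\<Sum>s\<in>UNIV. lc_gamma_bar H j k s z * lc_gamma H s i l z))"

definition lc_ricci :: "('a, 'n::finite) chart set \<Rightarrow> ('a, 'n) mform \<Rightarrow> ('a, 'n) mform" where
  "lc_ricci A \<omega> c z xs =
     (if c \<in> A \<and> z \<in> chart_image c then
        \<i> * (\<Sum>i\<in>UNIV. \<Sum>j\<in>UNIV. (\<Sum>k\<in>UNIV. lc_curvature (metric_matrix \<omega> c) i j k k z) *
               wedge (coord_covec (Inl i)) (coord_covec (Inr j)) xs)
      else 0)"

definition lc_ricci_flat :: "('a, 'n::finite) chart set \<Rightarrow> ('a, 'n) mform \<Rightarrow> bool" where
  "lc_ricci_flat A \<omega> \<longleftrightarrow> lc_ricci A \<omega> = 0"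

end

theory Submission
  imports Defs
begin

text \<open>Let \<open>\<Theta>\<close> be the curvature form of a metric on the anticanonical bundle and \<open>n\<close> the dimension. Both
  hypotheses provide a \<open>1\<close>-form \<open>\<gamma>\<close> with \<open>\<Theta> = (d\<gamma>)\<^sup>1\<^sup>,\<^sup>1\<close>. Since \<open>\<Theta>\<close> is closed and \<open>\<Theta>\<^sup>n\<^sup>-\<^sup>1\<close> has type
  \<open>(n-1,n-1)\<close>, the components of \<open>d\<gamma>\<close> of type \<open>(2,0)\<close> and \<open>(0,2)\<close> do not survive multiplication with it, and
  \<open>\<Theta>\<^sup>n = d\<gamma> \<and> \<Theta>\<^sup>n\<^sup>-\<^sup>1 = d(\<gamma> \<and> \<Theta>\<^sup>n\<^sup>-\<^sup>1)\<close> in top degree (\<open>wedge_power_top_exact\<close>). Any other representative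
  \<open>\<eta> = \<Theta> + d\<sigma>\<close> of the first Chern class has \<open>\<eta>\<^sup>n = \<Theta>\<^sup>n + d\<mu>\<close> (\<open>wedge_power_exact\<close>), so the integral of
  \<open>\<eta>\<^sup>n\<close> vanishes by Stokes' theorem (\<open>form_integral_exact\<close>, \<open>top_chern_number_zero\<close>).

  If the first Aeppli-Chern class vanishes, then \<open>\<Theta> = \<partial>\<alpha> + \<partial>\<bar>\<beta>\<close>, and \<open>\<gamma>\<close> is made of the \<open>(0,1)\<close>-part
  of \<open>\<alpha>\<close> and the \<open>(1,0)\<close>-part of \<open>\<beta>\<close>. For a Hermitian metric with matrix \<open>h\<close> and torsion \<open>1\<close>-form
  \<open>\<theta>\<close>, the contraction of \<open>d\<omega>\<close> with \<open>\<omega>\<close>, the traces of the Levi-Civita connection coefficients are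
  \<open>\<Gamma>\<^bsub>ik\<^esub>\<^sup>k = \<partial>\<^sub>i log det h - \<theta>\<^sub>i / 2\<close> and \<open>\<Gamma>\<^bsub>j\<bar>k\<^esub>\<^sup>k = \<theta>\<^bsub>j\<bar>\<^esub> / 2\<close>, and the quadratic terms of the curvature
  cancel in the trace. So, as coefficients of \<open>\<i> dz\<^sup>i \<and> dz\<bar>\<^sup>j\<close>, the Levi-Civita
  Ricci form differs from the curvature form of the metric \<open>det h\<close> by
  \<open>(\<partial>\<^bsub>j\<bar>\<^esub>\<theta>\<^sub>i + \<partial>\<^sub>i\<theta>\<^bsub>j\<bar>\<^esub>) / 2\<close>, and if it vanishes, \<open>\<gamma>\<close> is again a combination of the two parts of
  \<open>\<theta>\<close> (\<open>trace_lc_curvature\<close>, \<open>ricci_flat_potential\<close>). Another metric on the anticanonical bundle changes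
  \<open>\<Theta>\<close> by \<open>\<partial>\<partial>\<bar>\<close> of a global function (\<open>change_metric_potential\<close>).

  Forms are families of component functions indexed by lists of basis directions, so the exterior
  calculus is developed by induction on these lists. Contraction with the first direction is an
  antiderivation of the wedge product (\<open>wedge_Cons\<close>), and it anticommutes with the exterior derivative
  up to the partial derivative in that direction (\<open>local_ext_Cons\<close>). The Leibniz rule,
  \<open>d \<circ> d = 0\<close>, graded commutativity and naturality under coordinate changes all follow from these two
  recursions.

  The integral of a form is the value that all partitions of unity give. For exact forms
  each of them gives \<open>0\<close>, and that suffices: a partition \<open>\<rho>\<close> turns the integral of \<open>d\<gamma>\<close> into
  the sum of the integrals of \<open>- d\<rho>\<^sub>c \<and> \<gamma>\<close> by Stokes' theorem for compact support in a chart, and inserting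
  \<open>\<rho>\<close> once more and changing charts collects these into the integral of \<open>- d(\<Sum>\<^sub>c \<rho>\<^sub>c) \<and> \<gamma> = 0\<close>
  (\<open>partition_integral_exact\<close>).\<close>

section \<open>Calculus of smooth functions\<close>

lemma ck_on_cong:
  assumes "open S" "\<And>x. x \<in> S \<Longrightarrow> f x = g x" "ck_on k S f"
  shows "ck_on k S g"
  using assms(2,3)
proof (induction k arbitrary: f g)
  case 0 then show ?case by (simp cong: continuous_on_cong)
next
  case (Suc k)
  have d: "f differentiable (at x)" if "x \<in> S" for x using Suc.prems that by simp
  have "frechet_derivative f (at x) = frechet_derivative g (at x)" if "x \<in> S" for x
    using frechet_derivative_transform_within_open[OF d[OF that] assms(1) that] Suc.prems by blast
  moreover have "g differentiable (at x)" if "x \<in> S" for x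
    using d[OF that] Suc.prems(1) assms(1) that
    unfolding differentiable_def using has_derivative_transform_within_open by blast
  ultimately show ?case
    using Suc.prems(2) Suc.IH[of "\<lambda>x. frechet_derivative f (at x) v"
        "\<lambda>x. frechet_derivative g (at x) v" for v] by simp
qed

lemma ck_on_SucD: "ck_on (Suc k) S f \<Longrightarrow> ck_on k S f"
proof (induction k arbitrary: f)
  case 0
  then show ?case
    by (auto intro!: continuous_at_imp_continuous_on differentiable_imp_continuous_within)
next
  case (Suc k)
  then show ?case by (metis ck_on.simps(2))
qed

text \<open>Any derivative may stand in for \<^const>\<open>frechet_derivative\<close>. The closure properties
  below are proved by naming the derivative and induction on \<open>k\<close>.\<close>

lemma ck_on_SucI:
  assumes "open S" "\<And>x. x \<in> S \<Longrightarrow> (f has_derivative f' x) (at x)"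
    and "\<And>v. ck_on k S (\<lambda>x. f' x v)"
  shows "ck_on (Suc k) S f"
proof -
  have "frechet_derivative f (at x) = f' x" if "x \<in> S" for x
    using assms(2)[OF that] frechet_derivative_at by metis
  then have "ck_on k S (\<lambda>x. frechet_derivative f (at x) v)" for v
    by (intro ck_on_cong[OF assms(1) _ assms(3)[of v]]) simp
  then show ?thesis using assms(2) by (auto simp: differentiable_def)
qed

lemma ck_on_has_derivative:
  "ck_on (Suc k) S f \<Longrightarrow> x \<in> S \<Longrightarrow> (f has_derivative frechet_derivative f (at x)) (at x)"
  using frechet_derivative_works by (metis ck_on.simps(2))

lemma ck_on_const: "open S \<Longrightarrow> ck_on k S (\<lambda>x. c)"
proof (induction k arbitrary: c)
  case (Suc k)
  show ?case by (rule ck_on_SucI[where f' = "\<lambda>_ _. 0"]) (auto intro: Suc)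
qed simp

lemma ck_on_bounded_linear:
  assumes "open S" "bounded_linear L" "ck_on k S f"
  shows "ck_on k S (\<lambda>x. L (f x))"
  using assms(3)
proof (induction k arbitrary: f)
  case 0
  then show ?case using assms(2) by (auto intro: bounded_linear.continuous_on)
next
  case (Suc k)
  show ?case
    by (rule ck_on_SucI[OF assms(1), where f' = "\<lambda>x v. L (frechet_derivative f (at x) v)"])
      (use Suc ck_on_has_derivative[OF Suc.prems] in
        \<open>auto intro!: bounded_linear.has_derivative[OF assms(2)]\<close>)
qed

lemma ck_on_add:
  assumes "open S" "ck_on k S f" "ck_on k S g"
  shows "ck_on k S (\<lambda>x. f x + g x)"
  using assms(2,3)
proof (induction k arbitrary: f g)
  case 0 then show ?case by (auto intro: continuous_intros)
next
  case (Suc k)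
  show ?case
    by (rule ck_on_SucI[OF assms(1), where f' = "\<lambda>x v. frechet_derivative f (at x) v + frechet_derivative g (at x) v"])
      (use Suc ck_on_has_derivative[OF Suc.prems(1)] ck_on_has_derivative[OF Suc.prems(2)] in
        \<open>auto intro!: has_derivative_add\<close>)
qed

lemma ck_on_bilinear:
  assumes "open S" "bounded_bilinear pr" "ck_on k S f" "ck_on k S g"
  shows "ck_on k S (\<lambda>x. pr (f x) (g x))"
  using assms(3,4)
proof (induction k arbitrary: f g)
  case 0 then show ?case using assms(2) by (auto intro: bounded_bilinear.continuous_on)
next
  case (Suc k)
  show ?case
    by (rule ck_on_SucI[OF assms(1), where f' = "\<lambda>x v. pr (f x) (frechet_derivative g (at x) v)
        + pr (frechet_derivative f (at x) v) (g x)"])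
      (use Suc ck_on_SucD[OF Suc.prems(1)] ck_on_SucD[OF Suc.prems(2)]
        ck_on_has_derivative[OF Suc.prems(1)] ck_on_has_derivative[OF Suc.prems(2)] in
        \<open>auto intro!: bounded_bilinear.FDERIV[OF assms(2)] ck_on_add[OF assms(1)]\<close>)
qed

lemma ck_on_sum:
  assumes "open S" "\<And>i. i \<in> I \<Longrightarrow> ck_on k S (f i)"
  shows "ck_on k S (\<lambda>x. \<Sum>i\<in>I. f i x)"
  using assms(2)
  by (induction I rule: infinite_finite_induct) (auto intro: ck_on_const ck_on_add assms(1))

text \<open>The chain rule applies \<open>df(g x)\<close> to the moving vector \<open>dg(x) v\<close>.
  Expanding that vector in the basis of the finite-dimensional domain of \<open>f\<close> leaves
  products of functions to which the induction hypothesis applies.\<close>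

lemma ck_on_compose:
  fixes f :: "'b::euclidean_space \<Rightarrow> 'c::real_normed_vector"
  assumes "open S" "open T" "g ` S \<subseteq> T" "ck_on k T f" "ck_on k S g"
  shows "ck_on k S (\<lambda>x. f (g x))"
  using assms(4,5)
proof (induction k arbitrary: f)
  case 0
  then show ?case using assms(3) by (auto intro: continuous_on_compose2)
next
  case (Suc k)
  have fd: "(f has_derivative frechet_derivative f (at (g x))) (at (g x))" if "x \<in> S" for x
    using ck_on_has_derivative[OF Suc.prems(1)] that assms(3) by blast
  have gd: "(g has_derivative frechet_derivative g (at x)) (at x)" if "x \<in> S" for x
    using ck_on_has_derivative[OF Suc.prems(2)] that by blast
  show ?case
  proof (rule ck_on_SucI[OF assms(1), where f' = "\<lambda>x v. \<Sum>b\<in>Basis.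
      (frechet_derivative g (at x) v \<bullet> b) *\<^sub>R frechet_derivative f (at (g x)) b"])
    fix x assume x: "x \<in> S"
    have lin: "linear (frechet_derivative f (at (g x)))"
      using fd[OF x] by (rule has_derivative_linear)
    have "(\<lambda>v. \<Sum>b\<in>Basis. (frechet_derivative g (at x) v \<bullet> b) *\<^sub>R frechet_derivative f (at (g x)) b)
        = (\<lambda>v. frechet_derivative f (at (g x)) (frechet_derivative g (at x) v))"
    proof
      fix v
      have "frechet_derivative f (at (g x)) (frechet_derivative g (at x) v)
        = frechet_derivative f (at (g x)) (\<Sum>b\<in>Basis. (frechet_derivative g (at x) v \<bullet> b) *\<^sub>R b)"
        by (simp add: euclidean_representation)
      then show "(\<Sum>b\<in>Basis. (frechet_derivative g (at x) v \<bullet> b) *\<^sub>R frechet_derivative f (at (g x)) b)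
        = frechet_derivative f (at (g x)) (frechet_derivative g (at x) v)"
        by (simp add: linear_sum[OF lin] linear_cmul[OF lin])
    qed
    then show "((\<lambda>x. f (g x)) has_derivative (\<lambda>v. \<Sum>b\<in>Basis.
      (frechet_derivative g (at x) v \<bullet> b) *\<^sub>R frechet_derivative f (at (g x)) b)) (at x)"
      using has_derivative_compose[OF gd[OF x] fd[OF x]] by simp
  next
    fix v
    have 1: "ck_on k S (\<lambda>x. frechet_derivative f (at (g x)) b)" for b
      using Suc.IH[of "\<lambda>y. frechet_derivative f (at y) b"] Suc.prems ck_on_SucD[OF Suc.prems(2)]
      by simp
    have 2: "ck_on k S (\<lambda>x. frechet_derivative g (at x) v)" using Suc.prems(2) by simp
    show "ck_on k S (\<lambda>x. \<Sum>b\<in>Basis. (frechet_derivative g (at x) v \<bullet> b) *\<^sub>R frechet_derivative f (at (g x)) b)"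
      by (intro ck_on_sum ck_on_bilinear[OF _ bounded_bilinear_scaleR] assms(1) 1
          ck_on_bounded_linear[OF _ bounded_linear_inner_left] 2)
  qed
qed

lemma smooth_on_cong:
  "open S \<Longrightarrow> (\<And>x. x \<in> S \<Longrightarrow> f x = g x) \<Longrightarrow> smooth_on S f \<Longrightarrow> smooth_on S g"
  unfolding smooth_on_def using ck_on_cong by blast

lemma smooth_on_const: "open S \<Longrightarrow> smooth_on S (\<lambda>x. c)"
  by (simp add: smooth_on_def ck_on_const)

lemma smooth_on_bounded_linear:
  "open S \<Longrightarrow> bounded_linear L \<Longrightarrow> smooth_on S f \<Longrightarrow> smooth_on S (\<lambda>x. L (f x))"
  by (simp add: smooth_on_def ck_on_bounded_linear)

lemmas smooth_on_Re = smooth_on_bounded_linear[OF _ bounded_linear_Re]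
lemmas smooth_on_of_real = smooth_on_bounded_linear[OF _ bounded_linear_of_real]
lemmas smooth_on_cnj = smooth_on_bounded_linear[OF _ bounded_linear_cnj]
lemmas smooth_on_vec_nth = smooth_on_bounded_linear[OF _ bounded_linear_vec_nth]
lemmas smooth_on_minus = smooth_on_bounded_linear[OF _ bounded_linear_minus[OF bounded_linear_ident]]

lemma smooth_on_add:
  "open S \<Longrightarrow> smooth_on S f \<Longrightarrow> smooth_on S g \<Longrightarrow> smooth_on S (\<lambda>x. f x + g x)"
  by (simp add: smooth_on_def ck_on_add)

lemma smooth_on_diff:
  "open S \<Longrightarrow> smooth_on S f \<Longrightarrow> smooth_on S g \<Longrightarrow> smooth_on S (\<lambda>x. f x - g x)"
  using smooth_on_add[OF _ _ smooth_on_minus, of S f g] by simp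

lemma smooth_on_sum:
  "open S \<Longrightarrow> (\<And>i. i \<in> I \<Longrightarrow> smooth_on S (f i)) \<Longrightarrow> smooth_on S (\<lambda>x. \<Sum>i\<in>I. f i x)"
  by (simp add: smooth_on_def ck_on_sum)

lemma smooth_on_mult:
  fixes f g :: "_ \<Rightarrow> 'b::real_normed_algebra"
  shows "open S \<Longrightarrow> smooth_on S f \<Longrightarrow> smooth_on S g \<Longrightarrow> smooth_on S (\<lambda>x. f x * g x)"
  by (simp add: smooth_on_def ck_on_bilinear[OF _ bounded_bilinear_mult])

lemma smooth_on_inner:
  "open S \<Longrightarrow> smooth_on S f \<Longrightarrow> smooth_on S g \<Longrightarrow> smooth_on S (\<lambda>x. f x \<bullet> g x)"
  by (simp add: smooth_on_def ck_on_bilinear[OF _ bounded_bilinear_inner])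

lemma smooth_on_prod:
  fixes f :: "_ \<Rightarrow> _ \<Rightarrow> 'b::{real_normed_algebra,comm_ring_1}"
  shows "open S \<Longrightarrow> (\<And>i. i \<in> I \<Longrightarrow> smooth_on S (f i)) \<Longrightarrow> smooth_on S (\<lambda>x. \<Prod>i\<in>I. f i x)"
  by (induction I rule: infinite_finite_induct) (auto intro: smooth_on_const smooth_on_mult)

lemma smooth_on_det:
  fixes H :: "_ \<Rightarrow> complex^'n^'n"
  assumes "open S" "\<And>i j. smooth_on S (\<lambda>x. H x $ i $ j)"
  shows "smooth_on S (\<lambda>x. det (H x))"
  unfolding det_def by (intro smooth_on_sum smooth_on_mult smooth_on_prod smooth_on_const assms)

lemma smooth_on_compose:
  fixes f :: "'b::euclidean_space \<Rightarrow> 'c::real_normed_vector"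
  shows "open S \<Longrightarrow> open T \<Longrightarrow> g ` S \<subseteq> T \<Longrightarrow> smooth_on T f \<Longrightarrow> smooth_on S g
    \<Longrightarrow> smooth_on S (\<lambda>x. f (g x))"
  unfolding smooth_on_def using ck_on_compose by blast

lemma smooth_on_local:
  assumes "\<And>x. x \<in> S \<Longrightarrow> \<exists>T. open T \<and> x \<in> T \<and> smooth_on T f"
  shows "smooth_on S f"
proof -
  have "ck_on k S f" if "\<And>x. x \<in> S \<Longrightarrow> \<exists>T. open T \<and> x \<in> T \<and> ck_on k T f" for k
    using that
  proof (induction k arbitrary: f)
    case 0
    then show ?case
      by (metis ck_on.simps(1) continuous_at_imp_continuous_on continuous_on_eq_continuous_at)
  next
    case (Suc k)
    then show ?case by (metis ck_on.simps(2))
  qed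
  then show ?thesis using assms unfolding smooth_on_def by blast
qed

lemma smooth_on_has_derivative:
  "smooth_on S f \<Longrightarrow> x \<in> S \<Longrightarrow> (f has_derivative frechet_derivative f (at x)) (at x)"
  unfolding smooth_on_def using ck_on_has_derivative by blast

lemma smooth_on_differentiable: "smooth_on S f \<Longrightarrow> x \<in> S \<Longrightarrow> f differentiable at x"
  using smooth_on_has_derivative differentiableI by blast

lemma smooth_on_frechet_derivative:
  "smooth_on S f \<Longrightarrow> smooth_on S (\<lambda>x. frechet_derivative f (at x) v)"
  unfolding smooth_on_def by (metis ck_on.simps(2))

lemma smooth_on_continuous_on: "smooth_on S f \<Longrightarrow> continuous_on S f"
  unfolding smooth_on_def by (metis ck_on.simps(1))

lemma smooth_on_inverse:
  fixes f :: "_ \<Rightarrow> 'b::real_normed_field"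
  assumes "open S" "smooth_on S f" "\<And>x. x \<in> S \<Longrightarrow> f x \<noteq> 0"
  shows "smooth_on S (\<lambda>x. inverse (f x))"
  unfolding smooth_on_def
proof
  fix k show "ck_on k S (\<lambda>x. inverse (f x))"
  proof (induction k)
    case 0
    show ?case using smooth_on_continuous_on[OF assms(2)] assms(3) by (auto intro: continuous_intros)
  next
    case (Suc k)
    show ?case
    proof (rule ck_on_SucI[OF assms(1),
          where f' = "\<lambda>x v. - (inverse (f x) * frechet_derivative f (at x) v * inverse (f x))"])
      show "((\<lambda>x. inverse (f x)) has_derivative
         (\<lambda>v. - (inverse (f x) * frechet_derivative f (at x) v * inverse (f x)))) (at x)"
        if "x \<in> S" for x
        using Deriv.has_derivative_inverse[OF assms(3) smooth_on_has_derivative[OF assms(2)]] that by simp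
      have "ck_on k S (\<lambda>x. frechet_derivative f (at x) v)" for v
        using smooth_on_frechet_derivative[OF assms(2)] unfolding smooth_on_def by blast
      then show "ck_on k S (\<lambda>x. - (inverse (f x) * frechet_derivative f (at x) v * inverse (f x)))" for v
        by (intro ck_on_bounded_linear[OF _ bounded_linear_minus[OF bounded_linear_ident]]
            ck_on_bilinear[OF _ bounded_bilinear_mult] Suc assms(1))
    qed
  qed
qed

lemma smooth_on_divide:
  fixes f :: "_ \<Rightarrow> 'b::real_normed_field"
  shows "open S \<Longrightarrow> smooth_on S f \<Longrightarrow> smooth_on S g \<Longrightarrow> (\<And>x. x \<in> S \<Longrightarrow> g x \<noteq> 0)
    \<Longrightarrow> smooth_on S (\<lambda>x. f x / g x)"
  unfolding divide_inverse by (intro smooth_on_mult smooth_on_inverse)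

lemma smooth_on_ln:
  fixes f :: "_ \<Rightarrow> real"
  assumes "open S" "smooth_on S f" "\<And>x. x \<in> S \<Longrightarrow> f x > 0"
  shows "smooth_on S (\<lambda>x. ln (f x))"
  unfolding smooth_on_def
proof
  fix k show "ck_on k S (\<lambda>x. ln (f x))"
  proof (cases k)
    case 0
    then show ?thesis using smooth_on_continuous_on[OF assms(2)] assms(3)
      by (force intro: continuous_intros)
  next
    case (Suc k)
    have "ck_on k S (\<lambda>x. frechet_derivative f (at x) v * inverse (f x))" for v
      using smooth_on_mult[OF assms(1) smooth_on_frechet_derivative[OF assms(2)]
          smooth_on_inverse[OF assms(1,2)]] assms(3)
      unfolding smooth_on_def by (metis less_irrefl)
    then show ?thesis unfolding Suc
      by (intro ck_on_SucI[OF assms(1), where f' = "\<lambda>x v. frechet_derivative f (at x) v * inverse (f x)"])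
        (auto intro!: has_derivative_ln smooth_on_has_derivative assms)
  qed
qed

lemma matrix_inv_inverse:
  assumes "invertible A"
  shows "A ** matrix_inv A = mat 1" "matrix_inv A ** A = mat 1"
  using someI_ex[of "\<lambda>B. A ** B = mat 1 \<and> B ** A = mat 1"] assms
  unfolding invertible_def matrix_inv_def by auto

text \<open>By Cramer's rule the entries of the inverse are rational functions of the entries of the matrix,
  so the inverse of a smooth family is smooth.\<close>

lemma matrix_inv_component:
  fixes M :: "complex^'n^'n"
  assumes "det M \<noteq> 0"
  shows "matrix_inv M $ k $ l = det (\<chi> i j. if j = k then axis l 1 $ i else M $ i $ j) / det M"
proof -
  have inv: "invertible M" using assms invertible_det_nz by blast
  have "M *v (matrix_inv M *v axis l 1) = axis l 1"
    using matrix_inv_inverse(1)[OF inv] by (simp add: matrix_vector_mul_assoc)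
  then have "matrix_inv M *v axis l 1
      = (\<chi> k. det (\<chi> i j. if j = k then axis l 1 $ i else M $ i $ j) / det M)"
    using cramer[OF assms] by blast
  then have "(matrix_inv M *v axis l 1) $ k
      = det (\<chi> i j. if j = k then axis l 1 $ i else M $ i $ j) / det M" by simp
  moreover have "(matrix_inv M *v axis l 1) $ k = matrix_inv M $ k $ l"
    by (simp add: matrix_vector_mult_def axis_def if_distrib cong: if_cong)
  ultimately show ?thesis by simp
qed

lemma smooth_on_matrix_inv:
  fixes H :: "_ \<Rightarrow> complex^'n^'n"
  assumes S: "open S" and H: "\<And>i j. smooth_on S (\<lambda>x. H x $ i $ j)"
    and nz: "\<And>x. x \<in> S \<Longrightarrow> det (H x) \<noteq> 0"
  shows "smooth_on S (\<lambda>x. matrix_inv (H x) $ k $ l)"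
proof (rule smooth_on_cong[OF S])
  show "det (\<chi> i j. if j = k then axis l 1 $ i else H x $ i $ j) / det (H x)
      = matrix_inv (H x) $ k $ l" if "x \<in> S" for x
    using matrix_inv_component[OF nz[OF that]] by simp
  show "smooth_on S (\<lambda>x. det (\<chi> i j. if j = k then axis l 1 $ i else H x $ i $ j) / det (H x))"
  proof (intro smooth_on_divide smooth_on_det S H nz)
    show "smooth_on S (\<lambda>x. (\<chi> i j. if j = k then axis l 1 $ i else H x $ i $ j) $ i $ j)" for i j
      using H[of i j] smooth_on_const[OF S] by (cases "j = k") auto
  qed
qed

subsection \<open>A smooth step function\<close>

text \<open>The functions \<open>exp (-1/x) x\<^sup>-\<^sup>m\<close>, extended by zero. Derivatives of
  members of this family are linear combinations of members, so all of them are smooth as soon as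
  all are differentiable.\<close>

definition flat_pow :: "nat \<Rightarrow> real \<Rightarrow> real" where
  "flat_pow m x = (if x > 0 then exp (- inverse x) * inverse x ^ m else 0)"

text \<open>Differentiability at \<open>0\<close>: the exponential wins against every power of
  \<open>1/h\<close>.\<close>

lemma flat_pow_quotient_tendsto: "((\<lambda>h. flat_pow m h / h) \<longlongrightarrow> 0) (at 0)"
proof -
  have 1: "((\<lambda>x::real. x ^ Suc m / exp x) \<longlongrightarrow> 0) at_top"
    by (rule tendsto_power_div_exp_0)
  have "((\<lambda>h. inverse h ^ Suc m / exp (inverse h)) \<longlongrightarrow> 0) (at_right (0::real))"
    by (rule filterlim_compose[OF 1 filterlim_inverse_at_top_right])
  then have "((\<lambda>h. flat_pow m h / h) \<longlongrightarrow> 0) (at_right (0::real))"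
    by (rule Lim_transform_eventually)
      (auto simp: eventually_at_right_field flat_pow_def exp_minus field_simps intro!: exI[of _ 1])
  moreover have "((\<lambda>h. flat_pow m h / h) \<longlongrightarrow> 0) (at_left (0::real))"
    by (rule Lim_transform_eventually[OF tendsto_const])
      (auto simp: eventually_at_left_field flat_pow_def intro!: exI[of _ "-1"])
  ultimately show ?thesis by (simp add: filterlim_split_at)
qed

lemma flat_pow_derivative:
  "(flat_pow m has_field_derivative flat_pow (m + 2) x - real m * flat_pow (m + 1) x) (at x)"
proof -
  consider "x < 0" | "x = 0" | "x > 0" by linarith
  then show ?thesis
  proof cases
    case 1
    show ?thesis
      by (rule has_field_derivative_transform_within_open[where S = "{..<0}" and f = "\<lambda>x. 0"])
        (use 1 in \<open>auto simp: flat_pow_def\<close>)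
  next
    case 2
    then show ?thesis using flat_pow_quotient_tendsto[of m]
      by (simp add: DERIV_def flat_pow_def)
  next
    case 3
    have "((\<lambda>x. exp (- inverse x) * inverse x ^ m) has_field_derivative
       exp (- inverse x) * (real m * (inverse x ^ (m - 1) * - (inverse x * inverse x)))
       + exp (- inverse x) * (inverse x * inverse x) * inverse x ^ m) (at x)"
      using 3 by (intro DERIV_mult' DERIV_power[THEN DERIV_cong] DERIV_fun_exp[THEN DERIV_cong]
          DERIV_minus[THEN DERIV_cong] DERIV_inverse[THEN DERIV_cong]) auto
    moreover have "exp (- inverse x) * (real m * (inverse x ^ (m - 1) * - (inverse x * inverse x)))
       + exp (- inverse x) * (inverse x * inverse x) * inverse x ^ m
       = flat_pow (m + 2) x - real m * flat_pow (m + 1) x"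
      using 3 by (cases m) (simp_all add: flat_pow_def algebra_simps)
    ultimately have "((\<lambda>x. exp (- inverse x) * inverse x ^ m) has_field_derivative
       flat_pow (m + 2) x - real m * flat_pow (m + 1) x) (at x)" by simp
    then show ?thesis
      by (rule has_field_derivative_transform_within_open[where S = "{0<..}"])
        (use 3 in \<open>auto simp: flat_pow_def\<close>)
  qed
qed

lemma smooth_on_flat_pow: "smooth_on UNIV (flat_pow m)"
  unfolding smooth_on_def
proof
  fix k show "ck_on k UNIV (flat_pow m)"
  proof (induction k arbitrary: m)
    case 0
    show ?case using DERIV_isCont[OF flat_pow_derivative]
      by (auto intro!: continuous_at_imp_continuous_on)
  next
    case (Suc k)
    show ?case
    proof (rule ck_on_SucI[where f' = "\<lambda>x v. (flat_pow (m + 2) x + (- real m) * flat_pow (m + 1) x) * v"])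
      show "(flat_pow m has_derivative (\<lambda>v. (flat_pow (m + 2) x + - real m * flat_pow (m + 1) x) * v)) (at x)" for x
        using flat_pow_derivative[of m x] by (simp add: has_field_derivative_def)
      show "ck_on k UNIV (\<lambda>x. (flat_pow (m + 2) x + - real m * flat_pow (m + 1) x) * v)" for v
        by (intro ck_on_bilinear[OF _ bounded_bilinear_mult] ck_on_add ck_on_const Suc) auto
    qed simp
  qed
qed

subsection \<open>Symmetry of second derivatives\<close>

text \<open>The mean value theorem, first in the direction \<open>u\<close> and then in the direction
  \<open>v\<close>.\<close>

lemma second_difference:
  fixes f :: "'a::real_normed_vector \<Rightarrow> real"
  assumes "\<And>s t. 0 \<le> s \<Longrightarrow> s \<le> h \<Longrightarrow> 0 \<le> t \<Longrightarrow> t \<le> h \<Longrightarrow> x + s *\<^sub>R u + t *\<^sub>R v \<in> S"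
    and "smooth_on S f" "h > 0"
  shows "\<exists>s t. 0 < s \<and> s < h \<and> 0 < t \<and> t < h \<and>
    f (x + h *\<^sub>R u + h *\<^sub>R v) - f (x + h *\<^sub>R u) - f (x + h *\<^sub>R v) + f x
      = h * h * frechet_derivative (\<lambda>y. frechet_derivative f (at y) u) (at (x + s *\<^sub>R u + t *\<^sub>R v)) v"
proof -
  let ?D = "\<lambda>w y. frechet_derivative f (at y) w"
  have d: "((\<lambda>s. g (x + s *\<^sub>R u + t *\<^sub>R v)) has_real_derivative frechet_derivative g (at (x + s *\<^sub>R u + t *\<^sub>R v)) u) (at s)"
    if "smooth_on S g" "0 \<le> s" "s \<le> h" "0 \<le> t" "t \<le> h" for g :: "'a \<Rightarrow> real" and s t
  proof -
    have g: "(g has_derivative frechet_derivative g (at (x + s *\<^sub>R u + t *\<^sub>R v))) (at (x + s *\<^sub>R u + t *\<^sub>R v))"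
      using smooth_on_has_derivative[OF that(1) assms(1)] that by simp
    have line: "((\<lambda>s. x + s *\<^sub>R u + t *\<^sub>R v) has_derivative (\<lambda>r. r *\<^sub>R u)) (at s)"
      by (auto intro!: derivative_eq_intros)
    show ?thesis unfolding has_field_derivative_def
      by (rule has_derivative_eq_rhs[OF has_derivative_compose[OF line g]])
        (simp add: linear_cmul[OF has_derivative_linear[OF g]] fun_eq_iff)
  qed
  have e: "((\<lambda>t. g (x + s *\<^sub>R u + t *\<^sub>R v)) has_real_derivative frechet_derivative g (at (x + s *\<^sub>R u + t *\<^sub>R v)) v) (at t)"
    if "smooth_on S g" "0 \<le> s" "s \<le> h" "0 \<le> t" "t \<le> h" for g :: "'a \<Rightarrow> real" and s t
  proof -
    have g: "(g has_derivative frechet_derivative g (at (x + s *\<^sub>R u + t *\<^sub>R v))) (at (x + s *\<^sub>R u + t *\<^sub>R v))"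
      using smooth_on_has_derivative[OF that(1) assms(1)] that by simp
    have line: "((\<lambda>t. x + s *\<^sub>R u + t *\<^sub>R v) has_derivative (\<lambda>r. r *\<^sub>R v)) (at t)"
      by (auto intro!: derivative_eq_intros)
    show ?thesis unfolding has_field_derivative_def
      by (rule has_derivative_eq_rhs[OF has_derivative_compose[OF line g]])
        (simp add: linear_cmul[OF has_derivative_linear[OF g]] fun_eq_iff)
  qed
  have "\<exists>s>0. s < h \<and> (f (x + h *\<^sub>R u + h *\<^sub>R v) - f (x + h *\<^sub>R u + 0 *\<^sub>R v)) - (f (x + 0 *\<^sub>R u + h *\<^sub>R v) - f (x + 0 *\<^sub>R u + 0 *\<^sub>R v))
      = (h - 0) * (?D u (x + s *\<^sub>R u + h *\<^sub>R v) - ?D u (x + s *\<^sub>R u + 0 *\<^sub>R v))"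
    by (rule MVT2[where f = "\<lambda>s. f (x + s *\<^sub>R u + h *\<^sub>R v) - f (x + s *\<^sub>R u + 0 *\<^sub>R v)"])
      (use \<open>h > 0\<close> in \<open>auto intro!: DERIV_diff d[OF assms(2)] d[OF assms(2), of _ 0, simplified]\<close>)
  then obtain s where s: "0 < s" "s < h"
    "f (x + h *\<^sub>R u + h *\<^sub>R v) - f (x + h *\<^sub>R u) - f (x + h *\<^sub>R v) + f x
      = h * (?D u (x + s *\<^sub>R u + h *\<^sub>R v) - ?D u (x + s *\<^sub>R u))" by auto
  have "\<exists>t>0. t < h \<and> ?D u (x + s *\<^sub>R u + h *\<^sub>R v) - ?D u (x + s *\<^sub>R u + 0 *\<^sub>R v)
      = (h - 0) * frechet_derivative (?D u) (at (x + s *\<^sub>R u + t *\<^sub>R v)) v"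
    by (rule MVT2[where f = "\<lambda>t. ?D u (x + s *\<^sub>R u + t *\<^sub>R v)"])
      (use \<open>h > 0\<close> s in \<open>auto intro!: e smooth_on_frechet_derivative[OF assms(2)]\<close>)
  then show ?thesis using s by auto
qed

text \<open>The second difference is symmetric in \<open>u\<close> and \<open>v\<close>, so both mixed
  derivatives take a common value arbitrarily close to \<open>x\<close>, at different points;
  continuity does the rest.\<close>

lemma second_derivative_commute_real:
  fixes f :: "'a::real_normed_vector \<Rightarrow> real"
  assumes "open S" "smooth_on S f" "x \<in> S"
  shows "frechet_derivative (\<lambda>y. frechet_derivative f (at y) u) (at x) v
       = frechet_derivative (\<lambda>y. frechet_derivative f (at y) v) (at x) u" (is "?F u v x = ?F v u x")
proof (rule ccontr)
  assume ne: "?F u v x \<noteq> ?F v u x"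
  define \<epsilon> where "\<epsilon> = dist (?F u v x) (?F v u x) / 2"
  have "\<epsilon> > 0" using ne by (simp add: \<epsilon>_def)
  have cont: "isCont (?F u v) x" for u v
    using smooth_on_continuous_on[OF smooth_on_frechet_derivative[OF smooth_on_frechet_derivative[OF assms(2)]]]
      assms continuous_on_eq_continuous_at by blast
  obtain d1 where d1: "d1 > 0" "\<And>y. dist y x < d1 \<Longrightarrow> dist (?F u v y) (?F u v x) < \<epsilon>"
    using cont[of u v] \<open>\<epsilon> > 0\<close> unfolding continuous_at_eps_delta by blast
  obtain d2 where d2: "d2 > 0" "\<And>y. dist y x < d2 \<Longrightarrow> dist (?F v u y) (?F v u x) < \<epsilon>"
    using cont[of v u] \<open>\<epsilon> > 0\<close> unfolding continuous_at_eps_delta by blast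
  obtain d3 where d3: "d3 > 0" "ball x d3 \<subseteq> S" using assms open_contains_ball by blast
  define d where "d = min d1 (min d2 d3)"
  \<comment> \<open>The choice of \<open>h\<close> keeps the parallelogram with sides \<open>h u\<close> and \<open>h v\<close> within distance \<open>d\<close> of \<open>x\<close>.\<close>
  define N where "N = norm u + norm v + 1"
  define h where "h = d / (2 * N)"
  have pos: "N > 0" using norm_ge_zero[of u] norm_ge_zero[of v] unfolding N_def by linarith
  have "d > 0" using d1 d2 d3 by (simp add: d_def)
  then have "h > 0" using pos by (simp add: h_def)
  have near: "dist (x + s *\<^sub>R u + t *\<^sub>R v) x < d" if "0 \<le> s" "s \<le> h" "0 \<le> t" "t \<le> h" for s t
  proof -
    have "dist (x + s *\<^sub>R u + t *\<^sub>R v) x = norm (s *\<^sub>R u + t *\<^sub>R v)" by (simp add: dist_norm)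
    also have "\<dots> \<le> s * norm u + t * norm v" using norm_triangle_ineq[of "s *\<^sub>R u" "t *\<^sub>R v"] that by simp
    also have "\<dots> \<le> h * norm u + h * norm v" using that by (intro add_mono mult_right_mono) auto
    also have "\<dots> \<le> h * N" using \<open>h > 0\<close> by (simp add: N_def algebra_simps)
    also have "\<dots> < d" using pos \<open>d > 0\<close> by (simp add: h_def)
    finally show ?thesis .
  qed
  have inS: "x + s *\<^sub>R u + t *\<^sub>R v \<in> S" if "0 \<le> s" "s \<le> h" "0 \<le> t" "t \<le> h" for s t
    using near[OF that] d3 by (auto simp: d_def dist_commute)
  obtain s t where st: "0 < s" "s < h" "0 < t" "t < h"
    "f (x + h *\<^sub>R u + h *\<^sub>R v) - f (x + h *\<^sub>R u) - f (x + h *\<^sub>R v) + f x = h * h * ?F u v (x + s *\<^sub>R u + t *\<^sub>R v)"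
    using second_difference[OF inS assms(2) \<open>h > 0\<close>] by blast
  have inS': "x + s *\<^sub>R v + t *\<^sub>R u \<in> S" if "0 \<le> s" "s \<le> h" "0 \<le> t" "t \<le> h" for s t
    using inS[of t s] that by (simp add: algebra_simps)
  obtain s' t' where st': "0 < s'" "s' < h" "0 < t'" "t' < h"
    "f (x + h *\<^sub>R v + h *\<^sub>R u) - f (x + h *\<^sub>R v) - f (x + h *\<^sub>R u) + f x = h * h * ?F v u (x + s' *\<^sub>R v + t' *\<^sub>R u)"
    using second_difference[OF inS' assms(2) \<open>h > 0\<close>] by blast
  have sw: "x + h *\<^sub>R v + h *\<^sub>R u = x + h *\<^sub>R u + h *\<^sub>R v" "x + s' *\<^sub>R v + t' *\<^sub>R u = x + t' *\<^sub>R u + s' *\<^sub>R v"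
    by (simp_all add: algebra_simps)
  have eq: "?F u v (x + s *\<^sub>R u + t *\<^sub>R v) = ?F v u (x + t' *\<^sub>R u + s' *\<^sub>R v)"
    using st(5) st'(5) \<open>h > 0\<close> unfolding sw by (simp add: algebra_simps)
  have "dist (?F u v (x + s *\<^sub>R u + t *\<^sub>R v)) (?F u v x) < \<epsilon>"
    by (rule d1(2)) (use near[of s t] st in \<open>auto simp: d_def\<close>)
  moreover have "dist (?F v u (x + t' *\<^sub>R u + s' *\<^sub>R v)) (?F v u x) < \<epsilon>"
    by (rule d2(2)) (use near[of t' s'] st' in \<open>auto simp: d_def\<close>)
  ultimately show False using eq dist_triangle_half_r unfolding \<epsilon>_def by fastforce
qed

lemma frechet_derivative_bounded_linear:
  "bounded_linear L \<Longrightarrow> f differentiable at x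
    \<Longrightarrow> frechet_derivative (\<lambda>y. L (f y)) (at x) v = L (frechet_derivative f (at x) v)"
  using frechet_derivative_at[OF bounded_linear.has_derivative[OF _ iffD1[OF frechet_derivative_works]]]
  by metis

lemma second_derivative_commute:
  fixes f :: "'a::real_normed_vector \<Rightarrow> complex"
  assumes "open S" "smooth_on S f" "x \<in> S"
  shows "frechet_derivative (\<lambda>y. frechet_derivative f (at y) u) (at x) v
       = frechet_derivative (\<lambda>y. frechet_derivative f (at y) v) (at x) u"
proof -
  have *: "L (frechet_derivative (\<lambda>y. frechet_derivative f (at y) u) (at x) v)
      = frechet_derivative (\<lambda>y. frechet_derivative (\<lambda>z. L (f z)) (at y) u) (at x) v"
    if L: "bounded_linear L" for L :: "complex \<Rightarrow> real" and u v
  proof -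
    have "frechet_derivative (\<lambda>y. frechet_derivative (\<lambda>z. L (f z)) (at y) u) (at x)
        = frechet_derivative (\<lambda>y. L (frechet_derivative f (at y) u)) (at x)"
      by (rule frechet_derivative_transform_within_open[OF smooth_on_differentiable[OF
              smooth_on_frechet_derivative[OF smooth_on_bounded_linear[OF assms(1) L assms(2)]] assms(3)]
            assms(1,3) frechet_derivative_bounded_linear[OF L smooth_on_differentiable[OF assms(2)]]])
    then show ?thesis
      using frechet_derivative_bounded_linear[OF L smooth_on_differentiable[OF
            smooth_on_frechet_derivative[OF assms(2)] assms(3)]] by simp
  qed
  note c = second_derivative_commute_real[OF assms(1) smooth_on_bounded_linear[OF assms(1) _ assms(2)] assms(3)]
  show ?thesis
    by (rule complex_eqI; subst (1 2) *)
      (auto intro: c bounded_linear_Re bounded_linear_Im)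
qed

section \<open>Calculus of Wirtinger derivatives\<close>

text \<open>The Wirtinger derivative as a function of the differential, which separates the linear algebra
  from the differentiability conditions.\<close>

definition wirtinger_part :: "'n + 'n \<Rightarrow> (complex^'n::finite \<Rightarrow> complex) \<Rightarrow> complex" where
  "wirtinger_part a D = (case a of
      Inl i \<Rightarrow> (D (axis i 1) - \<i> * D (axis i \<i>)) / 2
    | Inr i \<Rightarrow> (D (axis i 1) + \<i> * D (axis i \<i>)) / 2)"

lemma wirtinger_eq': "wirtinger a f z = wirtinger_part a (frechet_derivative f (at z))"
  unfolding wirtinger_def wirtinger_part_def by (simp add: Let_def)

lemma wirtinger_eq: "(f has_derivative D) (at z) \<Longrightarrow> wirtinger a f z = wirtinger_part a D"
  unfolding wirtinger_eq' using frechet_derivative_at[of f D z] by simp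

lemma wirtinger_cong:
  assumes "open S" "z \<in> S" "f differentiable at z" "\<And>w. w \<in> S \<Longrightarrow> f w = g w"
  shows "wirtinger a f z = wirtinger a g z"
  unfolding wirtinger_eq' using frechet_derivative_transform_within_open[OF assms(3,1,2,4)] by simp

lemma wirtinger_const [simp]: "wirtinger a (\<lambda>z. c) z = 0"
  by (simp add: wirtinger_eq' wirtinger_part_def split: sum.split)

lemma wirtinger_add:
  assumes "f differentiable at z" "g differentiable at z"
  shows "wirtinger a (\<lambda>w. f w + g w) z = wirtinger a f z + wirtinger a g z"
  using wirtinger_eq[OF has_derivative_add[OF assms[unfolded frechet_derivative_works]]]
  by (simp add: wirtinger_eq' wirtinger_part_def algebra_simps add_divide_distrib diff_divide_distrib split: sum.split)

lemma wirtinger_mult: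
  assumes "f differentiable at z" "g differentiable at z"
  shows "wirtinger a (\<lambda>w. f w * g w) z = wirtinger a f z * g z + f z * wirtinger a g z"
  using wirtinger_eq[OF has_derivative_mult[OF assms[unfolded frechet_derivative_works]]]
  by (simp add: wirtinger_eq' wirtinger_part_def algebra_simps add_divide_distrib diff_divide_distrib split: sum.split)

lemma wirtinger_cmult:
  assumes "f differentiable at z"
  shows "wirtinger a (\<lambda>w. c * f w) z = c * wirtinger a f z"
  using wirtinger_mult[OF _ assms, of "\<lambda>w. c"] by simp

lemma wirtinger_uminus:
  assumes "f differentiable at z"
  shows "wirtinger a (\<lambda>w. - f w) z = - wirtinger a f z"
  using wirtinger_cmult[OF assms, of a "-1"] by simp

lemma wirtinger_diff:
  assumes "f differentiable at z" "g differentiable at z"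
  shows "wirtinger a (\<lambda>w. f w - g w) z = wirtinger a f z - wirtinger a g z"
  using wirtinger_add[OF assms(1), of "\<lambda>w. - g w" a] wirtinger_uminus[OF assms(2)] assms(2) by simp

lemma wirtinger_sum:
  assumes "\<And>i. i \<in> I \<Longrightarrow> f i differentiable at z"
  shows "wirtinger a (\<lambda>w. \<Sum>i\<in>I. f i w) z = (\<Sum>i\<in>I. wirtinger a (f i) z)"
  using assms
proof (induction I rule: infinite_finite_induct)
  case (insert i I)
  have "(\<lambda>w. \<Sum>i\<in>I. f i w) differentiable at z" using insert by (intro differentiable_sum) auto
  then show ?case using insert wirtinger_add[of "f i" z "\<lambda>w. \<Sum>i\<in>I. f i w" a] by simp
qed auto

lemma wirtinger_cnj:
  assumes "f differentiable at z"
  shows "wirtinger a (\<lambda>w. cnj (f w)) z = cnj (wirtinger (conj_index a) f z)"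
  using wirtinger_eq[OF has_derivative_cnj[OF assms[unfolded frechet_derivative_works]]]
  by (simp add: wirtinger_eq' wirtinger_part_def conj_index_def split: sum.split)

lemma sum_index: "(\<Sum>a\<in>(UNIV :: ('n + 'n::finite) set). f a) = (\<Sum>i\<in>UNIV. f (Inl i)) + (\<Sum>i\<in>UNIV. f (Inr i))"
  by (subst UNIV_Plus_UNIV[symmetric], subst sum.Plus) simp_all

text \<open>The formula \<open>df = \<Sum>\<^sub>a \<partial>\<^sub>af dz\<^sup>a\<close>, where
  \<open>a\<close> runs through the holomorphic and the conjugate directions.\<close>

lemma linear_wirtinger_expansion:
  assumes "linear D"
  shows "D v = (\<Sum>a\<in>UNIV. wirtinger_part a D * coord_fun a v)"
proof -
  have ax: "axis i (v $ i) = Re (v $ i) *\<^sub>R axis i 1 + Im (v $ i) *\<^sub>R axis i \<i>" for i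
    by (simp add: vec_eq_iff axis_def complex_eq_iff)
  have "D v = D (\<Sum>i\<in>UNIV. axis i (v $ i))"
    by (rule arg_cong[of _ _ D]) (simp add: vec_eq_iff axis_def if_distrib cong: if_cong)
  also have "\<dots> = (\<Sum>i\<in>UNIV. Re (v $ i) *\<^sub>R D (axis i 1) + Im (v $ i) *\<^sub>R D (axis i \<i>))"
    by (simp add: linear_sum[OF assms] ax linear_add[OF assms] linear_cmul[OF assms])
  also have "\<dots> = (\<Sum>i\<in>UNIV. wirtinger_part (Inl i) D * v $ i + wirtinger_part (Inr i) D * cnj (v $ i))"
  proof (rule sum.cong[OF refl])
    fix i
    obtain x y where xy: "v $ i = Complex x y" by (cases "v $ i")
    show "Re (v $ i) *\<^sub>R D (axis i 1) + Im (v $ i) *\<^sub>R D (axis i \<i>)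
        = wirtinger_part (Inl i) D * v $ i + wirtinger_part (Inr i) D * cnj (v $ i)"
      unfolding xy wirtinger_part_def by (simp add: complex_eq_iff field_simps)
  qed
  finally show ?thesis by (simp add: sum_index sum.distrib coord_fun_def)
qed

lemma bounded_linear_coord_fun: "bounded_linear (coord_fun a)"
  by (cases a) (auto simp: coord_fun_def[abs_def] bounded_linear_vec_nth
      intro: bounded_linear_compose[OF bounded_linear_cnj bounded_linear_vec_nth])

lemma wirtinger_chain:
  assumes "\<tau> differentiable at z" "f differentiable at (\<tau> z)"
  shows "wirtinger b (\<lambda>w. f (\<tau> w)) z = (\<Sum>a\<in>UNIV. wirtinger a f (\<tau> z) * jacobian \<tau> z a b)"
proof -
  let ?T = "frechet_derivative \<tau> (at z)" and ?F = "frechet_derivative f (at (\<tau> z))"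
  have T: "(\<tau> has_derivative ?T) (at z)" and F: "(f has_derivative ?F) (at (\<tau> z))"
    using assms frechet_derivative_works by blast+
  have "wirtinger b (\<lambda>w. f (\<tau> w)) z = wirtinger_part b (\<lambda>v. ?F (?T v))"
    by (rule wirtinger_eq[OF has_derivative_compose[OF T F]])
  also have "(\<lambda>v. ?F (?T v)) = (\<lambda>v. \<Sum>a\<in>UNIV. wirtinger a f (\<tau> z) * coord_fun a (?T v))"
    using linear_wirtinger_expansion[OF has_derivative_linear[OF F]] by (simp add: wirtinger_eq' fun_eq_iff)
  also have "wirtinger_part b \<dots> = (\<Sum>a\<in>UNIV. wirtinger a f (\<tau> z) * wirtinger_part b (\<lambda>v. coord_fun a (?T v)))"
    by (cases b) (simp_all add: wirtinger_part_def sum_distrib_left sum.distrib[symmetric]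
        sum_subtractf[symmetric] sum_divide_distrib algebra_simps)
  moreover have "wirtinger_part b (\<lambda>v. coord_fun a (?T v)) = jacobian \<tau> z a b" for a
    unfolding jacobian_def
    by (rule wirtinger_eq[symmetric, OF bounded_linear.has_derivative[OF bounded_linear_coord_fun T]])
  ultimately show ?thesis by simp
qed

lemma smooth_on_wirtinger:
  assumes "open S" "smooth_on S f" shows "smooth_on S (wirtinger a f)"
proof -
  define s :: complex where "s = (case a of Inl _ \<Rightarrow> - \<i> / 2 | Inr _ \<Rightarrow> \<i> / 2)"
  define e where "e = (case a of Inl i \<Rightarrow> i | Inr i \<Rightarrow> i)"
  have "wirtinger a f = (\<lambda>z. 1/2 * frechet_derivative f (at z) (axis e 1)
      + s * frechet_derivative f (at z) (axis e \<i>))"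
    by (simp add: fun_eq_iff wirtinger_eq' wirtinger_part_def s_def e_def field_simps split: sum.split)
  moreover have "smooth_on S (\<lambda>z. 1/2 * frechet_derivative f (at z) (axis e 1)
      + s * frechet_derivative f (at z) (axis e \<i>))"
    by (rule smooth_on_add[OF assms(1)]; rule smooth_on_mult[OF assms(1)];
      rule smooth_on_const[OF assms(1)] smooth_on_frechet_derivative[OF assms(2)])
  ultimately show ?thesis by simp
qed

text \<open>Wirtinger derivatives are constant linear combinations of real partial derivatives.\<close>

lemma wirtinger_commute:
  assumes "open S" "smooth_on S f" "z \<in> S"
  shows "wirtinger a (wirtinger b f) z = wirtinger b (wirtinger a f) z"
proof -
  let ?D = "\<lambda>v w. frechet_derivative f (at w) v"
  define s :: "'a + 'a \<Rightarrow> complex" where "s a = (case a of Inl _ \<Rightarrow> - \<i> | Inr _ \<Rightarrow> \<i>)" for a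
  define e :: "'a + 'a \<Rightarrow> 'a" where "e a = (case a of Inl i \<Rightarrow> i | Inr i \<Rightarrow> i)" for a
  have wp: "wirtinger_part a D = 1/2 * D (axis (e a) 1) + s a / 2 * D (axis (e a) \<i>)" for a D
    by (simp add: wirtinger_part_def s_def e_def field_simps split: sum.split)
  have sm: "smooth_on S (?D v)" for v by (rule smooth_on_frechet_derivative[OF assms(2)])
  have d: "(?D v has_derivative frechet_derivative (?D v) (at z)) (at z)" for v
    by (rule smooth_on_has_derivative[OF sm assms(3)])
  have "wirtinger a (wirtinger b f) z = wirtinger_part a (\<lambda>u.
      1/2 * frechet_derivative (?D (axis (e b) 1)) (at z) u
      + s b / 2 * frechet_derivative (?D (axis (e b) \<i>)) (at z) u)" for a b
  proof -
    have "wirtinger b f = (\<lambda>w. 1/2 * ?D (axis (e b) 1) w + s b / 2 * ?D (axis (e b) \<i>) w)"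
      by (simp add: fun_eq_iff wirtinger_eq' wp)
    then show ?thesis
      by (simp only:) (rule wirtinger_eq, intro has_derivative_add has_derivative_mult_right d)
  qed
  moreover define F where "F u v = frechet_derivative (?D u) (at z) v" for u v
  moreover have "F u v = F v u" for u v
    unfolding F_def by (rule second_derivative_commute[OF assms])
  ultimately show ?thesis
    by (simp add: wp algebra_simps)
qed

section \<open>Exterior algebra\<close>

definition contract :: "'n + 'n \<Rightarrow> 'n covec \<Rightarrow> 'n covec" where
  "contract x \<alpha> = (\<lambda>ys. \<alpha> (x # ys))"

text \<open>The sign \<open>(-1)\<^sup>p\<close> in degree \<open>p\<close>, which is the cost of moving a
  direction past a covector of degree \<open>p\<close>.\<close>

definition parity_sign :: "'n covec \<Rightarrow> 'n covec" where
  "parity_sign \<alpha> = (\<lambda>ys. (-1) ^ length ys * \<alpha> ys)"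

lemma contract_apply: "contract x \<alpha> ys = \<alpha> (x # ys)"
  by (simp add: contract_def)

lemma parity_sign_parity_sign [simp]: "parity_sign (parity_sign \<alpha>) = \<alpha>"
  by (simp add: parity_sign_def fun_eq_iff flip: mult.assoc power_add)

lemma contract_parity_sign: "contract x (parity_sign \<alpha>) = (\<lambda>ys. - parity_sign (contract x \<alpha>) ys)"
  by (simp add: parity_sign_def fun_eq_iff contract_apply)

lemma wedge_Nil [simp]: "wedge \<alpha> \<beta> [] = \<alpha> [] * \<beta> []"
  by (simp add: wedge_def)

text \<open>Contraction is an antiderivation. In the shuffle product the first direction \<open>x\<close> goes
  either to \<open>\<alpha>\<close>, at no cost, or to \<open>\<beta>\<close>, and then it passes
  all directions that go to \<open>\<alpha>\<close>. This recursion replaces the sum over subsets in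
  all that follows.\<close>

lemma wedge_Cons:
  "wedge \<alpha> \<beta> (x # xs) = wedge (contract x \<alpha>) \<beta> xs + wedge (parity_sign \<alpha>) (contract x \<beta>) xs"
proof -
  let ?n = "length xs"
  define inv where "inv n S = {(i, j). i \<in> S \<and> j \<in> {..<n} - S \<and> j < i}" for n :: nat and S
  let ?f = "\<lambda>S. (-1) ^ card (inv (Suc ?n) S) * \<alpha> (nths (x # xs) S) * \<beta> (nths (x # xs) (- S))"
  have disj: "Pow {..<Suc ?n} = (\<lambda>T. insert 0 (Suc ` T)) ` Pow {..<?n} \<union> (`) Suc ` Pow {..<?n}"
  proof (intro equalityI subsetI)
    fix S assume S: "S \<in> Pow {..<Suc ?n}"
    define T where "T = {j. Suc j \<in> S}"
    have T: "T \<in> Pow {..<?n}" using S by (auto simp: T_def)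
    have "S = (if 0 \<in> S then insert 0 (Suc ` T) else Suc ` T)"
    proof (intro set_eqI)
      fix i show "i \<in> S \<longleftrightarrow> i \<in> (if 0 \<in> S then insert 0 (Suc ` T) else Suc ` T)"
        by (cases i) (auto simp: T_def)
    qed
    then show "S \<in> (\<lambda>T. insert 0 (Suc ` T)) ` Pow {..<?n} \<union> (`) Suc ` Pow {..<?n}"
      using T by (auto split: if_splits)
  qed auto
  have "sum ?f (Pow {..<Suc ?n})
      = sum ?f ((\<lambda>T. insert 0 (Suc ` T)) ` Pow {..<?n}) + sum ?f ((`) Suc ` Pow {..<?n})"
    unfolding disj by (rule sum.union_disjoint) auto
  also have "sum ?f ((\<lambda>T. insert 0 (Suc ` T)) ` Pow {..<?n})
      = (\<Sum>T\<in>Pow {..<?n}. ?f (insert 0 (Suc ` T)))"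
  proof (rule sum.reindex_cong[OF _ refl refl])
    show "inj_on (\<lambda>T. insert 0 (Suc ` T)) (Pow {..<?n})"
      by (rule inj_onI) (auto simp: set_eq_iff image_iff)
  qed
  also have "(\<Sum>T\<in>Pow {..<?n}. ?f (insert 0 (Suc ` T))) = wedge (contract x \<alpha>) \<beta> xs"
    unfolding wedge_def
  proof (rule sum.cong[OF refl])
    fix T assume T: "T \<in> Pow {..<?n}"
    have "inv (Suc ?n) (insert 0 (Suc ` T)) = map_prod Suc Suc ` inv ?n T"
    proof (intro set_eqI)
      fix p :: "nat \<times> nat" obtain i j where p: "p = (i, j)" by (cases p)
      show "p \<in> inv (Suc ?n) (insert 0 (Suc ` T)) \<longleftrightarrow> p \<in> map_prod Suc Suc ` inv ?n T"
        unfolding p inv_def by (cases i; cases j) (auto simp: image_iff)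
    qed
    moreover have "inj_on (map_prod Suc Suc) (inv ?n T)" by (auto simp: inj_on_def)
    ultimately have "card (inv (Suc ?n) (insert 0 (Suc ` T))) = card (inv ?n T)"
      by (simp add: card_image)
    moreover have "{j. Suc j \<in> insert 0 (Suc ` T)} = T" "{j. Suc j \<in> - insert 0 (Suc ` T)} = - T" by auto
    ultimately show "?f (insert 0 (Suc ` T)) = (-1) ^ card {(i, j). i \<in> T \<and> j \<in> {..<?n} - T \<and> j < i}
        * contract x \<alpha> (nths xs T) * \<beta> (nths xs (- T))"
      by (simp add: nths_Cons contract_apply inv_def[of ?n])
  qed
  also have "sum ?f ((`) Suc ` Pow {..<?n}) = (\<Sum>T\<in>Pow {..<?n}. ?f (Suc ` T))"
  proof (rule sum.reindex_cong[OF _ refl refl])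
    show "inj_on ((`) Suc) (Pow {..<?n})"
      by (rule inj_onI) (auto simp: inj_image_eq_iff)
  qed
  also have "\<dots> = wedge (parity_sign \<alpha>) (contract x \<beta>) xs"
    unfolding wedge_def
  proof (rule sum.cong[OF refl])
    fix T assume T: "T \<in> Pow {..<?n}"
    then have fin: "finite T" using finite_subset by auto
    have "inv (Suc ?n) (Suc ` T) = map_prod Suc Suc ` inv ?n T \<union> (\<lambda>i. (Suc i, 0)) ` T"
    proof (intro set_eqI)
      fix p :: "nat \<times> nat" obtain i j where p: "p = (i, j)" by (cases p)
      show "p \<in> inv (Suc ?n) (Suc ` T) \<longleftrightarrow> p \<in> map_prod Suc Suc ` inv ?n T \<union> (\<lambda>i. (Suc i, 0)) ` T"
        unfolding p inv_def by (cases i; cases j) (auto simp: image_iff)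
    qed
    moreover have "finite (inv ?n T)"
      by (rule finite_subset[of _ "T \<times> {..<?n}"]) (auto simp: inv_def fin)
    moreover have "inj_on (map_prod Suc Suc) (inv ?n T)" by (auto simp: inj_on_def)
    moreover have "inj_on (\<lambda>i. (Suc i, 0::nat)) T" by (auto simp: inj_on_def)
    moreover have "map_prod Suc Suc ` inv ?n T \<inter> (\<lambda>i. (Suc i, 0)) ` T = {}" by auto
    ultimately have "card (inv (Suc ?n) (Suc ` T)) = card (inv ?n T) + card T"
      using fin by (simp add: card_Un_disjoint card_image)
    moreover have "{j. Suc j \<in> Suc ` T} = T" "{j. Suc j \<in> - Suc ` T} = - T" by auto
    moreover have "length (nths xs T) = card T"
      using T by (auto simp: length_nths intro!: arg_cong[of _ _ card])
    ultimately show "?f (Suc ` T) = (-1) ^ card {(i, j). i \<in> T \<and> j \<in> {..<?n} - T \<and> j < i}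
        * parity_sign \<alpha> (nths xs T) * contract x \<beta> (nths xs (- T))"
      by (simp add: nths_Cons contract_apply inv_def[of ?n] parity_sign_def power_add)
  qed
  finally show ?thesis by (simp add: wedge_def inv_def)
qed

lemma contract_wedge:
  "contract x (wedge \<alpha> \<beta>) = (\<lambda>xs. wedge (contract x \<alpha>) \<beta> xs + wedge (parity_sign \<alpha>) (contract x \<beta>) xs)"
  by (simp add: fun_eq_iff wedge_Cons contract_apply)

lemma wedge_add_left: "wedge (\<lambda>ys. \<alpha> ys + \<alpha>' ys) \<beta> xs = wedge \<alpha> \<beta> xs + wedge \<alpha>' \<beta> xs"
  by (simp add: wedge_def algebra_simps sum.distrib)

lemma wedge_add_right: "wedge \<alpha> (\<lambda>ys. \<beta> ys + \<beta>' ys) xs = wedge \<alpha> \<beta> xs + wedge \<alpha> \<beta>' xs"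
  by (simp add: wedge_def algebra_simps sum.distrib)

lemma wedge_cmult_left: "wedge (\<lambda>ys. c * \<alpha> ys) \<beta> xs = c * wedge \<alpha> \<beta> xs"
  by (simp add: wedge_def sum_distrib_left mult_ac)

lemma wedge_cmult_right: "wedge \<alpha> (\<lambda>ys. c * \<beta> ys) xs = c * wedge \<alpha> \<beta> xs"
  by (simp add: wedge_def sum_distrib_left mult_ac)

lemma wedge_minus_left: "wedge (\<lambda>ys. - \<alpha> ys) \<beta> xs = - wedge \<alpha> \<beta> xs"
  using wedge_cmult_left[of "-1"] by simp

lemma wedge_minus_right: "wedge \<alpha> (\<lambda>ys. - \<beta> ys) xs = - wedge \<alpha> \<beta> xs"
  using wedge_cmult_right[of _ "-1"] by simp

lemma wedge_diff_left: "wedge (\<lambda>ys. \<alpha> ys - \<alpha>' ys) \<beta> xs = wedge \<alpha> \<beta> xs - wedge \<alpha>' \<beta> xs"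
  using wedge_add_left[of \<alpha> "\<lambda>ys. - \<alpha>' ys"] by (simp add: wedge_minus_left)

lemma wedge_diff_right: "wedge \<alpha> (\<lambda>ys. \<beta> ys - \<beta>' ys) xs = wedge \<alpha> \<beta> xs - wedge \<alpha> \<beta>' xs"
  using wedge_add_right[of \<alpha> \<beta> "\<lambda>ys. - \<beta>' ys"] by (simp add: wedge_minus_right)

lemma wedge_zero_left [simp]: "wedge (\<lambda>ys. 0) \<beta> xs = 0"
  using wedge_cmult_left[of 0] by simp

lemma wedge_zero_right [simp]: "wedge \<alpha> (\<lambda>ys. 0) xs = 0"
  using wedge_cmult_right[of _ 0] by simp

lemma wedge_sum_left: "wedge (\<lambda>ys. \<Sum>i\<in>I. \<alpha> i ys) \<beta> xs = (\<Sum>i\<in>I. wedge (\<alpha> i) \<beta> xs)"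
  by (induction I rule: infinite_finite_induct) (simp_all add: wedge_add_left)

lemma wedge_sum_right: "wedge \<alpha> (\<lambda>ys. \<Sum>i\<in>I. \<beta> i ys) xs = (\<Sum>i\<in>I. wedge \<alpha> (\<beta> i) xs)"
  by (induction I rule: infinite_finite_induct) (simp_all add: wedge_add_right)

lemma wedge_scalar_left: "wedge (\<lambda>ys. c * covec_one ys) \<beta> xs = c * \<beta> xs"
proof (induction xs arbitrary: \<beta>)
  case (Cons x xs)
  have "contract x (\<lambda>ys. c * covec_one ys) = (\<lambda>ys. 0)" "parity_sign (\<lambda>ys. c * covec_one ys :: complex) = (\<lambda>ys :: ('a + 'a) list. c * covec_one ys)"
    by (auto simp: fun_eq_iff covec_one_def parity_sign_def contract_apply)
  then show ?case by (simp add: wedge_Cons Cons contract_apply)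
qed (simp add: covec_one_def)

text \<open>Every term of the shuffle product distributes the directions \<open>xs\<close> over the two
  factors. This form of the statement is the source of all arguments by degree and type.\<close>

lemma wedge_eq_0I:
  "(\<And>ys zs. mset ys + mset zs = mset xs \<Longrightarrow> \<alpha> ys = 0 \<or> \<beta> zs = 0) \<Longrightarrow> wedge \<alpha> \<beta> xs = 0"
proof (induction xs arbitrary: \<alpha> \<beta>)
  case (Cons x xs)
  have "wedge (contract x \<alpha>) \<beta> xs = 0" by (rule Cons.IH) (use Cons.prems[of "x # _"] in \<open>auto simp: contract_apply\<close>)
  moreover have "wedge (parity_sign \<alpha>) (contract x \<beta>) xs = 0"
    by (rule Cons.IH) (use Cons.prems[of _ "x # _"] in \<open>auto simp: parity_sign_def contract_apply\<close>)
  ultimately show ?case by (simp add: wedge_Cons)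
qed auto

text \<open>Contraction changes the parity, so the statements for even and odd \<open>\<alpha>\<close> need
  each other in the induction.\<close>

lemma wedge_commute_even_odd:
  "((\<forall>ys. odd (length ys) \<longrightarrow> \<alpha> ys = 0) \<longrightarrow> wedge \<alpha> \<beta> xs = wedge \<beta> \<alpha> xs) \<and>
   ((\<forall>ys. even (length ys) \<longrightarrow> \<alpha> ys = 0) \<longrightarrow> wedge \<alpha> \<beta> xs = wedge (parity_sign \<beta>) \<alpha> xs)"
proof (induction xs arbitrary: \<alpha> \<beta>)
  case Nil
  show ?case by (simp add: parity_sign_def)
next
  case (Cons x xs)
  show ?case
  proof (intro conjI impI)
    assume even: "\<forall>ys. odd (length ys) \<longrightarrow> \<alpha> ys = 0"
    have "parity_sign \<alpha> = \<alpha>"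
    proof
      fix ys show "parity_sign \<alpha> ys = \<alpha> ys"
        using even by (cases "even (length ys)") (simp_all add: parity_sign_def)
    qed
    moreover have "wedge (contract x \<alpha>) \<beta> xs = wedge (parity_sign \<beta>) (contract x \<alpha>) xs"
      using even by (intro Cons.IH[THEN conjunct2, rule_format]) (simp add: contract_apply)
    moreover have "wedge \<alpha> (contract x \<beta>) xs = wedge (contract x \<beta>) \<alpha> xs"
      using even by (intro Cons.IH[THEN conjunct1, rule_format]) (simp add: contract_apply)
    ultimately show "wedge \<alpha> \<beta> (x # xs) = wedge \<beta> \<alpha> (x # xs)"
      unfolding wedge_Cons by (simp only: add.commute)
  next
    assume odd: "\<forall>ys. even (length ys) \<longrightarrow> \<alpha> ys = 0"
    have "parity_sign \<alpha> = (\<lambda>ys. - \<alpha> ys)"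
    proof
      fix ys show "parity_sign \<alpha> ys = - \<alpha> ys"
        using odd by (cases "even (length ys)") (simp_all add: parity_sign_def)
    qed
    moreover have "wedge (contract x \<alpha>) \<beta> xs = wedge \<beta> (contract x \<alpha>) xs"
      using odd by (intro Cons.IH[THEN conjunct1, rule_format]) (simp add: contract_apply)
    moreover have "wedge \<alpha> (contract x \<beta>) xs = wedge (parity_sign (contract x \<beta>)) \<alpha> xs"
      using odd by (intro Cons.IH[THEN conjunct2, rule_format]) (simp add: contract_apply)
    ultimately show "wedge \<alpha> \<beta> (x # xs) = wedge (parity_sign \<beta>) \<alpha> (x # xs)"
      unfolding wedge_Cons by (simp only: contract_parity_sign wedge_minus_left parity_sign_parity_sign add.commute)
  qed
qed

lemma wedge_commute_even:
  "(\<And>ys. odd (length ys) \<Longrightarrow> \<alpha> ys = 0) \<Longrightarrow> wedge \<alpha> \<beta> = wedge \<beta> \<alpha>"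
  using wedge_commute_even_odd[of \<alpha> \<beta>] by (auto simp: fun_eq_iff)

lemma alternating_contract: "alternating \<alpha> \<Longrightarrow> alternating (contract x \<alpha>)"
  unfolding alternating_def contract_apply by (metis append_Cons)

lemma alternatingD: "alternating \<alpha> \<Longrightarrow> \<alpha> (xs @ [a, b] @ ys) = - \<alpha> (xs @ [b, a] @ ys)"
  unfolding alternating_def by blast

lemma alternatingI: "(\<And>xs a b ys. \<alpha> (xs @ [a, b] @ ys) = - \<alpha> (xs @ [b, a] @ ys)) \<Longrightarrow> alternating \<alpha>"
  unfolding alternating_def by blast

lemma alternating_parity_sign:
  assumes "alternating \<alpha>" shows "alternating (parity_sign \<alpha>)"
proof (rule alternatingI)
  fix xs ys :: "('a + 'a) list" and a b
  show "parity_sign \<alpha> (xs @ [a, b] @ ys) = - parity_sign \<alpha> (xs @ [b, a] @ ys)"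
    unfolding parity_sign_def by (subst alternatingD[OF assms, of xs a b]) simp
qed

lemma alternating_wedge:
  assumes "alternating \<alpha>" "alternating \<beta>"
  shows "alternating (wedge \<alpha> \<beta>)"
proof -
  have "wedge \<alpha> \<beta> (xs @ [a, b] @ ys) = - wedge \<alpha> \<beta> (xs @ [b, a] @ ys)" for xs a b ys
    using assms
  proof (induction xs arbitrary: \<alpha> \<beta>)
    case Nil
    have swap: "contract b (contract a \<gamma>) = (\<lambda>ys. - contract a (contract b \<gamma>) ys)" if "alternating \<gamma>" for \<gamma>
      using alternatingD[OF that, of "[]" a b] by (simp add: fun_eq_iff contract_apply)
    show ?case using Nil
      by (simp add: wedge_Cons wedge_add_left wedge_minus_left wedge_minus_right contract_parity_sign swap[of \<alpha>] swap[of \<beta>])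
  next
    case (Cons x xs)
    show ?case
      using Cons.IH[OF alternating_contract[OF Cons.prems(1)] Cons.prems(2)]
        Cons.IH[OF alternating_parity_sign[OF Cons.prems(1)] alternating_contract[OF Cons.prems(2)]]
      by (simp add: wedge_Cons)
  qed
  then show ?thesis by (rule alternatingI)
qed

subsection \<open>Pullback of covectors\<close>

lemma finite_lists_of_length [simp]: "finite {as :: 'a::finite list. length as = n}"
  using finite_lists_length_eq[of "UNIV :: 'a set" n] by simp

lemma sum_lists_Suc:
  "(\<Sum>as\<in>{as :: 'a::finite list. length as = Suc n}. f as) = (\<Sum>a\<in>UNIV. \<Sum>as\<in>{as. length as = n}. f (a # as))"
proof -
  have "{as :: 'a list. length as = Suc n} = (\<lambda>(a, as). a # as) ` (UNIV \<times> {as. length as = n})"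
    by (auto simp: length_Suc_conv image_iff)
  moreover have "inj_on (\<lambda>(a, as). a # as) (UNIV \<times> {as :: 'a list. length as = n})" by (auto simp: inj_on_def)
  ultimately show ?thesis
    by (simp only: sum.reindex) (simp add: sum.cartesian_product case_prod_beta)
qed

lemma pullback_Nil [simp]: "pullback_at \<tau> z \<alpha> [] = \<alpha> []"
  by (simp add: pullback_at_def)

lemma pullback_Cons:
  "pullback_at \<tau> z \<alpha> (b # bs) = (\<Sum>a\<in>UNIV. jacobian \<tau> z a b * pullback_at \<tau> z (contract a \<alpha>) bs)"
  by (simp add: pullback_at_def sum_lists_Suc contract_apply prod.lessThan_Suc_shift sum_distrib_left mult_ac del: prod.lessThan_Suc)

lemma contract_pullback:
  "contract b (pullback_at \<tau> z \<alpha>) = (\<lambda>bs. \<Sum>a\<in>UNIV. jacobian \<tau> z a b * pullback_at \<tau> z (contract a \<alpha>) bs)"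
  by (simp add: fun_eq_iff pullback_Cons contract_apply)

lemma pullback_add: "pullback_at \<tau> z (\<lambda>as. \<alpha> as + \<beta> as) bs = pullback_at \<tau> z \<alpha> bs + pullback_at \<tau> z \<beta> bs"
  by (simp add: pullback_at_def algebra_simps sum.distrib)

lemma pullback_cmult: "pullback_at \<tau> z (\<lambda>as. c * \<alpha> as) bs = c * pullback_at \<tau> z \<alpha> bs"
  by (simp add: pullback_at_def sum_distrib_left mult_ac)

lemma pullback_minus: "pullback_at \<tau> z (\<lambda>as. - \<alpha> as) bs = - pullback_at \<tau> z \<alpha> bs"
  using pullback_cmult[of _ _ "-1"] by simp

lemma pullback_diff: "pullback_at \<tau> z (\<lambda>as. \<alpha> as - \<beta> as) bs = pullback_at \<tau> z \<alpha> bs - pullback_at \<tau> z \<beta> bs"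
  using pullback_add[of _ _ \<alpha> "\<lambda>as. - \<beta> as"] by (simp add: pullback_minus)

lemma pullback_parity_sign: "pullback_at \<tau> z (parity_sign \<alpha>) = parity_sign (pullback_at \<tau> z \<alpha>)"
  by (rule ext) (simp add: pullback_at_def parity_sign_def sum_distrib_left mult_ac)

text \<open>Both sides satisfy the same recursion, because contraction after pullback is a combination of
  pullbacks of contractions.\<close>

lemma pullback_wedge:
  "pullback_at \<tau> z (wedge \<alpha> \<beta>) bs = wedge (pullback_at \<tau> z \<alpha>) (pullback_at \<tau> z \<beta>) bs"
proof (induction bs arbitrary: \<alpha> \<beta>)
  case (Cons b bs)
  show ?case
    by (simp add: wedge_Cons pullback_Cons contract_wedge contract_pullback pullback_add Cons
        pullback_parity_sign wedge_sum_left wedge_sum_right wedge_cmult_left wedge_cmult_right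
        sum.distrib algebra_simps)
qed simp

section \<open>The exterior derivative in a chart\<close>

text \<open>The expression of \<^const>\<open>partial_ext\<close> in a single chart.\<close>

definition local_ext ::
    "('n + 'n \<Rightarrow> bool) \<Rightarrow> (complex^'n::finite \<Rightarrow> 'n covec) \<Rightarrow> complex^'n \<Rightarrow> 'n covec" where
  "local_ext P w z xs = (\<Sum>i | i < length xs \<and> P (xs ! i).
     (-1) ^ i * wirtinger (xs ! i) (\<lambda>u. w u (take i xs @ drop (Suc i) xs)) z)"

abbreviation local_d :: "(complex^'n::finite \<Rightarrow> 'n covec) \<Rightarrow> complex^'n \<Rightarrow> 'n covec" where
  "local_d \<equiv> local_ext (\<lambda>_. True)"

lemma local_ext_Nil [simp]: "local_ext P w z [] = 0"
  by (simp add: local_ext_def)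

text \<open>Cartan's formula for the constant vector field \<open>x\<close>: contraction with \<open>x\<close>
  and \<open>d\<close> anticommute up to the derivative in the direction \<open>x\<close>.\<close>

lemma local_ext_Cons:
  "local_ext P w z (x # xs) = (if P x then wirtinger x (\<lambda>u. w u xs) z else 0)
     - local_ext P (\<lambda>u. contract x (w u)) z xs"
proof -
  let ?f = "\<lambda>i. (-1) ^ i * wirtinger ((x # xs) ! i) (\<lambda>u. w u (take i (x # xs) @ drop (Suc i) (x # xs))) z"
  have "local_ext P w z (x # xs) = (\<Sum>i<Suc (length xs). if P ((x # xs) ! i) then ?f i else 0)"
    unfolding local_ext_def
    by (subst sum.inter_filter[symmetric]) (auto intro!: sum.cong)
  also have "\<dots> = (if P x then ?f 0 else 0) + (\<Sum>i<length xs. if P (xs ! i) then ?f (Suc i) else 0)"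
    by (subst sum.lessThan_Suc_shift) simp
  also have "(\<Sum>i<length xs. if P (xs ! i) then ?f (Suc i) else 0) = - local_ext P (\<lambda>u. contract x (w u)) z xs"
    unfolding local_ext_def
    by (subst sum.inter_filter[symmetric]) (auto intro!: sum.cong simp: sum_negf[symmetric] contract_apply)
  finally show ?thesis by simp
qed

lemma contract_local_ext:
  "contract x (local_ext P w z) = (\<lambda>ys. (if P x then wirtinger x (\<lambda>u. w u ys) z else 0)
     - local_ext P (\<lambda>u. contract x (w u)) z ys)"
  by (rule ext) (simp only: contract_apply local_ext_Cons)

definition covec_differentiable :: "(complex^'n::finite \<Rightarrow> 'n covec) \<Rightarrow> complex^'n \<Rightarrow> bool" where
  "covec_differentiable w z \<longleftrightarrow> (\<forall>xs. (\<lambda>u. w u xs) differentiable at z)"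

lemma covec_differentiable_contract:
  "covec_differentiable w z \<Longrightarrow> covec_differentiable (\<lambda>u. contract x (w u)) z"
  by (simp add: covec_differentiable_def contract_apply)

lemma covec_differentiable_parity_sign:
  "covec_differentiable w z \<Longrightarrow> covec_differentiable (\<lambda>u. parity_sign (w u)) z"
  by (simp add: covec_differentiable_def parity_sign_def)

lemma covec_differentiable_wedge:
  "covec_differentiable \<alpha> z \<Longrightarrow> covec_differentiable \<beta> z \<Longrightarrow> covec_differentiable (\<lambda>u. wedge (\<alpha> u) (\<beta> u)) z"
  by (simp add: covec_differentiable_def wedge_def)

lemma local_ext_add:
  "covec_differentiable \<alpha> z \<Longrightarrow> covec_differentiable \<beta> z \<Longrightarrow>
    local_ext P (\<lambda>u ys. \<alpha> u ys + \<beta> u ys) z xs = local_ext P \<alpha> z xs + local_ext P \<beta> z xs"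
  by (simp add: local_ext_def covec_differentiable_def wirtinger_add algebra_simps sum.distrib)

lemma local_ext_cmult:
  "covec_differentiable \<alpha> z \<Longrightarrow> local_ext P (\<lambda>u ys. c * \<alpha> u ys) z xs = c * local_ext P \<alpha> z xs"
  by (simp add: local_ext_def covec_differentiable_def wirtinger_cmult sum_distrib_left mult_ac)

lemma local_ext_diff:
  "covec_differentiable \<alpha> z \<Longrightarrow> covec_differentiable \<beta> z \<Longrightarrow>
    local_ext P (\<lambda>u ys. \<alpha> u ys - \<beta> u ys) z xs = local_ext P \<alpha> z xs - local_ext P \<beta> z xs"
  by (simp add: local_ext_def covec_differentiable_def wirtinger_diff algebra_simps sum_subtractf)

lemma local_ext_sum:
  "(\<And>i. i \<in> I \<Longrightarrow> covec_differentiable (\<alpha> i) z) \<Longrightarrow>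
    local_ext P (\<lambda>u ys. \<Sum>i\<in>I. \<alpha> i u ys) z xs = (\<Sum>i\<in>I. local_ext P (\<alpha> i) z xs)"
  by (simp add: local_ext_def covec_differentiable_def wirtinger_sum sum_distrib_left sum.swap[of _ I])

lemma local_ext_parity_sign:
  assumes "covec_differentiable \<alpha> z"
  shows "local_ext P (\<lambda>u. parity_sign (\<alpha> u)) z = (\<lambda>ys. - parity_sign (local_ext P \<alpha> z) ys)"
proof
  fix xs :: "('a + 'a) list"
  have "wirtinger (xs ! i) (\<lambda>u. parity_sign (\<alpha> u) (take i xs @ drop (Suc i) xs)) z
    = - ((-1) ^ length xs * wirtinger (xs ! i) (\<lambda>u. \<alpha> u (take i xs @ drop (Suc i) xs)) z)" if "i < length xs" for i
  proof -
    have "(-1::complex) ^ length xs = - ((-1) ^ (length xs - 1))"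
      using that by (cases xs) auto
    moreover have "length (take i xs @ drop (Suc i) xs) = length xs - 1" using that by simp
    ultimately show ?thesis
      using assms by (simp only: parity_sign_def covec_differentiable_def wirtinger_cmult) simp
  qed
  then show "local_ext P (\<lambda>u. parity_sign (\<alpha> u)) z xs = - parity_sign (local_ext P \<alpha> z) xs"
    by (simp add: local_ext_def parity_sign_def sum_distrib_left sum_negf[symmetric] mult_ac)
qed

lemma wirtinger_wedge:
  assumes "covec_differentiable \<alpha> z" "covec_differentiable \<beta> z"
  shows "wirtinger x (\<lambda>u. wedge (\<alpha> u) (\<beta> u) xs) z
    = wedge (\<lambda>ys. wirtinger x (\<lambda>u. \<alpha> u ys) z) (\<beta> z) xs + wedge (\<alpha> z) (\<lambda>ys. wirtinger x (\<lambda>u. \<beta> u ys) z) xs"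
  using assms
  by (simp add: wedge_def covec_differentiable_def wirtinger_sum wirtinger_mult wirtinger_cmult
      algebra_simps sum.distrib)

text \<open>Both sides satisfy the same recursion on the list of directions; the signs are taken care of by
  \<^const>\<open>parity_sign\<close>.\<close>

lemma local_d_wedge:
  assumes "covec_differentiable \<alpha> z" "covec_differentiable \<beta> z"
  shows "local_d (\<lambda>u. wedge (\<alpha> u) (\<beta> u)) z xs
    = wedge (local_d \<alpha> z) (\<beta> z) xs + wedge (parity_sign (\<alpha> z)) (local_d \<beta> z) xs"
  using assms
proof (induction xs arbitrary: \<alpha> \<beta>)
  case (Cons x xs)
  note cd = covec_differentiable_contract[OF Cons.prems(1), of x] covec_differentiable_parity_sign[OF Cons.prems(1)]
    covec_differentiable_contract[OF Cons.prems(2), of x]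
  show ?case
    using Cons.IH[OF cd(1) Cons.prems(2)] Cons.IH[OF cd(2,3)]
    by (simp add: local_ext_Cons wedge_Cons contract_wedge contract_local_ext contract_parity_sign
        wirtinger_wedge[OF Cons.prems] local_ext_parity_sign[OF Cons.prems(1)]
        local_ext_add covec_differentiable_wedge cd Cons.prems
        wedge_minus_left wedge_diff_left wedge_diff_right)
qed (simp add: local_ext_def)

definition smooth_covec :: "(complex^'n::finite) set \<Rightarrow> (complex^'n \<Rightarrow> 'n covec) \<Rightarrow> bool" where
  "smooth_covec S w \<longleftrightarrow> (\<forall>xs. smooth_on S (\<lambda>u. w u xs))"

lemma smooth_covec_differentiable: "smooth_covec S w \<Longrightarrow> z \<in> S \<Longrightarrow> covec_differentiable w z"
  unfolding smooth_covec_def covec_differentiable_def using smooth_on_differentiable by blast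

lemma smooth_covec_contract: "smooth_covec S w \<Longrightarrow> smooth_covec S (\<lambda>u. contract x (w u))"
  by (simp add: smooth_covec_def contract_apply)

lemma smooth_covec_wedge:
  "open S \<Longrightarrow> smooth_covec S \<alpha> \<Longrightarrow> smooth_covec S \<beta> \<Longrightarrow> smooth_covec S (\<lambda>u. wedge (\<alpha> u) (\<beta> u))"
  unfolding smooth_covec_def wedge_def
  by (intro allI smooth_on_sum smooth_on_mult smooth_on_const) auto

lemma smooth_covec_wirtinger:
  "open S \<Longrightarrow> smooth_covec S w \<Longrightarrow> smooth_covec S (\<lambda>u ys. wirtinger x (\<lambda>v. w v ys) u)"
  by (simp add: smooth_covec_def smooth_on_wirtinger)

lemma smooth_covec_local_ext: "open S \<Longrightarrow> smooth_covec S w \<Longrightarrow> smooth_covec S (local_ext P w)"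
  unfolding smooth_covec_def local_ext_def
  by (intro allI smooth_on_sum smooth_on_mult smooth_on_const smooth_on_wirtinger) auto

lemma local_ext_cong:
  assumes "open S" "z \<in> S" "covec_differentiable v z" "\<And>u. u \<in> S \<Longrightarrow> v u = w u"
  shows "local_ext P v z = local_ext P w z"
  unfolding local_ext_def
  by (intro ext sum.cong refl arg_cong2[where f = "(*)"] wirtinger_cong[OF assms(1,2)])
    (use assms in \<open>auto simp: covec_differentiable_def\<close>)

text \<open>By Cartan's formula, contraction with \<open>x\<close> turns the claim into the claim for the
  contracted form and the fact that \<open>d\<close> commutes with the derivative in the direction
  \<open>x\<close>.\<close>

lemma local_d_local_d:
  assumes "open S" "z \<in> S" "smooth_covec S w"
  shows "local_d (local_d w) z xs = 0"
  using assms(3)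
proof (induction xs arbitrary: w)
  case (Cons x xs)
  have "wirtinger x (\<lambda>u. local_d w u xs) z = local_d (\<lambda>u ys. wirtinger x (\<lambda>v. w v ys) u) z xs"
  proof -
    have sm: "smooth_on S (\<lambda>u. w u ys)" for ys using Cons.prems by (simp add: smooth_covec_def)
    have "wirtinger y (\<lambda>u. w u ys) differentiable at z" for y ys
      by (rule smooth_on_differentiable[OF smooth_on_wirtinger[OF assms(1) sm] assms(2)])
    then show ?thesis
      by (simp add: local_ext_def wirtinger_sum wirtinger_cmult wirtinger_commute[OF assms(1) sm assms(2), of x])
  qed
  moreover have "local_d (\<lambda>u. contract x (local_d w u)) z xs
      = local_d (\<lambda>u ys. wirtinger x (\<lambda>v. w v ys) u) z xs - local_d (local_d (\<lambda>u. contract x (w u))) z xs"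
    unfolding contract_local_ext using assms Cons.prems
    by (subst local_ext_diff[symmetric]) (auto intro!: smooth_covec_differentiable[where S = S]
        smooth_covec_wirtinger smooth_covec_local_ext smooth_covec_contract)
  ultimately show ?case
    using Cons.IH[OF smooth_covec_contract[OF Cons.prems]] by (simp add: local_ext_Cons)
qed simp

definition differential :: "(complex^'n::finite \<Rightarrow> complex) \<Rightarrow> complex^'n \<Rightarrow> 'n covec" where
  "differential f z = local_d (\<lambda>u ys. f u * covec_one ys) z"

lemma differential_Nil: "differential f z [] = 0"
  by (simp add: differential_def)

lemma contract_differential:
  assumes "f differentiable at z"
  shows "contract x (differential f z) = (\<lambda>ys. wirtinger x f z * covec_one ys)"
proof
  fix ys :: "('a + 'a) list"
  have "contract x (\<lambda>ys. f u * covec_one ys) = (\<lambda>ys. 0)" for u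
    by (auto simp: fun_eq_iff covec_one_def contract_apply)
  moreover have "local_ext P (\<lambda>u ys. 0) z zs = 0" for P zs by (simp add: local_ext_def)
  moreover have "wirtinger x (\<lambda>u. f u * covec_one ys) z = wirtinger x f z * covec_one ys"
    using wirtinger_mult[OF assms, of "\<lambda>_. covec_one ys" x] by simp
  ultimately show "contract x (differential f z) ys = wirtinger x f z * covec_one ys"
    by (simp add: differential_def local_ext_Cons contract_apply)
qed

lemma parity_sign_differential:
  assumes "f differentiable at z"
  shows "parity_sign (differential f z) = (\<lambda>ys. - differential f z ys)"
proof
  fix ys show "parity_sign (differential f z) ys = - differential f z ys"
    using contract_differential[OF assms] differential_Nil[of f z]
    by (cases ys) (auto simp: parity_sign_def fun_eq_iff covec_one_def contract_apply)
qed

lemma local_d_scalar_mult: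
  assumes "f differentiable at z" "covec_differentiable \<beta> z"
  shows "local_d (\<lambda>u ys. f u * \<beta> u ys) z xs = f z * local_d \<beta> z xs + wedge (differential f z) (\<beta> z) xs"
proof -
  have cd: "covec_differentiable (\<lambda>u ys. f u * covec_one ys) z"
    using assms(1) by (simp add: covec_differentiable_def)
  have eq: "(\<lambda>u ys. f u * \<beta> u ys) = (\<lambda>u. wedge (\<lambda>ys. f u * covec_one ys) (\<beta> u))"
    by (simp add: fun_eq_iff wedge_scalar_left)
  have "parity_sign (\<lambda>ys :: ('a + 'a) list. f z * covec_one ys) = (\<lambda>ys. f z * covec_one ys)"
    by (auto simp: parity_sign_def fun_eq_iff covec_one_def)
  then show ?thesis
    unfolding eq by (simp add: local_d_wedge[OF cd assms(2)] wedge_scalar_left differential_def)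
qed

subsection \<open>Naturality\<close>

context
  fixes S T :: "(complex^'n::finite) set" and \<tau> :: "complex^'n \<Rightarrow> complex^'n"
  assumes S: "open S" and T: "open T" and map: "\<tau> ` S \<subseteq> T" and \<tau>: "smooth_on S \<tau>"
begin

lemma smooth_coord: "smooth_on S (\<lambda>w. coord_fun a (\<tau> w))"
  by (rule smooth_on_bounded_linear[OF S bounded_linear_coord_fun \<tau>])

lemma smooth_jacobian: "smooth_on S (\<lambda>u. jacobian \<tau> u a b)"
  unfolding jacobian_def using smooth_on_wirtinger[OF S smooth_coord] .

text \<open>The rows of the Jacobian are differentials, hence closed.\<close>

lemma jacobian_symmetric:
  "z \<in> S \<Longrightarrow> wirtinger c (\<lambda>u. jacobian \<tau> u a b) z = wirtinger b (\<lambda>u. jacobian \<tau> u a c) z"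
  unfolding jacobian_def by (rule wirtinger_commute[OF S smooth_coord])

lemma smooth_covec_pullback:
  assumes "smooth_covec T w"
  shows "smooth_covec S (\<lambda>u. pullback_at \<tau> u (w (\<tau> u)))"
  unfolding smooth_covec_def pullback_at_def
  by (intro allI smooth_on_sum smooth_on_mult smooth_on_prod S smooth_jacobian
      smooth_on_compose[OF S T map _ \<tau>]) (use assms in \<open>auto simp: smooth_covec_def\<close>)

text \<open>The derivative of a pullback falls either on the components of the form, which is the chain rule,
  or on one of the entries of the Jacobian that multiply them. As the Jacobian is symmetric in the
  sense above and the form alternates, the latter terms combine to the wedge products of the
  differentials of the entries with the contracted forms.\<close>

lemma wirtinger_pullback:
  assumes "z \<in> S" "smooth_covec T w" "alternating (w (\<tau> z))"
  shows "wirtinger b (\<lambda>u. pullback_at \<tau> u (w (\<tau> u)) bs) z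
    = (\<Sum>a\<in>UNIV. jacobian \<tau> z a b * pullback_at \<tau> z (\<lambda>as. wirtinger a (\<lambda>v. w v as) (\<tau> z)) bs)
      + (\<Sum>a\<in>UNIV. wedge (differential (\<lambda>u. jacobian \<tau> u a b) z) (pullback_at \<tau> z (contract a (w (\<tau> z)))) bs)"
  using assms(2,3)
proof (induction bs arbitrary: w)
  case Nil
  have "(\<lambda>v. w v []) differentiable at (\<tau> z)"
    using smooth_on_differentiable[of T _ "\<tau> z"] Nil map assms(1) by (auto simp: smooth_covec_def)
  then show ?case
    using wirtinger_chain[OF smooth_on_differentiable[OF \<tau> assms(1)], of "\<lambda>v. w v []" b]
    by (simp add: differential_Nil mult.commute)
next
  case (Cons c bs)
  have jd: "(\<lambda>u. jacobian \<tau> u a b) differentiable at z" for a b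
    by (rule smooth_on_differentiable[OF smooth_jacobian assms(1)])
  have sm: "smooth_covec T (\<lambda>v. contract e (w v))" for e using Cons.prems by (simp add: smooth_covec_contract)
  have pd: "(\<lambda>u. pullback_at \<tau> u (contract e (w (\<tau> u))) bs) differentiable at z" for e
    using smooth_covec_differentiable[OF smooth_covec_pullback[OF sm] assms(1)] by (simp add: covec_differentiable_def)
  have swap: "contract a (contract e (w (\<tau> z))) = (\<lambda>ys. - contract e (contract a (w (\<tau> z))) ys)" for a e
    using alternatingD[OF Cons.prems(2), of "[]" e a] by (simp add: fun_eq_iff contract_apply)
  let ?J = "\<lambda>a b. jacobian \<tau> z a b" and ?d = "\<lambda>a. differential (\<lambda>u. jacobian \<tau> u a b) z"
  let ?p = "\<lambda>\<alpha>. pullback_at \<tau> z \<alpha> bs" and ?D = "\<lambda>a e as. wirtinger a (\<lambda>v. contract e (w v) as) (\<tau> z)"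
  have IH: "wirtinger b (\<lambda>u. pullback_at \<tau> u (contract e (w (\<tau> u))) bs) z
      = (\<Sum>a\<in>UNIV. ?J a b * ?p (?D a e))
        - (\<Sum>a\<in>UNIV. wedge (?d a) (pullback_at \<tau> z (contract e (contract a (w (\<tau> z))))) bs)" for e
  proof -
    have "wedge (?d a) (pullback_at \<tau> z (contract a (contract e (w (\<tau> z))))) bs
        = - wedge (?d a) (pullback_at \<tau> z (contract e (contract a (w (\<tau> z))))) bs" for a
    proof -
      have "pullback_at \<tau> z (contract a (contract e (w (\<tau> z))))
          = (\<lambda>ys. - pullback_at \<tau> z (contract e (contract a (w (\<tau> z)))) ys)"
        by (subst swap) (simp add: fun_eq_iff pullback_minus)
      then show ?thesis by (simp add: wedge_minus_right)
    qed
    then show ?thesis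
      using Cons.IH[OF sm alternating_contract[OF Cons.prems(2)], of e] by (simp add: sum_negf)
  qed
  have "wirtinger b (\<lambda>u. pullback_at \<tau> u (w (\<tau> u)) (c # bs)) z
    = (\<Sum>e\<in>UNIV. wirtinger b (\<lambda>u. jacobian \<tau> u e c) z * ?p (contract e (w (\<tau> z))))
    + (\<Sum>e\<in>UNIV. ?J e c * wirtinger b (\<lambda>u. pullback_at \<tau> u (contract e (w (\<tau> u))) bs) z)"
    by (simp add: pullback_Cons wirtinger_sum wirtinger_mult jd pd sum.distrib)
  also have "\<dots> = (\<Sum>a\<in>UNIV. wirtinger c (\<lambda>u. jacobian \<tau> u a b) z * ?p (contract a (w (\<tau> z))))
    + ((\<Sum>e\<in>UNIV. \<Sum>a\<in>UNIV. ?J e c * (?J a b * ?p (?D a e)))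
     - (\<Sum>e\<in>UNIV. \<Sum>a\<in>UNIV. ?J e c * wedge (?d a) (pullback_at \<tau> z (contract e (contract a (w (\<tau> z))))) bs))"
    unfolding IH by (simp add: jacobian_symmetric[OF assms(1), of b _ c]
        sum_distrib_left right_diff_distrib sum_subtractf)
  also have "(\<Sum>e\<in>UNIV. \<Sum>a\<in>UNIV. ?J e c * (?J a b * ?p (?D a e)))
    = (\<Sum>a\<in>UNIV. ?J a b * pullback_at \<tau> z (\<lambda>as. wirtinger a (\<lambda>v. w v as) (\<tau> z)) (c # bs))"
    by (subst sum.swap) (simp add: pullback_Cons contract_def sum_distrib_left mult_ac)
  also have "(\<Sum>e\<in>UNIV. \<Sum>a\<in>UNIV. ?J e c * wedge (?d a) (pullback_at \<tau> z (contract e (contract a (w (\<tau> z))))) bs)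
    = (\<Sum>a\<in>UNIV. wedge (?d a) (contract c (pullback_at \<tau> z (contract a (w (\<tau> z))))) bs)"
    by (subst sum.swap) (simp add: contract_pullback wedge_sum_right wedge_cmult_right)
  finally show ?case
    by (simp add: wedge_Cons contract_differential[OF jd] parity_sign_differential[OF jd]
        wedge_scalar_left wedge_minus_left sum_subtractf sum.distrib)
qed

text \<open>By Cartan's formula for the pullback, the wedge products with the differentials of the entries of
  the Jacobian occur twice with opposite signs, once from the derivative of the pullback and once
  from the Leibniz rule.\<close>

lemma local_d_pullback:
  assumes "z \<in> S" "smooth_covec T w" "alternating (w (\<tau> z))"
  shows "local_d (\<lambda>u. pullback_at \<tau> u (w (\<tau> u))) z bs = pullback_at \<tau> z (local_d w (\<tau> z)) bs"
  using assms(2,3)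
proof (induction bs arbitrary: w)
  case (Cons b bs)
  have jd: "(\<lambda>u. jacobian \<tau> u a b) differentiable at z" for a b
    by (rule smooth_on_differentiable[OF smooth_jacobian assms(1)])
  have sm: "smooth_covec T (\<lambda>v. contract e (w v))" for e using Cons.prems by (simp add: smooth_covec_contract)
  have pd: "covec_differentiable (\<lambda>u. pullback_at \<tau> u (contract e (w (\<tau> u)))) z" for e
    by (rule smooth_covec_differentiable[OF smooth_covec_pullback[OF sm] assms(1)])
  have jpd: "covec_differentiable (\<lambda>u ys. jacobian \<tau> u a b * pullback_at \<tau> u (contract a (w (\<tau> u))) ys) z" for a
    using pd[of a] jd by (simp add: covec_differentiable_def)
  have "local_d (\<lambda>u. contract b (pullback_at \<tau> u (w (\<tau> u)))) z bs
    = (\<Sum>a\<in>UNIV. jacobian \<tau> z a b * pullback_at \<tau> z (local_d (\<lambda>v. contract a (w v)) (\<tau> z)) bs)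
      + (\<Sum>a\<in>UNIV. wedge (differential (\<lambda>u. jacobian \<tau> u a b) z) (pullback_at \<tau> z (contract a (w (\<tau> z)))) bs)"
    unfolding contract_pullback
    by (simp add: local_ext_sum jpd local_d_scalar_mult[OF jd pd] sum.distrib
        Cons.IH[OF sm alternating_contract[OF Cons.prems(2)]])
  then show ?case
    by (simp add: local_ext_Cons wirtinger_pullback[OF assms(1) Cons.prems] pullback_Cons contract_local_ext
        pullback_diff right_diff_distrib sum_subtractf)
qed simp

end

subsection \<open>Alternation\<close>

lemma alternating_local_ext:
  assumes "\<And>u. alternating (w u)" "covec_differentiable w z"
  shows "alternating (local_ext P w z)"
proof -
  have "local_ext P w z (xs @ [a, b] @ ys) = - local_ext P w z (xs @ [b, a] @ ys)" for xs a b ys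
    using assms
  proof (induction xs arbitrary: w)
    case Nil
    have swap: "(\<lambda>u. contract a (contract b (w u))) = (\<lambda>u ys. (- 1) * contract b (contract a (w u)) ys)"
      using alternatingD[OF Nil(1), where xs = "[]" and a = b and b = a] by (simp add: fun_eq_iff contract_apply)
    have "local_ext P (\<lambda>u. contract a (contract b (w u))) z ys
        = - local_ext P (\<lambda>u. contract b (contract a (w u))) z ys"
      unfolding swap using Nil by (subst local_ext_cmult) (auto intro: covec_differentiable_contract)
    then show ?case by (simp add: local_ext_Cons contract_apply)
  next
    case (Cons x xs)
    have "wirtinger x (\<lambda>u. w u (xs @ [a, b] @ ys)) z = - wirtinger x (\<lambda>u. w u (xs @ [b, a] @ ys)) z"
    proof -
      have "(\<lambda>u. w u (xs @ [a, b] @ ys)) = (\<lambda>u. - w u (xs @ [b, a] @ ys))"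
        using alternatingD[OF Cons.prems(1)] by blast
      then show ?thesis using Cons.prems(2) by (simp add: wirtinger_uminus covec_differentiable_def)
    qed
    then show ?case
      using Cons.IH[OF alternating_contract[OF Cons.prems(1)] covec_differentiable_contract[OF Cons.prems(2)], of x]
      by (simp add: local_ext_Cons)
  qed
  then show ?thesis by (rule alternatingI)
qed

lemma alternating_add: "alternating \<alpha> \<Longrightarrow> alternating \<beta> \<Longrightarrow> alternating (\<lambda>ys. \<alpha> ys + \<beta> ys)"
  unfolding alternating_def by (metis minus_add_distrib)

lemma alternating_cmult: "alternating \<alpha> \<Longrightarrow> alternating (\<lambda>ys. c * \<alpha> ys)"
  unfolding alternating_def by (metis mult_minus_right)

lemma alternating_degree_one: "(\<And>ys. length ys > 1 \<Longrightarrow> \<alpha> ys = 0) \<Longrightarrow> alternating \<alpha>"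
  unfolding alternating_def by simp

section \<open>Charts and forms on a complex manifold\<close>

locale complex_mfd =
  fixes X :: "'a topology" and A :: "('a, 'n::finite) chart set"
  assumes manifold: "complex_manifold X A"
begin

lemma open_chart_image: "c \<in> A \<Longrightarrow> open (chart_image c)"
  using manifold by (simp add: complex_manifold_def)

lemma openin_chart_domain: "c \<in> A \<Longrightarrow> openin X (fst c)"
  using manifold by (simp add: complex_manifold_def)

lemma chart_domain_subset: "c \<in> A \<Longrightarrow> fst c \<subseteq> topspace X"
  using openin_chart_domain openin_subset by blast

lemma chart_homeomorphic:
  "c \<in> A \<Longrightarrow> homeomorphic_map (subtopology X (fst c)) (top_of_set (chart_image c)) (snd c)"
  using manifold by (simp add: complex_manifold_def)

lemma inj_on_chart: "c \<in> A \<Longrightarrow> inj_on (snd c) (fst c)"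
  using homeomorphic_imp_injective_map[OF chart_homeomorphic] chart_domain_subset
  by (simp add: Int_absorb1)

lemma chart_inv_in: "z \<in> chart_image c \<Longrightarrow> chart_inv c z \<in> fst c"
  by (simp add: chart_image_def chart_inv_def inv_into_into)

lemma chart_chart_inv: "z \<in> chart_image c \<Longrightarrow> snd c (chart_inv c z) = z"
  by (simp add: chart_image_def chart_inv_def f_inv_into_f)

lemma chart_inv_chart: "c \<in> A \<Longrightarrow> p \<in> fst c \<Longrightarrow> chart_inv c (snd c p) = p"
  by (simp add: chart_inv_def inj_on_chart)

lemma overlap_iff:
  assumes "c \<in> A" shows "z \<in> overlap c d \<longleftrightarrow> z \<in> chart_image c \<and> chart_inv c z \<in> fst d"
proof
  assume "z \<in> overlap c d"
  then obtain p where "p \<in> fst c" "p \<in> fst d" "z = snd c p" by (auto simp: overlap_def)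
  then show "z \<in> chart_image c \<and> chart_inv c z \<in> fst d"
    using chart_inv_chart[OF assms] by (simp add: chart_image_def)
next
  assume z: "z \<in> chart_image c \<and> chart_inv c z \<in> fst d"
  then have "snd c (chart_inv c z) \<in> overlap c d"
    unfolding overlap_def using chart_inv_in by blast
  then show "z \<in> overlap c d" using chart_chart_inv[of z c] z by simp
qed

lemma overlap_subset: "overlap c d \<subseteq> chart_image c"
  by (auto simp: overlap_def chart_image_def)

lemma open_overlap:
  assumes "c \<in> A" "d \<in> A" shows "open (overlap c d)"
proof -
  have "openin (subtopology X (fst c)) (fst c \<inter> fst d)"
    using openin_chart_domain[OF assms(2)] by (auto simp: openin_subtopology)
  then have "openin (top_of_set (chart_image c)) (overlap c d)"
    unfolding overlap_def using homeomorphic_imp_open_map[OF chart_homeomorphic[OF assms(1)]]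
    by (simp add: open_map_def)
  then show ?thesis using open_chart_image[OF assms(1)] openin_open_trans by blast
qed

lemma transition_in:
  assumes "c \<in> A" "d \<in> A" "z \<in> overlap c d"
  shows "transition c d z \<in> overlap d c" "transition c d z \<in> chart_image d"
    "chart_inv d (transition c d z) = chart_inv c z" "transition d c (transition c d z) = z"
proof -
  have z: "z \<in> chart_image c" "chart_inv c z \<in> fst d" using assms overlap_iff by auto
  show *: "transition c d z \<in> chart_image d" using z by (simp add: transition_def chart_image_def)
  show **: "chart_inv d (transition c d z) = chart_inv c z"
    using z assms by (simp add: transition_def chart_inv_chart)
  show "transition c d z \<in> overlap d c" using * ** z overlap_iff[OF assms(2)] chart_inv_in by simp
  show "transition d c (transition c d z) = z"
    using z ** by (simp add: transition_def chart_chart_inv)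
qed

lemma transition_image: "c \<in> A \<Longrightarrow> d \<in> A \<Longrightarrow> transition c d ` overlap c d \<subseteq> chart_image d"
  using transition_in(2) by blast

lemma transition_overlap_image: "c \<in> A \<Longrightarrow> d \<in> A \<Longrightarrow> transition c d ` overlap c d = overlap d c"
  using transition_in(1,4) by (metis image_eqI image_subsetI subset_antisym subsetI)

lemma inj_on_transition: "c \<in> A \<Longrightarrow> d \<in> A \<Longrightarrow> inj_on (transition c d) (overlap c d)"
  using transition_in(4) inj_on_inverseI by metis

lemma holomorphic_transition: "c \<in> A \<Longrightarrow> d \<in> A \<Longrightarrow> holomorphic_map_on (overlap c d) (transition c d)"
  using manifold by (simp add: complex_manifold_def)

lemma smooth_transition: "c \<in> A \<Longrightarrow> d \<in> A \<Longrightarrow> smooth_on (overlap c d) (transition c d)"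
  using holomorphic_transition by (simp add: holomorphic_map_on_def)

text \<open>By the Cauchy-Riemann equations the complexified Jacobian is block diagonal, with conjugate blocks.\<close>

lemma jacobian_transition:
  assumes "c \<in> A" "d \<in> A" "z \<in> overlap c d"
  shows "jacobian (transition c d) z (Inl k) (Inr j) = 0"
    and "jacobian (transition c d) z (Inr k) (Inl j) = 0"
    and "jacobian (transition c d) z (Inr k) (Inr j) = cnj (jacobian (transition c d) z (Inl k) (Inl j))"
proof -
  have "(\<lambda>w. transition c d w $ k) differentiable at z"
    by (rule smooth_on_differentiable[OF smooth_on_vec_nth[OF open_overlap smooth_transition] assms(3)])
      (use assms in auto)
  note cnj = wirtinger_cnj[OF this]
  show *: "jacobian (transition c d) z (Inl k) (Inr j) = 0" for k j
    using holomorphic_transition[OF assms(1,2)] assms(3)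
    by (simp add: holomorphic_map_on_def jacobian_def coord_fun_def)
  show "jacobian (transition c d) z (Inr k) (Inl j) = 0"
    "jacobian (transition c d) z (Inr k) (Inr j) = cnj (jacobian (transition c d) z (Inl k) (Inl j))"
    using *[of k j] by (simp_all add: jacobian_def coord_fun_def cnj conj_index_def)
qed

lemma form_zero: "\<omega> \<in> forms A \<Longrightarrow> \<not> (c \<in> A \<and> z \<in> chart_image c) \<Longrightarrow> \<omega> c z = 0"
  unfolding forms_def mem_Collect_eq by blast

lemma form_alternating:
  assumes "\<omega> \<in> forms A" shows "alternating (\<omega> c z)"
proof (cases "c \<in> A \<and> z \<in> chart_image c")
  case True
  then show ?thesis using assms by (simp add: forms_def)
next
  case False
  then have "\<omega> c z = 0" using assms form_zero by blast
  then show ?thesis by (simp add: alternating_def)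
qed

lemma form_smooth: "\<omega> \<in> forms A \<Longrightarrow> c \<in> A \<Longrightarrow> smooth_covec (chart_image c) (\<omega> c)"
  by (simp add: forms_def smooth_covec_def)

lemma form_differentiable: "\<omega> \<in> forms A \<Longrightarrow> c \<in> A \<Longrightarrow> z \<in> chart_image c \<Longrightarrow> covec_differentiable (\<omega> c) z"
  using smooth_covec_differentiable form_smooth by blast

lemma form_pullback:
  "\<omega> \<in> forms A \<Longrightarrow> c \<in> A \<Longrightarrow> d \<in> A \<Longrightarrow> z \<in> overlap c d
    \<Longrightarrow> \<omega> c z = pullback_at (transition c d) z (\<omega> d (transition c d z))"
  by (simp add: forms_def)

lemma formsI:
  assumes "\<And>c z. \<not> (c \<in> A \<and> z \<in> chart_image c) \<Longrightarrow> \<omega> c z = 0"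
    and "\<And>c z. c \<in> A \<Longrightarrow> z \<in> chart_image c \<Longrightarrow> alternating (\<omega> c z)"
    and "\<And>c. c \<in> A \<Longrightarrow> smooth_covec (chart_image c) (\<omega> c)"
    and "\<And>c d z bs. c \<in> A \<Longrightarrow> d \<in> A \<Longrightarrow> z \<in> overlap c d \<Longrightarrow>
      \<omega> c z bs = pullback_at (transition c d) z (\<omega> d (transition c d z)) bs"
  shows "\<omega> \<in> forms A"
  unfolding forms_def mem_Collect_eq
proof (intro conjI ballI allI impI)
  fix c xs assume "c \<in> A"
  then show "smooth_on (chart_image c) (\<lambda>z. \<omega> c z xs)" using assms(3) by (simp add: smooth_covec_def)
next
  fix c d z assume "c \<in> A" "d \<in> A" "z \<in> overlap c d"
  from assms(4)[OF this] show "\<omega> c z = pullback_at (transition c d) z (\<omega> d (transition c d z))"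
    by (rule ext)
qed (fact assms(1), fact assms(2))

lemma partial_ext_eq:
  "c \<in> A \<Longrightarrow> z \<in> chart_image c \<Longrightarrow> partial_ext P A \<omega> c z = local_ext P (\<omega> c) z"
  by (rule ext) (simp add: partial_ext_def local_ext_def)

lemma partial_ext_zero: "\<not> (c \<in> A \<and> z \<in> chart_image c) \<Longrightarrow> partial_ext P A \<omega> c z = 0"
  by (rule ext) (auto simp: partial_ext_def)

lemmas ext_d_eq = partial_ext_eq[of _ _ "\<lambda>_. True", folded ext_d_def]
lemmas ext_d_zero = partial_ext_zero[of _ _ "\<lambda>_. True", folded ext_d_def]

definition wedge_form :: "('a, 'n) mform \<Rightarrow> ('a, 'n) mform \<Rightarrow> ('a, 'n) mform" where
  "wedge_form \<alpha> \<beta> = (\<lambda>c z. wedge (\<alpha> c z) (\<beta> c z))"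

lemma forms_wedge:
  assumes "\<alpha> \<in> forms A" "\<beta> \<in> forms A" shows "wedge_form \<alpha> \<beta> \<in> forms A"
  unfolding wedge_form_def
proof (rule formsI)
  fix c z assume "\<not> (c \<in> A \<and> z \<in> chart_image c)"
  then have "\<alpha> c z = (\<lambda>_. 0)" using form_zero[OF assms(1)] by (simp add: zero_fun_def)
  then show "wedge (\<alpha> c z) (\<beta> c z) = 0" by (intro ext) simp
next
  fix c assume "c \<in> A"
  then show "smooth_covec (chart_image c) (\<lambda>z. wedge (\<alpha> c z) (\<beta> c z))"
    by (intro smooth_covec_wedge open_chart_image form_smooth assms)
next
  fix c d z bs assume "c \<in> A" "d \<in> A" "z \<in> overlap c d"
  then show "wedge (\<alpha> c z) (\<beta> c z) bs
    = pullback_at (transition c d) z (wedge (\<alpha> d (transition c d z)) (\<beta> d (transition c d z))) bs"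
    using form_pullback[OF assms(1)] form_pullback[OF assms(2)] by (simp add: pullback_wedge)
qed (intro alternating_wedge form_alternating assms)

lemma forms_ext_d:
  assumes "\<omega> \<in> forms A" shows "ext_d A \<omega> \<in> forms A"
proof (rule formsI)
  fix c z assume "c \<in> A" "z \<in> chart_image c"
  then show "alternating (ext_d A \<omega> c z)"
    by (simp add: ext_d_eq alternating_local_ext form_alternating form_differentiable assms)
next
  fix c assume c: "c \<in> A"
  have "smooth_covec (chart_image c) (local_d (\<omega> c))"
    by (intro smooth_covec_local_ext open_chart_image form_smooth assms c)
  then show "smooth_covec (chart_image c) (ext_d A \<omega> c)"
    unfolding smooth_covec_def
    using smooth_on_cong[OF open_chart_image[OF c], of "\<lambda>u. local_d (\<omega> c) u xs"
        "\<lambda>u. ext_d A \<omega> c u xs" for xs] by (simp add: ext_d_eq c)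
next
  fix c d z bs assume cd: "c \<in> A" "d \<in> A" "z \<in> overlap c d"
  note z = subsetD[OF overlap_subset cd(3)] and o = open_overlap[OF cd(1,2)]
  have "local_d (\<omega> c) z bs = local_d (\<lambda>u. pullback_at (transition c d) u (\<omega> d (transition c d u))) z bs"
    by (rule fun_cong[OF local_ext_cong[OF o cd(3) form_differentiable[OF assms cd(1) z]]])
      (rule form_pullback[OF assms cd(1,2)])
  also have "\<dots> = pullback_at (transition c d) z (local_d (\<omega> d) (transition c d z)) bs"
    by (rule local_d_pullback[OF o open_chart_image[OF cd(2)] transition_image[OF cd(1,2)]
          smooth_transition[OF cd(1,2)] cd(3) form_smooth[OF assms cd(2)] form_alternating[OF assms]])
  finally show "ext_d A \<omega> c z bs = pullback_at (transition c d) z (ext_d A \<omega> d (transition c d z)) bs"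
    using cd z transition_in(2)[OF cd] by (simp add: ext_d_eq)
qed (simp add: ext_d_zero)

lemma forms_add:
  assumes "\<alpha> \<in> forms A" "\<beta> \<in> forms A" shows "\<alpha> + \<beta> \<in> forms A"
proof (rule formsI)
  show "alternating ((\<alpha> + \<beta>) c z)" for c z
    using alternating_add[OF form_alternating[OF assms(1)] form_alternating[OF assms(2)]]
    by (simp add: plus_fun_def)
  show "smooth_covec (chart_image c) ((\<alpha> + \<beta>) c)" if "c \<in> A" for c
    using form_smooth[OF assms(1) that] form_smooth[OF assms(2) that] open_chart_image[OF that]
    by (simp add: smooth_covec_def smooth_on_add)
  show "(\<alpha> + \<beta>) c z bs = pullback_at (transition c d) z ((\<alpha> + \<beta>) d (transition c d z)) bs"
    if "c \<in> A" "d \<in> A" "z \<in> overlap c d" for c d z bs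
    using form_pullback[OF assms(1) that] form_pullback[OF assms(2) that]
    by (simp add: plus_fun_def pullback_add)
  show "(\<alpha> + \<beta>) c z = 0" if "\<not> (c \<in> A \<and> z \<in> chart_image c)" for c z
    using form_zero[OF assms(1) that] form_zero[OF assms(2) that] by (intro ext) simp
qed

definition scale_form :: "complex \<Rightarrow> ('a, 'n) mform \<Rightarrow> ('a, 'n) mform" where
  "scale_form k \<alpha> = (\<lambda>c z xs. k * \<alpha> c z xs)"

lemma forms_scale:
  assumes "\<alpha> \<in> forms A" shows "scale_form k \<alpha> \<in> forms A"
  unfolding scale_form_def
proof (rule formsI)
  show "alternating (\<lambda>xs. k * \<alpha> c z xs)" for c z
    by (rule alternating_cmult[OF form_alternating[OF assms]])
  show "smooth_covec (chart_image c) (\<lambda>z xs. k * \<alpha> c z xs)" if "c \<in> A" for c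
    using form_smooth[OF assms(1) that] open_chart_image[OF that]
    by (simp add: smooth_covec_def smooth_on_mult smooth_on_const)
  show "k * \<alpha> c z bs = pullback_at (transition c d) z (\<lambda>xs. k * \<alpha> d (transition c d z) xs) bs"
    if "c \<in> A" "d \<in> A" "z \<in> overlap c d" for c d z bs
    using form_pullback[OF assms(1) that] by (simp add: pullback_cmult)
qed (simp add: form_zero assms fun_eq_iff)

lemma forms_zero: "0 \<in> forms A"
  by (rule formsI) (auto simp: alternating_def smooth_covec_def pullback_at_def zero_fun_def
      intro!: smooth_on_const open_chart_image)

text \<open>The cut-off outside the charts makes the family of local expressions a form.\<close>

definition fun_form :: "('a \<Rightarrow> complex) \<Rightarrow> ('a, 'n) mform" where
  "fun_form f = (\<lambda>c z xs. if c \<in> A \<and> z \<in> chart_image c then f (chart_inv c z) * covec_one xs else 0)"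

definition smooth_fun :: "('a \<Rightarrow> complex) \<Rightarrow> bool" where
  "smooth_fun f \<longleftrightarrow> (\<forall>c\<in>A. smooth_on (chart_image c) (\<lambda>z. f (chart_inv c z)))"

lemma forms_fun_form:
  assumes "smooth_fun f" shows "fun_form f \<in> forms A"
proof (rule formsI)
  show "alternating (fun_form f c z)" for c z
    by (rule alternating_degree_one) (auto simp: fun_form_def covec_one_def)
  show "smooth_covec (chart_image c) (fun_form f c)" if "c \<in> A" for c
    unfolding smooth_covec_def fun_form_def
  proof
    fix xs
    show "smooth_on (chart_image c)
        (\<lambda>u. if c \<in> A \<and> u \<in> chart_image c then f (chart_inv c u) * covec_one xs else 0)"
      by (rule smooth_on_cong[OF open_chart_image[OF that], of "\<lambda>u. f (chart_inv c u) * covec_one xs"])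
        (use assms that in \<open>auto simp: smooth_fun_def intro!: smooth_on_mult smooth_on_const open_chart_image\<close>)
  qed
  show "fun_form f c z bs = pullback_at (transition c d) z (fun_form f d (transition c d z)) bs"
    if "c \<in> A" "d \<in> A" "z \<in> overlap c d" for c d z bs
  proof (cases bs)
    case Nil
    then show ?thesis using that transition_in[OF that] subsetD[OF overlap_subset that(3)]
      by (simp add: fun_form_def)
  next
    case (Cons b bs')
    have "fun_form f d w as = 0" if "length as = length bs" for w as
      using that Cons by (auto simp: fun_form_def covec_one_def)
    then show ?thesis by (simp add: pullback_at_def) (use Cons in \<open>simp add: fun_form_def covec_one_def\<close>)
  qed
  show "fun_form f c z = 0" if "\<not> (c \<in> A \<and> z \<in> chart_image c)" for c z
    using that by (intro ext) (auto simp: fun_form_def)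
qed

lemma wedge_fun_form:
  assumes "\<omega> \<in> forms A"
  shows "wedge_form (fun_form f) \<omega> c z xs = f (chart_inv c z) * \<omega> c z xs"
  using form_zero[OF assms, of c z]
  by (cases "c \<in> A \<and> z \<in> chart_image c") (auto simp: wedge_form_def fun_form_def wedge_scalar_left)

definition one_form_part :: "('n + 'n \<Rightarrow> bool) \<Rightarrow> ('a, 'n) mform \<Rightarrow> ('a, 'n) mform" where
  "one_form_part P \<omega> = (\<lambda>c z xs. case xs of [a] \<Rightarrow> if P a then \<omega> c z [a] else 0 | _ \<Rightarrow> 0)"

lemma one_form_part_Cons: "one_form_part P \<omega> c z (a # xs) = (if xs = [] \<and> P a then \<omega> c z [a] else 0)"
  by (auto simp: one_form_part_def split: list.split)

text \<open>The components of type \<open>(1,0)\<close> and \<open>(0,1)\<close> are forms because the transition functions are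
  holomorphic.\<close>

lemma forms_one_form_part:
  assumes "\<omega> \<in> forms A" "P = isl \<or> P = (\<lambda>a. \<not> isl a)"
  shows "one_form_part P \<omega> \<in> forms A"
proof (rule formsI)
  show "one_form_part P \<omega> c z = 0" if "\<not> (c \<in> A \<and> z \<in> chart_image c)" for c z
    using form_zero[OF assms(1) that] by (auto simp: one_form_part_def fun_eq_iff split: list.split)
  show "alternating (one_form_part P \<omega> c z)" for c z
    by (rule alternating_degree_one) (auto simp: one_form_part_def split: list.split)
  show "smooth_covec (chart_image c) (one_form_part P \<omega> c)" if "c \<in> A" for c
    unfolding smooth_covec_def
  proof
    fix xs show "smooth_on (chart_image c) (\<lambda>u. one_form_part P \<omega> c u xs)"
      using form_smooth[OF assms(1) that] smooth_on_const[OF open_chart_image[OF that], of "0::complex"]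
      by (cases xs; cases "tl xs"; cases "P (hd xs)") (auto simp: one_form_part_def smooth_covec_def)
  qed
  fix c d z bs assume cd: "c \<in> A" "d \<in> A" "z \<in> overlap c d"
  let ?\<tau> = "transition c d"
  show "one_form_part P \<omega> c z bs = pullback_at ?\<tau> z (one_form_part P \<omega> d (?\<tau> z)) bs"
  proof (cases "\<exists>b. bs = [b]")
    case True
    then obtain b where b: "bs = [b]" by blast
    have *: "jacobian ?\<tau> z a b = 0" if "isl a \<noteq> isl b" for a
      using that jacobian_transition[OF cd] by (cases a; cases b) auto
    have P: "P a = P b" if "jacobian ?\<tau> z a b \<noteq> 0" for a
      using assms(2) * that by blast
    have "pullback_at ?\<tau> z (one_form_part P \<omega> d (?\<tau> z)) [b]
        = (\<Sum>a\<in>UNIV. jacobian ?\<tau> z a b * one_form_part P \<omega> d (?\<tau> z) [a])"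
      by (simp add: pullback_Cons contract_apply)
    also have "\<dots> = (\<Sum>a\<in>UNIV. if P b then jacobian ?\<tau> z a b * \<omega> d (?\<tau> z) [a] else 0)"
      by (rule sum.cong) (use P in \<open>auto simp: one_form_part_Cons\<close>)
    also have "\<dots> = (if P b then pullback_at ?\<tau> z (\<omega> d (?\<tau> z)) [b] else 0)"
      by (simp add: pullback_Cons contract_apply)
    also have "\<dots> = one_form_part P \<omega> c z [b]"
      using form_pullback[OF assms(1) cd] by (simp add: one_form_part_Cons)
    finally show ?thesis using b by simp
  next
    case False
    then have "length bs \<noteq> 1" by (auto simp: length_Suc_conv)
    then have "one_form_part P \<omega> c z bs = 0" "\<And>as. length as = length bs \<Longrightarrow> one_form_part P \<omega> d (?\<tau> z) as = 0"
      by (auto simp: one_form_part_def split: list.split)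
    then show ?thesis by (simp add: pullback_at_def)
  qed
qed

lemma ext_d_wedge:
  assumes "\<alpha> \<in> forms A" "\<beta> \<in> forms A"
  shows "ext_d A (wedge_form \<alpha> \<beta>) c z xs
    = wedge (ext_d A \<alpha> c z) (\<beta> c z) xs + wedge (parity_sign (\<alpha> c z)) (ext_d A \<beta> c z) xs"
proof (cases "c \<in> A \<and> z \<in> chart_image c")
  case True
  then show ?thesis
    using local_d_wedge[OF form_differentiable[OF assms(1)] form_differentiable[OF assms(2)]]
    by (simp add: ext_d_eq wedge_form_def)
next
  case False
  then show ?thesis using ext_d_zero form_zero assms
    by (simp add: zero_fun_def)
qed

lemma ext_d_add:
  assumes "\<alpha> \<in> forms A" "\<beta> \<in> forms A"
  shows "ext_d A (\<alpha> + \<beta>) = ext_d A \<alpha> + ext_d A \<beta>"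
proof (intro ext)
  fix c z xs
  show "ext_d A (\<alpha> + \<beta>) c z xs = (ext_d A \<alpha> + ext_d A \<beta>) c z xs"
  proof (cases "c \<in> A \<and> z \<in> chart_image c")
    case True
    then have "covec_differentiable (\<alpha> c) z" "covec_differentiable (\<beta> c) z"
      using form_differentiable assms by auto
    from local_ext_add[OF this] show ?thesis using True by (simp add: ext_d_eq plus_fun_def)
  qed (simp add: ext_d_zero)
qed

lemma ext_d_wedge_closed:
  assumes "\<alpha> \<in> forms A" "\<beta> \<in> forms A" "ext_d A \<beta> = 0"
  shows "ext_d A (wedge_form \<alpha> \<beta>) = wedge_form (ext_d A \<alpha>) \<beta>"
  using ext_d_wedge[OF assms(1,2)] assms(3) by (simp add: fun_eq_iff wedge_form_def zero_fun_def)

text \<open>The \<open>0\<close>-th power of a form is the constant \<open>1\<close>, cut off outside the charts in order to be a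
  form.\<close>

definition wedge_power :: "('a, 'n) mform \<Rightarrow> nat \<Rightarrow> ('a, 'n) mform" where
  "wedge_power \<eta> k = (wedge_form \<eta> ^^ k) (fun_form (\<lambda>_. 1))"

lemma wedge_power_Suc: "wedge_power \<eta> (Suc k) = wedge_form \<eta> (wedge_power \<eta> k)"
  by (simp add: wedge_power_def)

lemma form_power_eq:
  "c \<in> A \<Longrightarrow> z \<in> chart_image c \<Longrightarrow> form_power \<eta> k c z = wedge_power \<eta> k c z"
proof (induction k)
  case 0
  then show ?case by (simp add: form_power_def wedge_power_def fun_form_def)
next
  case (Suc k)
  then show ?case by (simp add: form_power_def wedge_power_Suc) (simp add: wedge_form_def)
qed

lemma smooth_fun_const: "smooth_fun (\<lambda>_. k)"
  by (simp add: smooth_fun_def smooth_on_const open_chart_image)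

lemma forms_wedge_power: "\<eta> \<in> forms A \<Longrightarrow> wedge_power \<eta> k \<in> forms A"
proof (induction k)
  case 0
  show ?case using forms_fun_form[OF smooth_fun_const] by (simp add: wedge_power_def)
qed (simp add: wedge_power_Suc forms_wedge)

lemma closed_wedge_power:
  assumes "\<eta> \<in> forms A" "ext_d A \<eta> = 0"
  shows "ext_d A (wedge_power \<eta> k) = 0"
proof (induction k)
  case 0
  have "ext_d A (fun_form (\<lambda>_. 1)) c z xs = 0" for c z xs
  proof (cases "c \<in> A \<and> z \<in> chart_image c")
    case True
    have "local_d (fun_form (\<lambda>_. 1) c) z = local_d (\<lambda>_. covec_one) z"
      by (rule local_ext_cong[OF open_chart_image _ form_differentiable[OF forms_fun_form[OF smooth_fun_const]]])
        (use True in \<open>auto simp: fun_form_def\<close>)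
    also have "\<dots> = (\<lambda>_. 0)" by (rule ext) (simp add: local_ext_def)
    finally show ?thesis using True by (simp add: ext_d_eq)
  qed (simp add: ext_d_zero)
  then show ?case by (simp add: wedge_power_def fun_eq_iff)
next
  case (Suc k)
  then show ?case
    using ext_d_wedge_closed[OF assms(1) forms_wedge_power[OF assms(1)] Suc] assms(2)
    by (simp add: wedge_power_Suc wedge_form_def fun_eq_iff zero_fun_def)
qed

text \<open>In \<open>\<eta>\<^sup>k\<^sup>+\<^sup>1 = \<Theta> \<and> \<eta>\<^sup>k + d\<sigma> \<and> \<eta>\<^sup>k\<close> the second term is exact as \<open>\<eta>\<close> is closed. By induction the first one
  differs from \<open>\<Theta>\<^sup>k\<^sup>+\<^sup>1\<close> by \<open>\<Theta> \<and> d\<mu>\<close>, which is exact because \<open>\<Theta>\<close> is closed and commutes with all forms.\<close>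

lemma wedge_power_exact:
  assumes \<eta>: "\<eta> \<in> forms A" "ext_d A \<eta> = 0"
    and \<Theta>: "\<Theta> \<in> forms A" "ext_d A \<Theta> = 0" "\<And>c z xs. odd (length xs) \<Longrightarrow> \<Theta> c z xs = 0"
    and \<sigma>: "\<sigma> \<in> forms A" "\<eta> - \<Theta> = ext_d A \<sigma>"
  shows "\<exists>\<mu>\<in>forms A. wedge_power \<eta> k = wedge_power \<Theta> k + ext_d A \<mu>"
proof (induction k)
  case 0
  have "ext_d A (0 :: ('a, 'n) mform) = 0"
    by (auto simp: fun_eq_iff ext_d_def partial_ext_def zero_fun_def)
  then have "wedge_power \<eta> 0 = wedge_power \<Theta> 0 + ext_d A 0"
    by (simp only: wedge_power_def funpow_0 add_0_right)
  then show ?case using forms_zero by blast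
next
  case (Suc k)
  then obtain \<mu> where \<mu>: "\<mu> \<in> forms A" "wedge_power \<eta> k = wedge_power \<Theta> k + ext_d A \<mu>" by blast
  let ?p = "wedge_power \<eta> k"
  have p: "?p \<in> forms A" "ext_d A ?p = 0"
    using forms_wedge_power closed_wedge_power \<eta> by auto
  have eq: "\<eta> = \<Theta> + ext_d A \<sigma>" using \<sigma>(2) by (metis add.commute diff_add_cancel)
  have "wedge_power \<eta> (Suc k) = wedge_form \<Theta> ?p + wedge_form (ext_d A \<sigma>) ?p"
    by (subst wedge_power_Suc, subst eq) (simp add: wedge_form_def fun_eq_iff plus_fun_def wedge_add_left)
  also have "wedge_form (ext_d A \<sigma>) ?p = ext_d A (wedge_form \<sigma> ?p)"
    using ext_d_wedge_closed[OF \<sigma>(1) p] by simp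
  also have "wedge_form \<Theta> ?p = wedge_power \<Theta> (Suc k) + wedge_form \<Theta> (ext_d A \<mu>)"
    unfolding \<mu>(2) wedge_power_Suc by (simp add: wedge_form_def fun_eq_iff plus_fun_def wedge_add_right)
  also have "wedge_form \<Theta> (ext_d A \<mu>) = wedge_form (ext_d A \<mu>) \<Theta>"
    unfolding wedge_form_def by (intro ext fun_cong[OF wedge_commute_even[OF \<Theta>(3)]])
  also have "\<dots> = ext_d A (wedge_form \<mu> \<Theta>)"
    using ext_d_wedge_closed[OF \<mu>(1) \<Theta>(1,2)] by simp
  finally have "wedge_power \<eta> (Suc k) = wedge_power \<Theta> (Suc k)
      + ext_d A (wedge_form \<mu> \<Theta> + wedge_form \<sigma> ?p)"
    unfolding ext_d_add[OF forms_wedge[OF \<mu>(1) \<Theta>(1)] forms_wedge[OF \<sigma>(1) p(1)]]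
    by (simp only: plus_fun_def add.assoc)
  then show ?case using forms_add[OF forms_wedge[OF \<mu>(1) \<Theta>(1)] forms_wedge[OF \<sigma>(1) p(1)]] by blast
qed

end

section \<open>Determinants and top degree covectors\<close>

text \<open>If \<open>N\<close> is the identity outside the image of \<open>f\<close>, only the permutations
  that fix the complement of this image contribute to the Leibniz formula. For bijective
  \<open>f\<close> this is the change of the index type.\<close>

lemma det_submatrix:
  fixes N :: "'k::comm_ring_1^'b::finite^'b" and f :: "'c::finite \<Rightarrow> 'b"
  assumes f: "inj f" and id: "\<And>x y. x \<notin> range f \<Longrightarrow> N $ x $ y = (if x = y then 1 else 0)"
  shows "det N = det (\<chi> i j. N $ f i $ f j)"
proof -
  let ?t = "\<lambda>p. of_int (sign p) * (\<Prod>x\<in>UNIV. N $ x $ p x)"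
  let ?h = "map_permutation UNIV f"
  have bij: "bij_betw f UNIV (range f)" using f by (simp add: inj_on_imp_bij_betw)
  have "det N = (\<Sum>p\<in>{p. p permutes range f}. ?t p)"
    unfolding det_def
  proof (rule sum.mono_neutral_right)
    show "{p. p permutes range f} \<subseteq> {p. p permutes UNIV}" using permutes_subset by blast
    show "\<forall>p\<in>{p. p permutes UNIV} - {p. p permutes range f}. ?t p = 0"
    proof
      fix p assume p: "p \<in> {p. p permutes UNIV} - {p. p permutes range f}"
      then obtain x where "x \<notin> range f" "p x \<noteq> x"
        by (auto simp: permutes_def)
      then have "N $ x $ p x = 0" using id by metis
      then have "(\<Prod>x\<in>UNIV. N $ x $ p x) = 0" by (meson UNIV_I finite prod_zero)
      then show "?t p = 0" by simp
    qed
  qed simp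
  also have "\<dots> = (\<Sum>q\<in>{q. q permutes UNIV}. ?t (?h q))"
  proof (rule sum.reindex_bij_betw[symmetric])
    have "?h = (\<lambda>q x. if x \<in> range f then f (q (inv_into UNIV f x)) else x)"
      by (simp add: map_permutation_def restrict_id_def fun_eq_iff)
    then show "bij_betw ?h {q. q permutes UNIV} {p. p permutes range f}"
      using bij_betw_permutations[OF bij] by simp
  qed
  also have "\<dots> = (\<Sum>q\<in>{q. q permutes UNIV}. of_int (sign q) * (\<Prod>i\<in>UNIV. (\<chi> i j. N $ f i $ f j) $ i $ q i))"
  proof (rule sum.cong[OF refl])
    fix q :: "'c \<Rightarrow> 'c" assume "q \<in> {q. q permutes UNIV}"
    then have q: "q permutes UNIV" by simp
    have h: "?h q (f i) = f (q i)" "x \<notin> range f \<Longrightarrow> ?h q x = x" for i x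
      using f by (simp_all add: map_permutation_def restrict_id_def)
    have "(\<Prod>x\<in>UNIV. N $ x $ ?h q x) = (\<Prod>x\<in>range f. N $ x $ ?h q x)"
      by (rule prod.mono_neutral_right) (auto simp: h(2) id)
    also have "\<dots> = (\<Prod>i\<in>UNIV. N $ f i $ f (q i))"
      by (simp add: prod.reindex f h(1))
    finally show "?t (?h q) = of_int (sign q) * (\<Prod>i\<in>UNIV. (\<chi> i j. N $ f i $ f j) $ i $ q i)"
      using sign_map_permutation[OF f q] by simp
  qed
  finally show ?thesis by (simp add: det_def)
qed

text \<open>The matrix is the product of two matrices, each with one block replaced by the identity.\<close>

lemma det_block_diagonal:
  fixes M :: "'k::comm_ring_1^('b::finite + 'c::finite)^('b + 'c)"
  assumes "\<And>i j. M $ Inl i $ Inr j = 0" "\<And>i j. M $ Inr i $ Inl j = 0"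
  shows "det M = det (\<chi> i j. M $ Inl i $ Inl j) * det (\<chi> i j. M $ Inr i $ Inr j)"
proof -
  let ?L = "\<chi> x y. if isl x then M $ x $ y else if x = y then 1 else 0"
  let ?R = "\<chi> x y. if \<not> isl x then M $ x $ y else if x = y then 1 else 0"
  have "M = ?L ** ?R"
  proof -
    have "(?L ** ?R) $ x $ y = M $ x $ y" for x y
    proof (cases x)
      case (Inl i)
      have "(?L ** ?R) $ x $ y = (\<Sum>w\<in>UNIV. if y = w then M $ x $ y else 0)"
        unfolding matrix_matrix_mult_def vec_lambda_beta
      proof (rule sum.cong[OF refl])
        fix w show "(if isl x then M $ x $ w else if x = w then 1 else 0) *
            (if \<not> isl w then M $ w $ y else if w = y then 1 else 0) = (if y = w then M $ x $ y else 0)"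
          using assms Inl by (cases w) auto
      qed
      then show ?thesis by simp
    next
      case (Inr i)
      have "(?L ** ?R) $ x $ y = (\<Sum>w\<in>UNIV. if x = w then M $ x $ y else 0)"
        unfolding matrix_matrix_mult_def vec_lambda_beta
        by (rule sum.cong[OF refl]) (use assms Inr in auto)
      then show ?thesis by simp
    qed
    then show ?thesis by (simp add: vec_eq_iff)
  qed
  then have "det M = det (?L ** ?R)" by (rule arg_cong)
  then have "det M = det ?L * det ?R" unfolding det_mul .
  moreover have "det ?L = det (\<chi> i j. ?L $ Inl i $ Inl j)"
  proof (rule det_submatrix[where f = Inl])
    fix x y :: "'b + 'c" assume "x \<notin> range Inl"
    then have "\<not> isl x" by (cases x) auto
    then show "?L $ x $ y = (if x = y then 1 else 0)" by simp
  qed simp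
  moreover have "det ?R = det (\<chi> i j. ?R $ Inr i $ Inr j)"
  proof (rule det_submatrix[where f = Inr])
    fix x y :: "'b + 'c" assume "x \<notin> range Inr"
    then have "isl x" by (cases x) auto
    then show "?R $ x $ y = (if x = y then 1 else 0)" by simp
  qed simp
  ultimately show ?thesis by simp
qed

lemma alternating_swap:
  assumes "alternating \<alpha>"
  shows "\<alpha> (xs @ [a] @ ys @ [b] @ zs) = - \<alpha> (xs @ [b] @ ys @ [a] @ zs)"
proof (induction ys arbitrary: xs)
  case Nil
  show ?case using alternatingD[OF assms, of xs a b zs] by simp
next
  case (Cons y ys)
  have "\<alpha> (xs @ [a] @ (y # ys) @ [b] @ zs) = - \<alpha> ((xs @ [y]) @ [a] @ ys @ [b] @ zs)"
    using alternatingD[OF assms, of xs a y "ys @ [b] @ zs"] by simp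
  also have "\<dots> = \<alpha> ((xs @ [y]) @ [b] @ ys @ [a] @ zs)"
    by (subst Cons.IH) simp
  also have "\<dots> = - \<alpha> (xs @ [b] @ (y # ys) @ [a] @ zs)"
    using alternatingD[OF assms, of xs y b "ys @ [a] @ zs"] by simp
  finally show ?case .
qed

lemma alternating_not_distinct:
  assumes "alternating \<alpha>" "\<not> distinct as"
  shows "\<alpha> as = 0"
proof -
  obtain xs ys zs a where "as = xs @ [a] @ ys @ [a] @ zs"
    using not_distinct_decomp[OF assms(2)] by blast
  then have "\<alpha> as = - \<alpha> as" using alternating_swap[OF assms(1), of xs a ys a zs] by simp
  then show ?thesis by simp
qed

lemma alternating_transpose:
  assumes "alternating \<alpha>" "distinct cs" "a \<in> set cs" "b \<in> set cs" "a \<noteq> b"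
  shows "\<alpha> (map (Transposition.transpose a b) cs) = - \<alpha> cs"
proof -
  have *: "\<alpha> (map (Transposition.transpose a b) cs) = - \<alpha> cs"
    if "cs = xs @ [a] @ ys @ [b] @ zs" for xs ys zs a b
  proof -
    have "map (Transposition.transpose a b) ws = ws" if "a \<notin> set ws" "b \<notin> set ws" for ws
      using that by (intro map_idI) (auto simp: Transposition.transpose_def)
    then have "map (Transposition.transpose a b) cs = xs @ [b] @ ys @ [a] @ zs"
      using that assms(2) by auto
    then show ?thesis using alternating_swap[OF assms(1), of xs b ys a zs] that by simp
  qed
  obtain xs zs where xs: "cs = xs @ [a] @ zs" using split_list[OF assms(3)] by auto
  then consider "b \<in> set xs" | "b \<in> set zs" using assms(4,5) by auto
  then show ?thesis
  proof cases
    case 1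
    then obtain us vs where "xs = us @ [b] @ vs" using split_list[of b xs] by auto
    then show ?thesis using *[of us b vs a zs] xs by (simp add: transpose_commute)
  next
    case 2
    then obtain us vs where "zs = us @ [b] @ vs" using split_list[of b zs] by auto
    then show ?thesis using *[of xs a us b vs] xs by simp
  qed
qed

lemma alternating_permutation:
  fixes bs :: "('n + 'n::finite) list"
  assumes "alternating \<alpha>" "distinct bs" "set bs = UNIV" "p permutes UNIV"
  shows "\<alpha> (map p bs) = of_int (sign p) * \<alpha> bs"
  using assms(4) finite
proof (induction rule: permutes_induct)
  case (swap a b p)
  have cs: "distinct (map p bs)" "set (map p bs) = UNIV"
    using assms(2,3) permutes_inj[OF swap.hyps(4)] permutes_surj[OF swap.hyps(4)]
    by (auto simp: distinct_map inj_on_def)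
  have "\<alpha> (map (Transposition.transpose a b) (map p bs)) = - \<alpha> (map p bs)"
    using alternating_transpose[OF assms(1) cs(1)] cs(2) swap.hyps(3) by simp
  moreover have "sign (Transposition.transpose a b \<circ> p) = - sign p"
    using swap.hyps sign_compose[OF permutation_swap_id[of a b], of p] permutation_permutes[of p]
    by (auto simp: sign_swap_id)
  ultimately show ?case using swap.IH by (simp add: o_def)
qed (simp add: sign_id)

text \<open>On a list of all directions, a top degree alternating covector sees only the permutations of that
  list, and the pullback becomes the Leibniz formula for the determinant.\<close>

lemma pullback_top:
  fixes bs :: "('n + 'n::finite) list"
  assumes "alternating \<alpha>" "distinct bs" "set bs = UNIV"
  shows "pullback_at \<tau> z \<alpha> bs = det (\<chi> a b. jacobian \<tau> z a b) * \<alpha> bs"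
proof -
  let ?J = "jacobian \<tau> z" and ?L = "{as :: ('n + 'n) list. length as = length bs}"
  have "length bs = CARD('n + 'n)" using assms distinct_card by metis
  then have set_as: "set as = UNIV" if "as \<in> ?L" "distinct as" for as
    using that by (metis card_eq_UNIV_imp_eq_UNIV distinct_card finite mem_Collect_eq)
  let ?f = "\<lambda>as. \<alpha> as * (\<Prod>i<length bs. ?J (as ! i) (bs ! i))"
  have "pullback_at \<tau> z \<alpha> bs = (\<Sum>as\<in>{as\<in>?L. distinct as}. ?f as)"
    unfolding pullback_at_def
    by (rule sum.mono_neutral_right) (use alternating_not_distinct[OF assms(1)] in auto)
  also have "\<dots> = (\<Sum>p\<in>{p. p permutes UNIV}. ?f (map p bs))"
  proof (rule sum.reindex_bij_betw[symmetric], unfold bij_betw_def, intro conjI)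
    show "inj_on (\<lambda>p. map p bs) {p. p permutes UNIV}"
      by (rule inj_onI) (use assms(3) in \<open>auto simp: map_eq_conv fun_eq_iff\<close>)
    show "(\<lambda>p. map p bs) ` {p. p permutes UNIV} = {as\<in>?L. distinct as}"
    proof (intro equalityI subsetI)
      fix as assume as: "as \<in> {as\<in>?L. distinct as}"
      have "\<exists>p. map p bs = as" if "length bs = length as" "distinct bs" for as bs :: "('n + 'n) list"
        using that
      proof (induction bs as rule: list_induct2)
        case (Cons x xs y ys)
        then obtain p where "map p xs = ys" by auto
        then have "map (p(x := y)) (x # xs) = y # ys" using Cons.prems by (auto simp: map_eq_conv)
        then show ?case by (rule exI[of _ "p(x := y)"])
      qed simp
      then obtain p where p: "map p bs = as" using as assms(2) by force
      have "inj p" using as assms(2,3) p by (metis (mono_tags, lifting) distinct_map mem_Collect_eq)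
      then have "p permutes UNIV" by (intro bij_imp_permutes) (auto simp: finite_UNIV_inj_surj bij_def)
      then show "as \<in> (\<lambda>p. map p bs) ` {p. p permutes UNIV}" using p by blast
    next
      fix as assume "as \<in> (\<lambda>p. map p bs) ` {p. p permutes UNIV}"
      then obtain p where "p permutes UNIV" "as = map p bs" by blast
      then show "as \<in> {as\<in>?L. distinct as}"
        using assms(2) permutes_inj_on[of p UNIV] by (simp add: distinct_map)
    qed
  qed
  also have "\<dots> = (\<Sum>p\<in>{p. p permutes UNIV}. of_int (sign p) * \<alpha> bs * (\<Prod>b\<in>UNIV. ?J (p b) b))"
  proof (rule sum.cong[OF refl])
    fix p :: "'n + 'n \<Rightarrow> 'n + 'n" assume "p \<in> {p. p permutes UNIV}"
    then have "p permutes UNIV" by simp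
    note ap = alternating_permutation[OF assms this]
    have "(\<Prod>i<length bs. ?J (map p bs ! i) (bs ! i)) = (\<Prod>i<length bs. ?J (p (bs ! i)) (bs ! i))"
      by (rule prod.cong) auto
    also have "\<dots> = (\<Prod>b\<in>UNIV. ?J (p b) b)"
      using prod.reindex_bij_betw[OF bij_betw_nth[OF assms(2) refl assms(3)[symmetric]], of "\<lambda>b. ?J (p b) b"] by simp
    finally show "?f (map p bs) = of_int (sign p) * \<alpha> bs * (\<Prod>b\<in>UNIV. ?J (p b) b)" by (simp add: ap)
  qed
  also have "\<dots> = det (transpose (\<chi> a b. ?J a b)) * \<alpha> bs"
    by (simp add: det_def transpose_def sum_distrib_left mult_ac)
  finally show ?thesis by (simp add: det_transpose)
qed

text \<open>The list of directions at which \<^const>\<open>top_density\<close> evaluates a covector.\<close>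

definition top_index :: "('n + 'n::finite) list" where
  "top_index = concat (map (\<lambda>i. [Inl i, Inr i]) (SOME ns. distinct ns \<and> set ns = UNIV))"

lemma top_index:
  "distinct (top_index :: ('n + 'n::finite) list)" "set (top_index :: ('n + 'n) list) = UNIV"
proof -
  define ns :: "'n list" where "ns = (SOME ns. distinct ns \<and> set ns = UNIV)"
  have "\<exists>ns :: 'n list. distinct ns \<and> set ns = UNIV" using finite_distinct_list[of "UNIV :: 'n set"] by auto
  then have ns: "distinct ns" "set ns = UNIV" using someI_ex[of "\<lambda>ns :: 'n list. distinct ns \<and> set ns = UNIV"] unfolding ns_def by auto
  have "distinct (concat (map (\<lambda>i. [Inl i, Inr i]) ms))" if "distinct ms" for ms :: "'n list"
    using that by (induction ms) auto
  then show "distinct (top_index :: ('n + 'n) list)" using ns by (simp add: top_index_def ns_def)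
  have "x \<in> set (concat (map (\<lambda>i. [Inl i, Inr i]) ns))" for x :: "'n + 'n"
    by (cases x) (auto simp: ns(2))
  then show "set (top_index :: ('n + 'n) list) = UNIV" by (auto simp: top_index_def ns_def)
qed

lemma top_density_eq: "top_density \<alpha> = (-2 * \<i>) ^ CARD('n) * \<alpha> top_index" for \<alpha> :: "'n::finite covec"
  by (simp add: top_density_def top_index_def)

text \<open>The matrix of a real linear map in the real basis \<open>\<partial>/\<partial>x\<^sup>i, \<partial>/\<partial>y\<^sup>i\<close>, indexed like the Wirtinger
  basis.\<close>

definition real_coord :: "'n + 'n \<Rightarrow> complex^'n \<Rightarrow> real" where
  "real_coord a v = (case a of Inl k \<Rightarrow> Re (v $ k) | Inr k \<Rightarrow> Im (v $ k))"

definition real_basis :: "'n + 'n \<Rightarrow> complex^'n::finite" where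
  "real_basis a = (case a of Inl k \<Rightarrow> axis k 1 | Inr k \<Rightarrow> axis k \<i>)"

definition real_matrix :: "(complex^'n \<Rightarrow> complex^'n) \<Rightarrow> real^('n + 'n::finite)^('n + 'n)" where
  "real_matrix D = (\<chi> a b. real_coord a (D (real_basis b)))"

lemma det_cnj: "det (\<chi> i j. cnj (M $ i $ j)) = cnj (det M)" for M :: "complex^'b::finite^'b"
  by (simp add: det_def)

lemma det_of_real: "det (\<chi> i j. (of_real (M $ i $ j) :: complex)) = of_real (det M)"
  for M :: "real^'b::finite^'b"
  by (simp add: det_def)

lemma wirtinger_part_eq_sum:
  "wirtinger_part b E = (\<Sum>d\<in>UNIV. E (real_basis d) * (case b of
      Inl i \<Rightarrow> (case d of Inl j \<Rightarrow> if i = j then 1/2 else 0 | Inr j \<Rightarrow> if i = j then - \<i>/2 else 0)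
    | Inr i \<Rightarrow> (case d of Inl j \<Rightarrow> if i = j then 1/2 else 0 | Inr j \<Rightarrow> if i = j then \<i>/2 else 0)))"
  by (cases b) (simp_all add: sum_index wirtinger_part_def real_basis_def if_distrib field_simps cong: if_cong)

lemma coord_fun_eq_sum:
  "coord_fun a v = (\<Sum>c\<in>UNIV. (case a of
      Inl i \<Rightarrow> (case c of Inl j \<Rightarrow> if i = j then 1 else 0 | Inr j \<Rightarrow> if i = j then \<i> else 0)
    | Inr i \<Rightarrow> (case c of Inl j \<Rightarrow> if i = j then 1 else 0 | Inr j \<Rightarrow> if i = j then - \<i> else 0))
      * of_real (real_coord c v))"
  by (cases a) (simp_all add: sum_index coord_fun_def real_coord_def if_distrib[of "\<lambda>x. x * _"]
      complex_eq_iff cong: if_cong)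

text \<open>The complexified Jacobian is the real one in another basis: the base changes \<open>P\<close> and
  \<open>Q\<close> between the real and the Wirtinger basis are inverse to each other.\<close>

lemma det_jacobian_real:
  assumes "\<tau> differentiable at z"
  shows "det (\<chi> a b. jacobian \<tau> z a b) = of_real (det (real_matrix (frechet_derivative \<tau> (at z))))"
proof -
  let ?T = "frechet_derivative \<tau> (at z)"
  define P :: "complex^('a + 'a)^('a + 'a)" where "P = (\<chi> a c. case a of
      Inl i \<Rightarrow> (case c of Inl j \<Rightarrow> if i = j then 1 else 0 | Inr j \<Rightarrow> if i = j then \<i> else 0)
    | Inr i \<Rightarrow> (case c of Inl j \<Rightarrow> if i = j then 1 else 0 | Inr j \<Rightarrow> if i = j then - \<i> else 0))"
  define Q :: "complex^('a + 'a)^('a + 'a)" where "Q = (\<chi> d b. case b of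
      Inl i \<Rightarrow> (case d of Inl j \<Rightarrow> if i = j then 1/2 else 0 | Inr j \<Rightarrow> if i = j then - \<i>/2 else 0)
    | Inr i \<Rightarrow> (case d of Inl j \<Rightarrow> if i = j then 1/2 else 0 | Inr j \<Rightarrow> if i = j then \<i>/2 else 0))"
  let ?R = "\<chi> a b. (of_real (real_matrix ?T $ a $ b) :: complex)"
  have T: "(\<tau> has_derivative ?T) (at z)" using assms frechet_derivative_works by blast
  have "jacobian \<tau> z a b = (P ** ?R ** Q) $ a $ b" for a b
  proof -
    have "jacobian \<tau> z a b = wirtinger_part b (\<lambda>v. coord_fun a (?T v))"
      unfolding jacobian_def
      by (rule wirtinger_eq[OF bounded_linear.has_derivative[OF bounded_linear_coord_fun T]])
    also have "\<dots> = (\<Sum>d\<in>UNIV. coord_fun a (?T (real_basis d)) * Q $ d $ b)"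
      by (simp add: wirtinger_part_eq_sum Q_def)
    also have "\<dots> = (\<Sum>d\<in>UNIV. (\<Sum>c\<in>UNIV. P $ a $ c * ?R $ c $ d) * Q $ d $ b)"
      by (simp add: coord_fun_eq_sum P_def real_matrix_def)
    finally show ?thesis by (simp add: matrix_matrix_mult_def)
  qed
  then have "(\<chi> a b. jacobian \<tau> z a b) = P ** ?R ** Q" by (simp add: vec_eq_iff)
  then have "det (\<chi> a b. jacobian \<tau> z a b) = det P * det Q * det ?R" by (simp add: det_mul)
  also have "P ** Q = mat 1"
  proof -
    have "(P ** Q) $ a $ b = mat 1 $ a $ b" for a b
      by (cases a; cases b) (auto simp: matrix_matrix_mult_def P_def Q_def sum_index mat_def
          if_distrib[of "\<lambda>x. x * _"] if_distrib[of "\<lambda>x. _ * x"] cong: if_cong)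
    then show ?thesis by (simp add: vec_eq_iff)
  qed
  then have "det P * det Q = 1" by (metis det_I det_mul)
  finally show ?thesis by (simp add: det_of_real)
qed

context complex_mfd
begin

text \<open>Holomorphic changes of coordinates preserve the orientation, so that the absolute value in the
  change of variables formula disappears.\<close>

lemma top_density_transition:
  assumes "c \<in> A" "d \<in> A" "z \<in> overlap c d" "\<omega> \<in> forms A"
  shows "top_density (\<omega> c z)
    = \<bar>det (real_matrix (frechet_derivative (transition c d) (at z)))\<bar> *\<^sub>R top_density (\<omega> d (transition c d z))"
proof -
  let ?\<tau> = "transition c d" and ?R = "det (real_matrix (frechet_derivative (transition c d) (at z)))"
  let ?J = "\<chi> k j. jacobian ?\<tau> z (Inl k) (Inl j)"
  have "?\<tau> differentiable at z"
    using smooth_on_differentiable[OF smooth_transition] assms by blast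
  note r = det_jacobian_real[OF this]
  have "det (\<chi> a b. jacobian ?\<tau> z a b) = det ?J * cnj (det ?J)"
    using det_block_diagonal[of "\<chi> a b. jacobian ?\<tau> z a b"] jacobian_transition[OF assms(1-3)] det_cnj[of ?J]
    by simp
  then have "of_real ?R = complex_of_real ((cmod (det ?J))\<^sup>2)"
    unfolding complex_norm_square r[symmetric] .
  then have "?R \<ge> 0" by (metis of_real_eq_iff zero_le_power2)
  moreover have "top_density (\<omega> c z) = of_real ?R * top_density (\<omega> d (?\<tau> z))"
    using form_pullback[OF assms(4,1-3)] pullback_top[OF form_alternating[OF assms(4)] top_index] r
    by (simp add: top_density_eq)
  ultimately show ?thesis by (simp add: scaleR_conv_of_real)
qed

end

section \<open>Integration of compactly supported functions\<close>

lemma integrable_compact_support: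
  fixes f :: "'a::euclidean_space \<Rightarrow> 'b::{banach, second_countable_topology}"
  assumes "continuous_on UNIV f" "compact K" "\<And>x. x \<notin> K \<Longrightarrow> f x = 0"
  shows "integrable lborel f"
proof -
  have "integrable lborel (\<lambda>x. indicator K x *\<^sub>R f x)"
    by (rule borel_integrable_compact[OF assms(2) continuous_on_subset[OF assms(1)]]) simp
  moreover have "(\<lambda>x. indicator K x *\<^sub>R f x) = f" using assms(3) by (auto simp: indicator_def fun_eq_iff)
  ultimately show ?thesis by simp
qed

lemma frechet_derivative_zero_outside:
  fixes f :: "'a::euclidean_space \<Rightarrow> 'b::real_normed_vector"
  assumes "compact K" "\<And>x. x \<notin> K \<Longrightarrow> f x = 0" "x \<notin> K"
  shows "frechet_derivative f (at x) v = 0"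
proof -
  have "frechet_derivative (\<lambda>x. 0) (at x) = frechet_derivative f (at x)"
    by (rule frechet_derivative_transform_within_open[where X = "- K"])
      (use assms compact_imp_closed in auto)
  then show ?thesis by (metis frechet_derivative_const)
qed

text \<open>By translation invariance the difference quotients of \<open>f\<close> have integral zero. They
  are dominated by a multiple of the indicator of a large ball, and they converge to the derivative.\<close>

lemma integral_directional_derivative:
  fixes f :: "'a::euclidean_space \<Rightarrow> complex"
  assumes f: "smooth_on UNIV f" and K: "compact K" and f0: "\<And>x. x \<notin> K \<Longrightarrow> f x = 0"
  shows "(LINT x|lborel. frechet_derivative f (at x) v) = 0"
proof -
  let ?D = "\<lambda>x. frechet_derivative f (at x) v"
  define g where "g k x = real (Suc k) *\<^sub>R (f (x + inverse (real (Suc k)) *\<^sub>R v) - f x)" for k x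
  have cf: "continuous_on UNIV f" by (rule smooth_on_continuous_on[OF f])
  have cD: "continuous_on UNIV ?D" by (rule smooth_on_continuous_on[OF smooth_on_frechet_derivative[OF f]])
  have D0: "?D x = 0" if "x \<notin> K" for x by (rule frechet_derivative_zero_outside[OF K f0 that])
  have "bounded (?D ` K)"
    using compact_continuous_image[OF continuous_on_subset[OF cD] K] compact_imp_bounded by blast
  then obtain B where "\<And>x. x \<in> K \<Longrightarrow> norm (?D x) \<le> B" "B > 0"
    unfolding bounded_pos by blast
  then have B: "norm (?D x) \<le> B" for x using D0 by (cases "x \<in> K") auto
  obtain R where R: "\<And>x. x \<in> K \<Longrightarrow> norm x \<le> R"
    using compact_imp_bounded[OF K] unfolding bounded_iff by blast
  \<comment> \<open>The steps have length at most \<open>norm v\<close>, so all difference quotients vanish outside this ball.\<close>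
  define W where "W = cball (0::'a) (R + norm v)"
  have curve: "((\<lambda>t. f (x + t *\<^sub>R v)) has_derivative (\<lambda>h. h *\<^sub>R ?D (x + t *\<^sub>R v))) (at t)" for x t
  proof -
    have F: "(f has_derivative frechet_derivative f (at (x + t *\<^sub>R v))) (at (x + t *\<^sub>R v))"
      using smooth_on_has_derivative[OF f] by simp
    have line: "((\<lambda>t. x + t *\<^sub>R v) has_derivative (\<lambda>h. h *\<^sub>R v)) (at t)"
      by (auto intro!: derivative_eq_intros)
    show ?thesis
      by (rule has_derivative_eq_rhs[OF has_derivative_compose[OF line F]])
        (simp add: linear_cmul[OF has_derivative_linear[OF F]])
  qed
  have bound: "norm (g k x) \<le> B * indicator W x" for k x
  proof (cases "x \<in> W")
    case True
    let ?t = "inverse (real (Suc k))"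
    have "norm (f (x + ?t *\<^sub>R v) - f (x + 0 *\<^sub>R v)) \<le> B * norm (?t - 0)"
    proof (rule differentiable_bound[where f' = "\<lambda>t h. h *\<^sub>R ?D (x + t *\<^sub>R v)" and S = UNIV])
      show "onorm (\<lambda>h. h *\<^sub>R ?D (x + t *\<^sub>R v)) \<le> B" for t
        by (rule onorm_le) (use mult_right_mono[OF B[of "x + t *\<^sub>R v"] abs_ge_zero] in \<open>simp add: mult.commute\<close>)
    qed (use curve in auto)
    then have "real (Suc k) * norm (f (x + ?t *\<^sub>R v) - f x) \<le> real (Suc k) * (B * ?t)"
      by (intro mult_left_mono) auto
    also have "\<dots> = B" by simp
    finally show ?thesis using True by (simp add: g_def)
  next
    case False
    have "x + s *\<^sub>R v \<notin> K" if "0 \<le> s" "s \<le> 1" for s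
    proof
      assume "x + s *\<^sub>R v \<in> K"
      then have "norm (x + s *\<^sub>R v) \<le> R" by (rule R)
      moreover have "norm x \<le> norm (x + s *\<^sub>R v) + norm (s *\<^sub>R v)"
        using norm_triangle_ineq4[of "x + s *\<^sub>R v" "s *\<^sub>R v"] by simp
      moreover have "norm (s *\<^sub>R v) \<le> norm v" using that by (simp add: mult_left_le_one_le)
      ultimately show False using False by (simp add: W_def)
    qed
    from this[of 0] this[of "inverse (real (Suc k))"] have "g k x = 0"
      by (simp add: g_def f0 inverse_le_1_iff)
    then show ?thesis using \<open>B > 0\<close> by simp
  qed
  have lim: "(\<lambda>k. g k x) \<longlonglongrightarrow> ?D x" for x
  proof -
    have "((\<lambda>h. norm (f (x + (0 + h) *\<^sub>R v) - f (x + 0 *\<^sub>R v) - h *\<^sub>R ?D (x + 0 *\<^sub>R v)) / norm h) \<longlongrightarrow> 0) (at 0)"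
      using curve[of x 0] unfolding has_derivative_at by blast
    moreover have "filterlim (\<lambda>k. inverse (real (Suc k))) (at 0) sequentially"
      unfolding filterlim_at using LIMSEQ_inverse_real_of_nat by simp
    ultimately have "(\<lambda>k. norm (f (x + (0 + inverse (real (Suc k))) *\<^sub>R v) - f (x + 0 *\<^sub>R v)
        - inverse (real (Suc k)) *\<^sub>R ?D (x + 0 *\<^sub>R v)) / norm (inverse (real (Suc k)))) \<longlonglongrightarrow> 0"
      by (rule filterlim_compose)
    moreover have "norm (f (x + (0 + inverse (real (Suc k))) *\<^sub>R v) - f (x + 0 *\<^sub>R v)
        - inverse (real (Suc k)) *\<^sub>R ?D (x + 0 *\<^sub>R v)) / norm (inverse (real (Suc k))) = norm (g k x - ?D x)" for k
    proof -
      have "g k x - ?D x = real (Suc k) *\<^sub>R (f (x + inverse (real (Suc k)) *\<^sub>R v) - f x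
          - inverse (real (Suc k)) *\<^sub>R ?D x)"
        by (simp add: g_def scaleR_diff_right del: of_nat_Suc)
      then show ?thesis by (simp add: divide_inverse mult.commute del: of_nat_Suc)
    qed
    ultimately show ?thesis by (simp add: LIM_zero_iff tendsto_norm_zero_iff)
  qed
  have intf: "integrable lborel f" by (rule integrable_compact_support[OF cf K f0])
  have [measurable]: "f \<in> borel_measurable borel" using cf by (rule borel_measurable_continuous_onI)
  have trans: "integrable lborel (\<lambda>x. f (x + w))" "(LINT x|lborel. f (x + w)) = (LINT x|lborel. f x)" for w
  proof -
    have "integrable (distr lborel borel ((+) w)) f" using intf by (simp add: lborel_distr_plus)
    then show "integrable lborel (\<lambda>x. f (x + w))" by (subst (asm) integrable_distr_eq) (auto simp: add.commute)
    have "(LINT x|lborel. f x) = integral\<^sup>L (distr lborel borel ((+) w)) f" by (simp add: lborel_distr_plus)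
    then show "(LINT x|lborel. f (x + w)) = (LINT x|lborel. f x)" by (subst (asm) integral_distr) (auto simp: add.commute)
  qed
  have "(LINT x|lborel. g k x) = 0" for k
    unfolding g_def by (simp add: trans intf del: of_nat_Suc)
  moreover have "(\<lambda>k. LINT x|lborel. g k x) \<longlonglongrightarrow> (LINT x|lborel. ?D x)"
  proof (rule integral_dominated_convergence[where w = "\<lambda>x. B * indicator W x"])
    show "?D \<in> borel_measurable lborel" using cD by (simp add: borel_measurable_continuous_onI)
    show "g k \<in> borel_measurable lborel" for k unfolding g_def by measurable
    have "integrable lborel (\<lambda>x. indicator W x *\<^sub>R B)"
      by (rule borel_integrable_compact) (auto simp: W_def)
    then show "integrable lborel (\<lambda>x. B * indicator W x)" by (simp add: mult.commute)
  qed (use lim bound in auto)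
  ultimately show ?thesis by (simp add: LIMSEQ_const_iff)
qed

lemma wirtinger_zero_outside:
  assumes "compact K" "\<And>x. x \<notin> K \<Longrightarrow> f x = 0" "x \<notin> K"
  shows "wirtinger a f x = 0"
  using frechet_derivative_zero_outside[OF assms]
  by (simp add: wirtinger_eq' wirtinger_part_def split: sum.split)

lemma integral_wirtinger:
  assumes f: "smooth_on UNIV f" and K: "compact K" and f0: "\<And>x. x \<notin> K \<Longrightarrow> f x = 0"
  shows "integrable lborel (wirtinger a f)" "(LINT x|lborel. wirtinger a f x) = 0"
proof -
  let ?D = "\<lambda>v x. frechet_derivative f (at x) v"
  show "integrable lborel (wirtinger a f)"
    by (rule integrable_compact_support[OF smooth_on_continuous_on[OF smooth_on_wirtinger[OF _ f]] K
          wirtinger_zero_outside[OF K f0]]) auto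
  have int: "integrable lborel (?D v)" for v
    by (rule integrable_compact_support[OF smooth_on_continuous_on[OF smooth_on_frechet_derivative[OF f]] K
          frechet_derivative_zero_outside[OF K f0]])
  show "(LINT x|lborel. wirtinger a f x) = 0"
    by (cases a) (simp_all add: wirtinger_eq' wirtinger_part_def int integral_directional_derivative[OF f K f0])
qed

section \<open>Change of variables in complex coordinates\<close>

lemma Basis_complex_vec: "(Basis :: (complex^'n::finite) set) = range real_basis"
proof -
  have "(Basis :: (complex^'n) set) = (\<Union>i. {axis i 1, axis i \<i>})" by (auto simp: Basis_vec_def Basis_complex_def)
  also have "\<dots> = range real_basis"
  proof (intro equalityI subsetI)
    fix x :: "complex^'n" assume "x \<in> (\<Union>i. {axis i 1, axis i \<i>})"
    then obtain i where "x = real_basis (Inl i) \<or> x = real_basis (Inr i)" by (auto simp: real_basis_def)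
    then show "x \<in> range real_basis" by auto
  qed (auto simp: real_basis_def split: sum.splits)
  finally show ?thesis .
qed

lemma inner_real_basis: "v \<bullet> real_basis a = real_coord a v"
  by (cases a) (simp_all add: real_basis_def real_coord_def inner_axis inner_complex_def)

lemma inj_real_basis: "inj real_basis"
  by (rule injI) (auto simp: real_basis_def axis_eq_axis complex_eq_iff split: sum.splits)

text \<open>The change of variables formula for \<open>\<real>\<^sup>m\<close> is transported to \<open>\<complex>\<^sup>n\<close> along an enumeration \<open>e\<close> of the real
  coordinates by \<^typ>\<open>'n bit0\<close>, a well-ordered index type with \<open>2n\<close> elements.\<close>

context
  fixes e :: "'n::finite bit0 \<Rightarrow> 'n + 'n"
  assumes e: "bij e"
begin

definition from_real :: "real^'n bit0 \<Rightarrow> complex^'n" where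
  "from_real x = (\<chi> k. Complex (x $ inv e (Inl k)) (x $ inv e (Inr k)))"

definition to_real :: "complex^'n \<Rightarrow> real^'n bit0" where
  "to_real v = (\<chi> i. real_coord (e i) v)"

lemma real_coord_from_real: "real_coord a (from_real x) = x $ inv e a"
  by (cases a) (simp_all add: real_coord_def from_real_def)

lemma from_to_real [simp]: "from_real (to_real v) = v"
  using e by (simp add: from_real_def to_real_def vec_eq_iff complex_eq_iff real_coord_def
      bij_is_surj surj_f_inv_f)

lemma to_from_real [simp]: "to_real (from_real x) = x"
  using e by (simp add: to_real_def vec_eq_iff real_coord_from_real bij_is_inj)

lemma bounded_linear_from_real: "bounded_linear from_real"
  by (intro linear_conv_bounded_linear[THEN iffD1] linearI)
    (simp_all add: from_real_def vec_eq_iff complex_eq_iff)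

lemma bounded_linear_to_real: "bounded_linear to_real"
  by (intro linear_conv_bounded_linear[THEN iffD1] linearI)
    (auto simp: to_real_def vec_eq_iff real_coord_def split: sum.split)

lemma from_real_axis: "from_real (axis j 1) = real_basis (e j)"
proof -
  have "real_coord a (from_real (axis j 1)) = real_coord a (real_basis (e j))" for a
  proof -
    have "inv e a = j \<longleftrightarrow> a = e j" using e by (metis bij_inv_eq_iff)
    then show ?thesis unfolding real_coord_from_real
      by (cases a; cases "e j") (auto simp: axis_def real_coord_def real_basis_def)
  qed
  from this[of "Inl _"] this[of "Inr _"] show ?thesis
    by (simp add: vec_eq_iff complex_eq_iff real_coord_def)
qed

text \<open>The coordinate change permutes the coordinates, so it maps boxes to boxes of the same volume.\<close>

lemma lborel_from_real: "distr lborel borel from_real = (lborel :: (complex^'n) measure)"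
proof (rule lborel_eqI[symmetric])
  have meas: "from_real \<in> borel_measurable borel"
    by (intro borel_measurable_continuous_onI linear_continuous_on bounded_linear_from_real)
  fix l u :: "complex^'n" assume le: "\<And>b. b \<in> Basis \<Longrightarrow> l \<bullet> b \<le> u \<bullet> b"
  have le': "real_coord a l \<le> real_coord a u" for a
    using le[of "real_basis a"] by (simp add: Basis_complex_vec inner_real_basis)
  have "from_real -` box l u = box (to_real l) (to_real u)"
  proof -
    have "from_real x \<in> box l u \<longleftrightarrow> (\<forall>a. real_coord a l < x $ inv e a \<and> x $ inv e a < real_coord a u)" for x
      by (simp add: mem_box Basis_complex_vec inner_real_basis real_coord_from_real)
    also have "\<dots> x \<longleftrightarrow> (\<forall>i. real_coord (e i) l < x $ i \<and> x $ i < real_coord (e i) u)" for x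
      using e by (metis bij_inv_eq_iff)
    also have "\<dots> x \<longleftrightarrow> x \<in> box (to_real l) (to_real u)" for x
      by (simp add: mem_box_cart to_real_def)
    finally show ?thesis by auto
  qed
  then have "emeasure (distr lborel borel from_real) (box l u) = emeasure lborel (box (to_real l) (to_real u))"
    using meas by (simp add: emeasure_distr)
  also have "\<dots> = ennreal (\<Prod>b\<in>Basis. (to_real u - to_real l) \<bullet> b)"
    by (rule emeasure_lborel_box) (auto simp: Basis_vec_def inner_axis to_real_def le')
  also have "(\<Prod>b\<in>Basis. (to_real u - to_real l) \<bullet> b) = (\<Prod>i\<in>UNIV. real_coord (e i) u - real_coord (e i) l)"
  proof -
    have B: "(Basis :: (real^'n bit0) set) = range (\<lambda>i. axis i 1)" by (auto simp: Basis_vec_def)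
    have "inj (\<lambda>i :: 'n bit0. axis i (1::real))" by (simp add: inj_on_def axis_eq_axis)
    then show ?thesis unfolding B by (simp add: prod.reindex inner_axis to_real_def)
  qed
  also have "\<dots> = (\<Prod>a\<in>UNIV. real_coord a u - real_coord a l)"
    by (rule prod.reindex_bij_betw[OF e])
  also have "\<dots> = (\<Prod>b\<in>Basis. (u - l) \<bullet> b)"
    by (simp add: Basis_complex_vec prod.reindex inj_real_basis inner_diff_left inner_real_basis)
  finally show "emeasure (distr lborel borel from_real) (box l u) = (\<Prod>b\<in>Basis. (u - l) \<bullet> b)" .
qed simp

lemma integral_from_real:
  fixes F :: "complex^'n \<Rightarrow> real"
  assumes "integrable lborel F"
  shows "integrable lborel (\<lambda>x. F (from_real x))" "(LINT x|lborel. F (from_real x)) = (LINT z|lborel. F z)"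
proof -
  have meas: "from_real \<in> lborel \<rightarrow>\<^sub>M borel"
    using linear_continuous_on[OF bounded_linear_from_real, of UNIV]
    by (simp add: borel_measurable_continuous_onI)
  have F: "F \<in> borel_measurable borel" using borel_measurable_integrable[OF assms] by simp
  show "integrable lborel (\<lambda>x. F (from_real x))"
    using assms integrable_distr_eq[OF meas F] by (simp add: lborel_from_real)
  show "(LINT x|lborel. F (from_real x)) = (LINT z|lborel. F z)"
    using integral_distr[OF meas F] by (simp add: lborel_from_real)
qed

end

text \<open>The change of variables formula restated with functions that vanish outside the domains of
  integration. Real functions are treated as functions into vectors with one entry, for which the
  formula is stated.\<close>

lemma integral_substitution_real:
  fixes h k :: "real^'m::{finite,wellorder} \<Rightarrow> real" and g :: "real^'m::_ \<Rightarrow> real^'m::_"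
  assumes S: "S \<in> sets lebesgue"
    and der: "\<And>x. x \<in> S \<Longrightarrow> (g has_derivative g' x) (at x within S)"
    and inj: "inj_on g S"
    and h: "integrable lborel h" "\<And>y. y \<notin> g ` S \<Longrightarrow> h y = 0"
    and k: "integrable lborel k" "\<And>x. x \<in> S \<Longrightarrow> k x = \<bar>det (matrix (g' x))\<bar> * h (g x)" "\<And>x. x \<notin> S \<Longrightarrow> k x = 0"
  shows "(LINT x|lborel. k x) = (LINT y|lborel. h y)"
proof -
  let ?v = "vec :: real \<Rightarrow> real^1"
  have v: "bounded_linear ?v" by (intro linear_conv_bounded_linear[THEN iffD1] linearI) (simp_all add: vec_eq_iff)
  have leb: "integrable lebesgue f" "integral\<^sup>L lebesgue f = integral\<^sup>L lborel f" if "integrable lborel f" for f :: "real^'m::_ \<Rightarrow> real"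
    using that integrable_completion[of f lborel] integral_completion[of f lborel]
      borel_measurable_integrable[OF that] by simp_all
  have ind: "(\<lambda>x. indicator (g ` S) x *\<^sub>R ?v (h x)) = (\<lambda>x. ?v (h x))"
    "(\<lambda>x. indicator S x *\<^sub>R (\<bar>det (matrix (g' x))\<bar> *\<^sub>R ?v (h (g x)))) = (\<lambda>x. ?v (k x))"
    using h(2) k(2,3) by (auto simp: fun_eq_iff indicator_def vec_eq_iff)
  have "integrable lebesgue (\<lambda>x. ?v (h x))" by (rule integrable_bounded_linear[OF v leb(1)[OF h(1)]])
  then have ai: "(\<lambda>x. ?v (h x)) absolutely_integrable_on (g ` S)"
    by (simp add: set_integrable_def ind)
  have *: "(\<lambda>x. \<bar>det (matrix (g' x))\<bar> *\<^sub>R ?v (h (g x))) absolutely_integrable_on S \<and>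
      integral S (\<lambda>x. \<bar>det (matrix (g' x))\<bar> *\<^sub>R ?v (h (g x))) = integral (g ` S) (\<lambda>x. ?v (h x))"
    by (subst has_absolute_integral_change_of_variables[OF S der inj]) (use ai in simp_all)
  have "?v (integral\<^sup>L lborel k) = (LINT x:S|lebesgue. \<bar>det (matrix (g' x))\<bar> *\<^sub>R ?v (h (g x)))"
    using integral_bounded_linear[OF v leb(1)[OF k(1)]] leb(2)[OF k(1)]
    by (simp only: set_lebesgue_integral_def ind)
  also have "\<dots> = (LINT x:g ` S|lebesgue. ?v (h x))"
    unfolding set_lebesgue_integral_eq_integral(2)[OF ai] set_lebesgue_integral_eq_integral(2)[OF *[THEN conjunct1]]
    by (rule *[THEN conjunct2])
  also have "\<dots> = ?v (integral\<^sup>L lborel h)"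
    using integral_bounded_linear[OF v leb(1)[OF h(1)]] leb(2)[OF h(1)]
    by (simp only: set_lebesgue_integral_def ind)
  finally show ?thesis by (simp add: vec_eq_iff)
qed

lemma integral_substitution:
  fixes F H :: "complex^'n::finite \<Rightarrow> complex"
  assumes S: "open S"
    and der: "\<And>z. z \<in> S \<Longrightarrow> (g has_derivative D z) (at z)"
    and inj: "inj_on g S"
    and F: "integrable lborel F" "\<And>w. w \<notin> g ` S \<Longrightarrow> F w = 0"
    and H: "integrable lborel H" "\<And>z. z \<in> S \<Longrightarrow> H z = \<bar>det (real_matrix (D z))\<bar> *\<^sub>R F (g z)" "\<And>z. z \<notin> S \<Longrightarrow> H z = 0"
  shows "(LINT z|lborel. H z) = (LINT w|lborel. F w)"
proof -
  have "CARD('n bit0) = CARD('n + 'n)" by simp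
  then obtain e :: "'n bit0 \<Rightarrow> 'n + 'n" where e: "bij e"
    using finite_same_card_bij[of "UNIV :: 'n bit0 set" "UNIV :: ('n + 'n) set"] by auto
  let ?\<phi> = "from_real e" and ?\<psi> = "to_real e"
  let ?g = "\<lambda>x. ?\<psi> (g (?\<phi> x))" and ?S = "?\<psi> ` S"
  note simps = from_to_real[OF e] to_from_real[OF e]
  have memS: "x \<in> ?S \<longleftrightarrow> ?\<phi> x \<in> S" for x using simps by (metis image_iff)
  have img: "x \<in> ?g ` ?S \<longleftrightarrow> ?\<phi> x \<in> g ` S" for x
    using simps by (auto simp: image_iff) metis+
  have "?S = ?\<phi> -` S" using memS by auto
  then have "open ?S"
    using open_vimage[OF S linear_continuous_on[OF bounded_linear_from_real[OF e]]] by simp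
  then have leb: "?S \<in> sets lebesgue" by (simp add: sets_completionI_sets)
  have der': "(?g has_derivative (\<lambda>v. ?\<psi> (D (?\<phi> x) (?\<phi> v)))) (at x within ?S)" if "x \<in> ?S" for x
  proof -
    have "(?\<phi> has_derivative ?\<phi>) (at x within ?S)"
      by (rule bounded_linear_imp_has_derivative[OF bounded_linear_from_real[OF e]])
    from has_derivative_compose[OF this der] that have "((\<lambda>x. g (?\<phi> x)) has_derivative (\<lambda>v. D (?\<phi> x) (?\<phi> v))) (at x within ?S)"
      by (simp add: memS)
    then show ?thesis by (rule bounded_linear.has_derivative[OF bounded_linear_to_real[OF e]])
  qed
  have det: "det (matrix (\<lambda>v. ?\<psi> (D z (?\<phi> v)))) = det (real_matrix (D z))" for z
  proof -
    have "matrix (\<lambda>v. ?\<psi> (D z (?\<phi> v))) = (\<chi> i j. real_matrix (D z) $ e i $ e j)"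
      by (simp add: matrix_def real_matrix_def from_real_axis[OF e] to_real_def[OF e])
    moreover have "det (real_matrix (D z)) = det (\<chi> i j. real_matrix (D z) $ e i $ e j)"
      by (rule det_submatrix) (use e in \<open>auto simp: bij_def\<close>)
    ultimately show ?thesis by simp
  qed
  have inj': "inj_on ?g ?S"
  proof (rule inj_onI)
    fix x y assume "x \<in> ?S" "y \<in> ?S" "?g x = ?g y"
    then have "?\<phi> x \<in> S" "?\<phi> y \<in> S" "g (?\<phi> x) = g (?\<phi> y)" using simps memS by metis+
    then have "?\<phi> x = ?\<phi> y" using inj by (simp add: inj_on_def)
    then show "x = y" using simps by metis
  qed
  have part: "(LINT z|lborel. L (H z)) = (LINT w|lborel. L (F w))" if L: "bounded_linear L" for L :: "complex \<Rightarrow> real"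
  proof -
    note iF = integrable_bounded_linear[OF L F(1)] and iH = integrable_bounded_linear[OF L H(1)]
    have "(LINT x|lborel. L (H (?\<phi> x))) = (LINT y|lborel. L (F (?\<phi> y)))"
    proof (rule integral_substitution_real[OF leb der' inj'])
      show "L (F (?\<phi> y)) = 0" if "y \<notin> ?g ` ?S" for y
        using F(2)[of "?\<phi> y"] that img[of y] linear_0[OF bounded_linear.linear[OF L]] by metis
      show "L (H (?\<phi> x)) = \<bar>det (matrix (\<lambda>v. ?\<psi> (D (?\<phi> x) (?\<phi> v))))\<bar> * L (F (?\<phi> (?g x)))" if "x \<in> ?S" for x
        using H(2)[of "?\<phi> x"] that by (simp add: memS det simps linear_cmul[OF bounded_linear.linear[OF L]])
      show "L (H (?\<phi> x)) = 0" if "x \<notin> ?S" for x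
        using H(3)[of "?\<phi> x"] that memS[of x] linear_0[OF bounded_linear.linear[OF L]] by metis
    qed (use integral_from_real[OF e iF] integral_from_real[OF e iH] in auto)
    then show ?thesis using integral_from_real(2)[OF e iF] integral_from_real(2)[OF e iH] by simp
  qed
  show ?thesis
    by (rule complex_eqI)
      (use part[OF bounded_linear_Re] part[OF bounded_linear_Im] F(1) H(1) in simp_all)
qed

section \<open>Stokes' theorem on a compact complex manifold\<close>

lemma top_density_add: "top_density (\<lambda>xs. \<alpha> xs + \<beta> xs) = top_density \<alpha> + top_density \<beta>"
  by (simp add: top_density_eq distrib_left)

lemma top_density_sum: "top_density (\<lambda>xs. \<Sum>i\<in>I. \<alpha> i xs) = (\<Sum>i\<in>I. top_density (\<alpha> i))"
  by (simp add: top_density_eq sum_distrib_left)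

lemma top_density_zero: "top_density (\<lambda>xs. 0) = 0"
  by (simp add: top_density_eq)

context complex_mfd
begin

text \<open>The support is measured on the manifold, so that the condition is independent of the chart.\<close>

definition supported_in :: "('a, 'n) mform \<Rightarrow> 'a set \<Rightarrow> bool" where
  "supported_in \<omega> K \<longleftrightarrow> (\<forall>c\<in>A. \<forall>z\<in>chart_image c. chart_inv c z \<notin> K \<longrightarrow> \<omega> c z = 0)"

lemma compact_chart:
  assumes "c \<in> A" "compactin X K" "K \<subseteq> fst c"
  shows "compact (snd c ` K)"
proof -
  have "compactin (subtopology X (fst c)) K" using assms by (simp add: compactin_subtopology)
  then have "compactin (top_of_set (chart_image c)) (snd c ` K)"
    using image_compactin homeomorphic_imp_continuous_map[OF chart_homeomorphic[OF assms(1)]] by blast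
  then show ?thesis by (simp add: compactin_subtopology)
qed

lemma form_zero_outside:
  assumes "\<omega> \<in> forms A" "c \<in> A" "supported_in \<omega> K" "z \<notin> snd c ` K"
  shows "\<omega> c z = 0"
proof (cases "z \<in> chart_image c")
  case True
  then have "chart_inv c z \<notin> K" using assms(4) chart_chart_inv[of z c] by (metis imageI)
  then show ?thesis using assms True by (simp add: supported_in_def)
qed (use form_zero[OF assms(1)] in blast)

text \<open>In a chart that contains the compact support, the components extend by zero to smooth functions on
  the whole of \<open>\<complex>\<^sup>n\<close>; they already have the value zero there.\<close>

lemma smooth_supported_form:
  assumes "\<omega> \<in> forms A" "c \<in> A" "compactin X K" "K \<subseteq> fst c" "supported_in \<omega> K"
  shows "smooth_on UNIV (\<lambda>z. \<omega> c z xs)"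
proof (rule smooth_on_local)
  fix z
  have cl: "open (- snd c ` K)" using compact_chart[OF assms(2-4)] compact_imp_closed by blast
  show "\<exists>T. open T \<and> z \<in> T \<and> smooth_on T (\<lambda>z. \<omega> c z xs)"
  proof (cases "z \<in> chart_image c")
    case True
    then show ?thesis using open_chart_image[OF assms(2)] form_smooth[OF assms(1,2)]
      by (auto simp: smooth_covec_def)
  next
    case False
    have "smooth_on (- snd c ` K) (\<lambda>z. \<omega> c z xs)"
      by (rule smooth_on_cong[OF cl _ smooth_on_const[OF cl, of 0]])
        (simp add: form_zero_outside[OF assms(1,2,5)])
    moreover have "z \<in> - snd c ` K" using False assms(4) by (auto simp: chart_image_def)
    ultimately show ?thesis using cl by blast
  qed
qed

definition chart_integral :: "('a, 'n) chart \<Rightarrow> ('a, 'n) mform \<Rightarrow> complex" where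
  "chart_integral c \<omega> = (LINT z|lborel. top_density (\<omega> c z))"

lemma integrable_density:
  assumes "\<omega> \<in> forms A" "c \<in> A" "compactin X K" "K \<subseteq> fst c" "supported_in \<omega> K"
  shows "integrable lborel (\<lambda>z. top_density (\<omega> c z))"
  unfolding top_density_eq
proof (rule integrable_mult_right)
  show "integrable lborel (\<lambda>z. \<omega> c z top_index)"
    by (rule integrable_compact_support[OF smooth_on_continuous_on[OF smooth_supported_form[OF assms]]
          compact_chart[OF assms(2-4)]]) (simp add: form_zero_outside[OF assms(1,2,5)])
qed

lemma open_chart_complement:
  assumes "c \<in> A" "closedin X K"
  shows "open {z \<in> chart_image c. chart_inv c z \<notin> K}"
proof -
  have "{z \<in> chart_image c. chart_inv c z \<notin> K} = snd c ` (fst c \<inter> (topspace X - K))"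
    using chart_inv_chart[OF assms(1)] chart_chart_inv chart_inv_in chart_domain_subset[OF assms(1)]
    by (auto simp: chart_image_def image_iff)
  moreover have "openin (subtopology X (fst c)) (fst c \<inter> (topspace X - K))"
    using assms(2) by (auto simp: openin_subtopology)
  then have "openin (top_of_set (chart_image c)) (snd c ` (fst c \<inter> (topspace X - K)))"
    using homeomorphic_imp_open_map[OF chart_homeomorphic[OF assms(1)]] by (simp add: open_map_def)
  ultimately show ?thesis using open_chart_image[OF assms(1)] openin_open_trans by metis
qed

lemma supported_in_ext_d:
  assumes "\<omega> \<in> forms A" "closedin X K" "supported_in \<omega> K"
  shows "supported_in (ext_d A \<omega>) K"
  unfolding supported_in_def
proof (intro ballI impI ext)
  fix c z xs assume c: "c \<in> A" "z \<in> chart_image c" "chart_inv c z \<notin> K"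
  have "local_d (\<omega> c) z = local_d (\<lambda>_ _. 0) z"
    by (rule local_ext_cong[OF open_chart_complement[OF c(1) assms(2)] _ form_differentiable[OF assms(1) c(1,2)]])
      (use c assms(3) in \<open>auto simp: supported_in_def zero_fun_def\<close>)
  then show "ext_d A \<omega> c z xs = 0 xs" using c by (simp add: ext_d_eq local_ext_def)
qed

lemma supported_in_wedge:
  "supported_in \<alpha> K \<or> supported_in \<beta> K \<Longrightarrow> supported_in (wedge_form \<alpha> \<beta>) K"
  unfolding supported_in_def wedge_form_def by (auto simp: zero_fun_def intro!: ext)

lemma supported_in_Int: "supported_in \<omega> K \<Longrightarrow> supported_in \<omega> L \<Longrightarrow> supported_in \<omega> (K \<inter> L)"
  unfolding supported_in_def by blast

text \<open>Each term of the exterior derivative is a Wirtinger derivative of a compactly supported function.\<close>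

lemma stokes_chart:
  assumes "\<omega> \<in> forms A" "c \<in> A" "compactin X K" "K \<subseteq> fst c" "supported_in \<omega> K"
  shows "chart_integral c (ext_d A \<omega>) = 0"
proof -
  let ?K = "snd c ` K"
  note sm = smooth_supported_form[OF assms] and cpt = compact_chart[OF assms(2-4)]
  have out: "\<omega> c z xs = 0" if "z \<notin> ?K" for z xs using form_zero_outside[OF assms(1,2,5) that] by simp
  have "ext_d A \<omega> c z xs = local_d (\<omega> c) z xs" for z xs
  proof (cases "z \<in> chart_image c")
    case False
    then have "z \<notin> ?K" using assms(4) by (auto simp: chart_image_def)
    then have "wirtinger a (\<lambda>u. \<omega> c u ys) z = 0" for a ys
      by (intro wirtinger_zero_outside[OF cpt out])
    then show ?thesis using False by (simp add: ext_d_zero local_ext_def)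
  qed (simp add: ext_d_eq assms(2))
  then have "chart_integral c (ext_d A \<omega>) = (-2 * \<i>) ^ CARD('n) * (LINT z|lborel. local_d (\<omega> c) z top_index)"
    by (simp add: chart_integral_def top_density_eq)
  also have "(LINT z|lborel. local_d (\<omega> c) z top_index) = 0"
    unfolding local_ext_def
    by (subst Bochner_Integration.integral_sum) (auto simp: integral_wirtinger[OF sm cpt out])
  finally show ?thesis by simp
qed

text \<open>Only the overlap of the charts contributes, and the transition map is a diffeomorphism there with
  the Jacobian determinant that \<open>top_density_transition\<close> provides.\<close>

lemma chart_integral_change:
  assumes "\<omega> \<in> forms A" "c \<in> A" "d \<in> A" "compactin X K" "K \<subseteq> fst c \<inter> fst d" "supported_in \<omega> K"
  shows "chart_integral c \<omega> = chart_integral d \<omega>"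
  unfolding chart_integral_def
proof (rule integral_substitution[where S = "overlap c d" and g = "transition c d"
      and D = "\<lambda>z. frechet_derivative (transition c d) (at z)"])
  have Kc: "K \<subseteq> fst c" and Kd: "K \<subseteq> fst d" using assms by auto
  show "integrable lborel (\<lambda>z. top_density (\<omega> c z))" by (rule integrable_density[OF assms(1,2,4) Kc assms(6)])
  show "integrable lborel (\<lambda>z. top_density (\<omega> d z))" by (rule integrable_density[OF assms(1,3,4) Kd assms(6)])
  have out: "top_density (\<omega> c z) = 0" if "z \<notin> overlap c d" "c \<in> A" "K \<subseteq> fst c" "K \<subseteq> fst d" for c d z
  proof -
    have "z \<notin> snd c ` K" using that by (auto simp: overlap_def)
    then show ?thesis using form_zero_outside[OF assms(1) that(2) assms(6)]
      by (simp add: top_density_eq)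
  qed
  show "top_density (\<omega> c z) = 0" if "z \<notin> overlap c d" for z by (rule out[OF that assms(2) Kc Kd])
  show "top_density (\<omega> d w) = 0" if "w \<notin> transition c d ` overlap c d" for w
    by (rule out[OF _ assms(3) Kd Kc]) (use that transition_overlap_image[OF assms(2,3)] in simp)
  show "(transition c d has_derivative frechet_derivative (transition c d) (at z)) (at z)" if "z \<in> overlap c d" for z
    by (rule smooth_on_has_derivative[OF smooth_transition[OF assms(2,3)] that])
qed (use assms open_overlap inj_on_transition top_density_transition in auto)

lemma partition_compact:
  assumes "partition_of_unity X A F \<rho>" "compact_space X" "c \<in> F"
  obtains K where "compactin X K" "closedin X K" "K \<subseteq> fst c" "\<And>p. p \<in> topspace X \<Longrightarrow> p \<notin> K \<Longrightarrow> \<rho> c p = 0"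
proof -
  let ?K = "X closure_of {p \<in> topspace X. \<rho> c p \<noteq> 0}"
  have "{p \<in> topspace X. \<rho> c p \<noteq> 0} \<subseteq> ?K" by (rule closure_of_subset) auto
  then have "\<rho> c p = 0" if "p \<in> topspace X" "p \<notin> ?K" for p using that by blast
  moreover have "?K \<subseteq> fst c" using assms by (simp add: partition_of_unity_def)
  ultimately show ?thesis using that[of ?K] closedin_compact_space[OF assms(2) closedin_closure_of] by simp
qed

text \<open>Integration by parts in each chart moves the derivative to the partition functions; inserting
  the partition once more and changing charts collects the derivatives to that of the constant
  \<open>1\<close>. In particular the value does not depend on the partition.\<close>

lemma partition_integral_exact:
  assumes pou: "partition_of_unity X A F \<rho>" and X: "compact_space X" and \<gamma>: "\<gamma> \<in> forms A"
  shows "(\<Sum>c\<in>F. chart_integral c (wedge_form (fun_form (\<lambda>p. of_real (\<rho> c p))) (ext_d A \<gamma>))) = 0"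
proof -
  define r where "r c = fun_form (\<lambda>p. of_real (\<rho> c p))" for c
  have F: "finite F" "F \<subseteq> A" using pou by (auto simp: partition_of_unity_def)
  have one: "(\<Sum>c\<in>F. \<rho> c p) = 1" if "p \<in> topspace X" for p using pou that by (auto simp: partition_of_unity_def)
  have inX: "chart_inv c z \<in> topspace X" if "c \<in> A" "z \<in> chart_image c" for c z
    using chart_inv_in[OF that(2)] chart_domain_subset[OF that(1)] by blast
  have r: "r c \<in> forms A" if "c \<in> F" for c
    unfolding r_def
  proof (rule forms_fun_form)
    show "smooth_fun (\<lambda>p. complex_of_real (\<rho> c p))"
      unfolding smooth_fun_def
      by (intro ballI smooth_on_of_real open_chart_image)
        (use pou that in \<open>simp_all add: partition_of_unity_def\<close>)
  qed
  have "\<forall>c\<in>F. \<exists>K. compactin X K \<and> closedin X K \<and> K \<subseteq> fst c \<and> supported_in (r c) K"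
  proof
    fix c assume "c \<in> F"
    then obtain K where K: "compactin X K" "closedin X K" "K \<subseteq> fst c" "\<And>p. p \<in> topspace X \<Longrightarrow> p \<notin> K \<Longrightarrow> \<rho> c p = 0"
      using partition_compact[OF pou X] by metis
    have "supported_in (r c) K"
      unfolding supported_in_def r_def fun_form_def using K(4) inX by (auto simp: fun_eq_iff)
    then show "\<exists>K. compactin X K \<and> closedin X K \<and> K \<subseteq> fst c \<and> supported_in (r c) K" using K by blast
  qed
  then obtain K where K: "\<And>c. c \<in> F \<Longrightarrow> compactin X (K c)" "\<And>c. c \<in> F \<Longrightarrow> closedin X (K c)"
    "\<And>c. c \<in> F \<Longrightarrow> K c \<subseteq> fst c" "\<And>c. c \<in> F \<Longrightarrow> supported_in (r c) (K c)" by metis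
  let ?\<beta> = "\<lambda>c. wedge_form (ext_d A (r c)) \<gamma>"
  have \<beta>: "?\<beta> c \<in> forms A" "supported_in (?\<beta> c) (K c)" if "c \<in> F" for c
    using forms_wedge[OF forms_ext_d[OF r[OF that]] \<gamma>]
      supported_in_wedge[OF disjI1, OF supported_in_ext_d[OF r[OF that] K(2)[OF that] K(4)[OF that]]]
    by simp_all
  have r\<beta>: "wedge_form (r d) (?\<beta> c) \<in> forms A" "supported_in (wedge_form (r d) (?\<beta> c)) (K c \<inter> K d)"
    if "c \<in> F" "d \<in> F" for c d
    using forms_wedge[OF r[OF that(2)] \<beta>(1)[OF that(1)]]
      supported_in_Int[OF supported_in_wedge[OF disjI2, OF \<beta>(2)[OF that(1)]]
        supported_in_wedge[OF disjI1, OF K(4)[OF that(2)]]]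
    by simp_all
  have cpt: "compactin X (K c \<inter> K d)" if "c \<in> F" "d \<in> F" for c d
    using closed_Int_compactin[OF K(2)[OF that(1)] K(1)[OF that(2)]] .
  have int: "integrable lborel (\<lambda>z. top_density (wedge_form (r d) (?\<beta> c) c z))"
    "integrable lborel (\<lambda>z. top_density (wedge_form (r d) (?\<beta> c) d z))" if "c \<in> F" "d \<in> F" for c d
    using integrable_density[OF r\<beta>(1)[OF that] _ cpt[OF that] _ r\<beta>(2)[OF that]] that F K(3) by blast+
  have parts: "chart_integral c (wedge_form (r c) (ext_d A \<gamma>)) = - chart_integral c (?\<beta> c)" if c: "c \<in> F" for c
  proof -
    have rc: "wedge_form (r c) \<gamma> \<in> forms A" "supported_in (wedge_form (r c) \<gamma>) (K c)"
      "wedge_form (r c) (ext_d A \<gamma>) \<in> forms A" "supported_in (wedge_form (r c) (ext_d A \<gamma>)) (K c)"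
      using forms_wedge[OF r[OF c] \<gamma>] forms_wedge[OF r[OF c] forms_ext_d[OF \<gamma>]]
        supported_in_wedge[OF disjI1, OF K(4)[OF c]] by simp_all
    have cA: "c \<in> A" using c F by blast
    have par: "parity_sign (r c c z) = r c c z" for z
      by (auto simp: r_def fun_form_def parity_sign_def fun_eq_iff covec_one_def)
    have "ext_d A (wedge_form (r c) \<gamma>) c z = (\<lambda>xs. ?\<beta> c c z xs + wedge_form (r c) (ext_d A \<gamma>) c z xs)" for z
      by (rule ext) (simp add: ext_d_wedge[OF r[OF c] \<gamma>] par, simp add: wedge_form_def)
    then have "top_density (ext_d A (wedge_form (r c) \<gamma>) c z)
        = top_density (?\<beta> c c z) + top_density (wedge_form (r c) (ext_d A \<gamma>) c z)" for z
      by (simp add: top_density_add)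
    then have "chart_integral c (ext_d A (wedge_form (r c) \<gamma>))
        = chart_integral c (?\<beta> c) + chart_integral c (wedge_form (r c) (ext_d A \<gamma>))"
      using integrable_density[OF \<beta>(1)[OF c] cA K(1)[OF c] K(3)[OF c] \<beta>(2)[OF c]]
        integrable_density[OF rc(3) cA K(1)[OF c] K(3)[OF c] rc(4)]
      by (simp add: chart_integral_def)
    then show ?thesis using stokes_chart[OF rc(1) cA K(1)[OF c] K(3)[OF c] rc(2)] by (simp add: eq_neg_iff_add_eq_0 add.commute)
  qed
  have insert: "chart_integral c (?\<beta> c) = (\<Sum>d\<in>F. chart_integral d (wedge_form (r d) (?\<beta> c)))" if c: "c \<in> F" for c
  proof -
    have "top_density (?\<beta> c c z) = (\<Sum>d\<in>F. top_density (wedge_form (r d) (?\<beta> c) c z))" for z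
    proof (cases "z \<in> chart_image c")
      case True
      then have p: "chart_inv c z \<in> topspace X" using c F inX by blast
      have "(\<Sum>d\<in>F. top_density (wedge_form (r d) (?\<beta> c) c z))
          = (\<Sum>d\<in>F. of_real (\<rho> d (chart_inv c z)) * top_density (?\<beta> c c z))"
        unfolding r_def by (simp add: wedge_fun_form[OF \<beta>(1)[OF c], unfolded r_def] fun_eq_iff top_density_eq mult_ac)
      also have "\<dots> = of_real (\<Sum>d\<in>F. \<rho> d (chart_inv c z)) * top_density (?\<beta> c c z)"
        by (simp add: sum_distrib_right)
      finally show ?thesis using one[OF p] by simp
    next
      case False
      then show ?thesis using form_zero[OF \<beta>(1)[OF c]] form_zero[OF r\<beta>(1)[OF c]] by (simp add: top_density_eq)
    qed
    then have "chart_integral c (?\<beta> c) = (\<Sum>d\<in>F. chart_integral c (wedge_form (r d) (?\<beta> c)))"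
      unfolding chart_integral_def
      by (simp only:) (rule Bochner_Integration.integral_sum, rule int(1)[OF c])
    also have "\<dots> = (\<Sum>d\<in>F. chart_integral d (wedge_form (r d) (?\<beta> c)))"
    proof (rule sum.cong[OF refl])
      fix d assume d: "d \<in> F"
      show "chart_integral c (wedge_form (r d) (?\<beta> c)) = chart_integral d (wedge_form (r d) (?\<beta> c))"
        by (rule chart_integral_change[OF r\<beta>(1)[OF c d] _ _ cpt[OF c d] _ r\<beta>(2)[OF c d]])
          (use F c d K(3)[OF c] K(3)[OF d] in auto)
    qed
    finally show ?thesis .
  qed
  have sum0: "(\<Sum>c\<in>F. ext_d A (r c) d z xs) = 0" if d: "d \<in> A" "z \<in> chart_image d" for d z xs
  proof -
    have rd: "covec_differentiable (r c d) z" if "c \<in> F" for c by (rule form_differentiable[OF r[OF that] d])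
    have "(\<Sum>c\<in>F. ext_d A (r c) d z xs) = local_d (\<lambda>u ys. \<Sum>c\<in>F. r c d u ys) z xs"
      using rd d by (simp add: local_ext_sum ext_d_eq)
    also have "local_d (\<lambda>u ys. \<Sum>c\<in>F. r c d u ys) z = local_d (\<lambda>_. covec_one) z"
    proof (rule local_ext_cong[OF open_chart_image[OF d(1)] d(2)])
      show "covec_differentiable (\<lambda>u ys. \<Sum>c\<in>F. r c d u ys) z"
        using rd F by (auto simp: covec_differentiable_def intro!: differentiable_sum)
      fix u assume u: "u \<in> chart_image d"
      have "(\<Sum>c\<in>F. of_real (\<rho> c (chart_inv d u))) = complex_of_real (\<Sum>c\<in>F. \<rho> c (chart_inv d u))" by simp
      then show "(\<lambda>ys. \<Sum>c\<in>F. r c d u ys) = covec_one"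
        using u d one[OF inX[OF d(1) u]] by (simp add: r_def fun_form_def fun_eq_iff flip: sum_distrib_right)
    qed
    finally show ?thesis by (simp add: local_ext_def)
  qed
  have total: "(\<Sum>c\<in>F. chart_integral d (wedge_form (r d) (?\<beta> c))) = 0" if d: "d \<in> F" for d
  proof -
    have "(\<Sum>c\<in>F. top_density (wedge_form (r d) (?\<beta> c) d z)) = 0" for z
    proof (cases "z \<in> chart_image d")
      case True
      have "(\<Sum>c\<in>F. wedge_form (r d) (?\<beta> c) d z xs) = 0" for xs
      proof -
        have "(\<Sum>c\<in>F. wedge_form (r d) (?\<beta> c) d z xs)
            = wedge (r d d z) (wedge (\<lambda>ys. \<Sum>c\<in>F. ext_d A (r c) d z ys) (\<gamma> d z)) xs"
          unfolding wedge_form_def wedge_sum_left[abs_def] wedge_sum_right ..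
        also have "\<dots> = 0" using True d F by (simp add: sum0 subsetD wedge_zero_left[abs_def])
        finally show ?thesis .
      qed
      then show ?thesis by (simp add: top_density_sum[symmetric] top_density_zero)
    next
      case False
      then show ?thesis using form_zero[OF r\<beta>(1)[OF _ d]] by (simp add: top_density_eq)
    qed
    moreover have "(\<Sum>c\<in>F. chart_integral d (wedge_form (r d) (?\<beta> c)))
        = (LINT z|lborel. (\<Sum>c\<in>F. top_density (wedge_form (r d) (?\<beta> c) d z)))"
      unfolding chart_integral_def
      by (rule Bochner_Integration.integral_sum[symmetric]) (rule int(2)[OF _ d])
    ultimately show ?thesis by simp
  qed
  have "(\<Sum>c\<in>F. chart_integral c (wedge_form (r c) (ext_d A \<gamma>)))
      = - (\<Sum>c\<in>F. \<Sum>d\<in>F. chart_integral d (wedge_form (r d) (?\<beta> c)))"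
    by (simp add: parts insert sum_negf)
  also have "\<dots> = - (\<Sum>d\<in>F. \<Sum>c\<in>F. chart_integral d (wedge_form (r d) (?\<beta> c)))"
    by (subst sum.swap) simp
  finally show ?thesis by (simp add: total r_def[symmetric])
qed

section \<open>Existence of partitions of unity\<close>

lemma continuous_chart_inv:
  assumes "c \<in> A" shows "continuous_map (top_of_set (chart_image c)) (subtopology X (fst c)) (chart_inv c)"
proof -
  obtain g where g: "homeomorphic_maps (subtopology X (fst c)) (top_of_set (chart_image c)) (snd c) g"
    using chart_homeomorphic[OF assms] homeomorphic_map_maps by blast
  then have cont: "continuous_map (top_of_set (chart_image c)) (subtopology X (fst c)) g"
    and inv: "\<And>z. z \<in> chart_image c \<Longrightarrow> snd c (g z) = z"
    by (auto simp: homeomorphic_maps_def)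
  have "g z = chart_inv c z" if "z \<in> chart_image c" for z
  proof -
    have "g z \<in> fst c" using cont that by (auto simp: continuous_map_def)
    then show ?thesis using inv[OF that] chart_inv_chart[OF assms] by metis
  qed
  then show ?thesis using continuous_map_eq[OF cont] by simp
qed

text \<open>Near \<open>p\<close> the function is \<open>exp (-1 / (r\<^sup>2 - |z -
  z\<^sub>0|\<^sup>2))\<close> in a chart. It is smooth in every other chart because its support
  \<open>L\<close>, the preimage of a closed ball, is compact and therefore closed in the Hausdorff
  space \<open>X\<close>.\<close>

lemma bump_function:
  assumes "p \<in> topspace X"
  obtains c U L b where "c \<in> A" "openin X U" "p \<in> U" "closedin X L" "L \<subseteq> fst c"
    "\<And>q. 0 \<le> b q" "\<And>q. q \<in> U \<Longrightarrow> 0 < b q" "\<And>q. q \<notin> L \<Longrightarrow> b q = 0"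
    "\<And>d. d \<in> A \<Longrightarrow> smooth_on (chart_image d) (\<lambda>z. b (chart_inv d z) :: real)"
proof -
  have "topspace X = (\<Union>c\<in>A. fst c)" using manifold by (simp add: complex_manifold_def)
  then obtain c where c: "c \<in> A" "p \<in> fst c" using assms by auto
  define z0 where "z0 = snd c p"
  have "z0 \<in> chart_image c" using c by (simp add: z0_def chart_image_def)
  then obtain r where r: "r > 0" "cball z0 r \<subseteq> chart_image c"
    using open_chart_image[OF c(1)] open_contains_cball by blast
  define U where "U = {q \<in> fst c. dist z0 (snd c q) < r}"
  define L where "L = chart_inv c ` cball z0 r"
  define b where "b q = (if q \<in> fst c then flat_pow 0 (r\<^sup>2 - (snd c q - z0) \<bullet> (snd c q - z0)) else 0)" for q
  have sq: "(x - z0) \<bullet> (x - z0) < r\<^sup>2 \<longleftrightarrow> dist z0 x < r" for x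
  proof -
    have "(x - z0) \<bullet> (x - z0) = (dist z0 x)\<^sup>2" by (simp add: dist_norm norm_minus_commute power2_norm_eq_inner)
    then show ?thesis using r(1) by (simp add: power2_less_imp_less power_mono_iff not_le[symmetric] abs_le_square_iff[symmetric])
  qed
  have "openin X U"
  proof -
    have "U = {q \<in> topspace (subtopology X (fst c)). snd c q \<in> chart_image c \<inter> ball z0 r}"
      using chart_domain_subset[OF c(1)] by (auto simp: U_def chart_image_def)
    moreover have "openin (top_of_set (chart_image c)) (chart_image c \<inter> ball z0 r)"
      by (simp add: openin_open_Int)
    ultimately have "openin (subtopology X (fst c)) U"
      using homeomorphic_imp_continuous_map[OF chart_homeomorphic[OF c(1)]]
      by (simp only: openin_continuous_map_preimage)
    then show ?thesis using openin_chart_domain[OF c(1)] openin_trans_full by blast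
  qed
  have L: "L \<subseteq> fst c" using r(2) chart_inv_in[of _ c] by (auto simp: L_def)
  have "compactin (top_of_set (chart_image c)) (cball z0 r)" using r(2) by (simp add: compactin_subtopology)
  then have "compactin (subtopology X (fst c)) L"
    unfolding L_def by (rule image_compactin[OF _ continuous_chart_inv[OF c(1)]])
  then have cL: "closedin X L"
    using manifold compactin_imp_closedin by (auto simp: compactin_subtopology complex_manifold_def)
  have b0: "b q = 0" if "q \<notin> L" for q
  proof (cases "q \<in> fst c")
    case True
    have "\<not> dist z0 (snd c q) < r"
    proof
      assume "dist z0 (snd c q) < r"
      then have "chart_inv c (snd c q) \<in> L" by (auto simp: L_def)
      then show False using that chart_inv_chart[OF c(1) True] by simp
    qed
    then show ?thesis using sq[of "snd c q"] by (simp add: b_def flat_pow_def)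
  qed (simp add: b_def)
  show ?thesis
  proof (rule that[of c U L b])
    show "p \<in> U" using c r by (simp add: U_def z0_def)
    show "0 \<le> b q" for q by (simp add: b_def flat_pow_def)
    show "0 < b q" if "q \<in> U" for q using that sq[of "snd c q"] by (simp add: b_def U_def flat_pow_def)
    fix d assume d: "d \<in> A"
    show "smooth_on (chart_image d) (\<lambda>z. b (chart_inv d z))"
    proof (rule smooth_on_local)
      fix z assume z: "z \<in> chart_image d"
      show "\<exists>T. open T \<and> z \<in> T \<and> smooth_on T (\<lambda>z. b (chart_inv d z))"
      proof (cases "chart_inv d z \<in> fst c")
        case True
        let ?T = "overlap d c"
        have T: "open ?T" "z \<in> ?T" using open_overlap[OF d c(1)] overlap_iff[OF d] z True by auto
        have "smooth_on ?T (\<lambda>z. flat_pow 0 (r\<^sup>2 - (transition d c z - z0) \<bullet> (transition d c z - z0)))"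
          by (rule smooth_on_compose[OF T(1) open_UNIV _ smooth_on_flat_pow])
            (auto intro!: smooth_on_diff smooth_on_inner smooth_on_const T(1) smooth_transition d c(1))
        then have "smooth_on ?T (\<lambda>z. b (chart_inv d z))"
          by (rule smooth_on_cong[OF T(1), rotated])
            (use overlap_iff[OF d] in \<open>simp add: b_def transition_def\<close>)
        then show ?thesis using T by blast
      next
        case False
        let ?T = "{z \<in> chart_image d. chart_inv d z \<notin> L}"
        have T: "open ?T" "z \<in> ?T" using open_chart_complement[OF d cL] z False L by auto
        have "smooth_on ?T (\<lambda>z. b (chart_inv d z))"
          by (rule smooth_on_cong[OF T(1) _ smooth_on_const[OF T(1), of 0]]) (simp add: b0)
        then show ?thesis using T by blast
      qed
    qed
  qed (use c \<open>openin X U\<close> cL L b0 in auto)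
qed

text \<open>Finitely many bump functions have a positive sum. Those that belong to the same chart are added
  up, because the partition is indexed by charts.\<close>

lemma partition_of_unity_exists:
  assumes "compact_space X"
  shows "\<exists>F \<rho>. partition_of_unity X A F \<rho>"
proof -
  have "\<forall>p\<in>topspace X. \<exists>c U L b. c \<in> A \<and> openin X U \<and> p \<in> U \<and> closedin X L \<and> L \<subseteq> fst c \<and>
    (\<forall>q. 0 \<le> b q) \<and> (\<forall>q\<in>U. 0 < b q) \<and> (\<forall>q. q \<notin> L \<longrightarrow> b q = 0) \<and>
    (\<forall>d\<in>A. smooth_on (chart_image d) (\<lambda>z. b (chart_inv d z) :: real))"
  proof
    fix p assume "p \<in> topspace X"
    then obtain c U L b where *: "c \<in> A" "openin X U" "p \<in> U" "closedin X L" "L \<subseteq> fst c"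
      "\<And>q. 0 \<le> b q" "\<And>q. q \<in> U \<Longrightarrow> 0 < b q" "\<And>q. q \<notin> L \<Longrightarrow> b q = 0"
      "\<And>d. d \<in> A \<Longrightarrow> smooth_on (chart_image d) (\<lambda>z. b (chart_inv d z) :: real)"
      by (rule bump_function) (rule that; assumption)
    show "\<exists>c U L b. c \<in> A \<and> openin X U \<and> p \<in> U \<and> closedin X L \<and> L \<subseteq> fst c \<and>
      (\<forall>q. 0 \<le> b q) \<and> (\<forall>q\<in>U. 0 < b q) \<and> (\<forall>q. q \<notin> L \<longrightarrow> b q = 0) \<and>
      (\<forall>d\<in>A. smooth_on (chart_image d) (\<lambda>z. b (chart_inv d z) :: real))"
      by (rule exI[of _ c], rule exI[of _ U], rule exI[of _ L], rule exI[of _ b]) (simp add: *)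
  qed
  then obtain c U L b where cULb: "\<And>p. p \<in> topspace X \<Longrightarrow> c p \<in> A \<and> openin X (U p) \<and> p \<in> U p \<and> closedin X (L p) \<and> L p \<subseteq> fst (c p) \<and>
    (\<forall>q. 0 \<le> b p q) \<and> (\<forall>q\<in>U p. 0 < b p q) \<and> (\<forall>q. q \<notin> L p \<longrightarrow> b p q = 0) \<and>
    (\<forall>d\<in>A. smooth_on (chart_image d) (\<lambda>z. b p (chart_inv d z) :: real))" by metis
  have "\<exists>\<F>. finite \<F> \<and> \<F> \<subseteq> U ` topspace X \<and> topspace X \<subseteq> \<Union>\<F>"
    by (rule compactinD[OF assms[unfolded compact_space_def]]) (use cULb in auto)
  then obtain P where P: "finite P" "P \<subseteq> topspace X" "topspace X \<subseteq> (\<Union>p\<in>P. U p)"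
    by (metis finite_subset_image)
  define B where "B q = (\<Sum>p\<in>P. b p q)" for q
  define \<rho> where "\<rho> k q = (\<Sum>p\<in>{p\<in>P. c p = k}. b p q) / B q" for k q
  have Bpos: "B q > 0" if "q \<in> topspace X" for q
  proof -
    obtain p where "p \<in> P" "q \<in> U p" using P(3) \<open>q \<in> topspace X\<close> by blast
    then show ?thesis unfolding B_def
      by (intro sum_pos2[of P p]) (use P cULb in auto)
  qed
  have "partition_of_unity X A (c ` P) \<rho>"
    unfolding partition_of_unity_def
  proof (intro conjI ballI)
    show "finite (c ` P)" "c ` P \<subseteq> A" using P cULb by auto
    show "0 \<le> \<rho> k q" if "q \<in> topspace X" for k q
      unfolding \<rho>_def using Bpos[OF that] P cULb by (intro divide_nonneg_pos sum_nonneg) auto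
    show "(\<Sum>k\<in>c ` P. \<rho> k q) = 1" if "q \<in> topspace X" for q
      using Bpos[OF that] sum.image_gen[OF P(1), of "\<lambda>p. b p q" c]
      by (simp add: \<rho>_def B_def sum_divide_distrib[symmetric])
    fix k assume "k \<in> c ` P"
    let ?L = "\<Union>p\<in>{p\<in>P. c p = k}. L p"
    have "X closure_of {q \<in> topspace X. \<rho> k q \<noteq> 0} \<subseteq> ?L"
    proof (rule closure_of_minimal)
      show "closedin X ?L" using P cULb by (intro closedin_Union) auto
      show "{q \<in> topspace X. \<rho> k q \<noteq> 0} \<subseteq> ?L"
      proof
        fix q assume "q \<in> {q \<in> topspace X. \<rho> k q \<noteq> 0}"
        then have "(\<Sum>p\<in>{p\<in>P. c p = k}. b p q) \<noteq> 0" by (auto simp: \<rho>_def)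
        then obtain p where "p \<in> P" "c p = k" "b p q \<noteq> 0" by (metis (mono_tags, lifting) mem_Collect_eq sum.neutral)
        then show "q \<in> ?L" using P(2) cULb by blast
      qed
    qed
    also have "?L \<subseteq> fst k" using P(2) cULb by blast
    finally show "X closure_of {q \<in> topspace X. \<rho> k q \<noteq> 0} \<subseteq> fst k" .
    fix d assume d: "d \<in> A"
    have "chart_inv d z \<in> topspace X" if "z \<in> chart_image d" for z
      using chart_inv_in[OF that] chart_domain_subset[OF d] by blast
    then show "smooth_on (chart_image d) (\<lambda>z. \<rho> k (chart_inv d z))"
      unfolding \<rho>_def B_def
      by (intro smooth_on_divide smooth_on_sum open_chart_image d)
        (use P(2) cULb d Bpos[unfolded B_def] in \<open>auto simp: less_le\<close>)
  qed
  then show ?thesis by blast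
qed

text \<open>Only the densities enter, so \<open>\<eta>\<close> need be exact in top degree only. As all
  partitions of unity give \<open>0\<close> and there is one, \<open>0\<close> is the value that the
  definition describes.\<close>

lemma form_integral_exact:
  assumes X: "compact_space X" and \<gamma>: "\<gamma> \<in> forms A"
    and eq: "\<And>c z. c \<in> A \<Longrightarrow> z \<in> chart_image c \<Longrightarrow> top_density (\<eta> c z) = top_density (ext_d A \<gamma> c z)"
  shows "form_integral X A \<eta> = 0"
proof -
  have *: "(\<Sum>c\<in>F. LINT z:chart_image c|lborel. complex_of_real (\<rho> c (chart_inv c z)) * top_density (\<eta> c z)) = 0"
    if pou: "partition_of_unity X A F \<rho>" for F \<rho>
  proof -
    have "(LINT z:chart_image c|lborel. complex_of_real (\<rho> c (chart_inv c z)) * top_density (\<eta> c z))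
       = chart_integral c (wedge_form (fun_form (\<lambda>p. of_real (\<rho> c p))) (ext_d A \<gamma>))" if "c \<in> F" for c
    proof -
      have "c \<in> A" using pou that by (auto simp: partition_of_unity_def)
      then have "indicator (chart_image c) z *\<^sub>R (complex_of_real (\<rho> c (chart_inv c z)) * top_density (\<eta> c z))
        = top_density (wedge_form (fun_form (\<lambda>p. of_real (\<rho> c p))) (ext_d A \<gamma>) c z)" for z
        using eq[of c z] ext_d_zero[of c z \<gamma>]
        by (simp add: indicator_def top_density_eq wedge_fun_form[OF forms_ext_d[OF \<gamma>]])
      then show ?thesis by (simp add: set_lebesgue_integral_def chart_integral_def)
    qed
    then show ?thesis using partition_integral_exact[OF pou X \<gamma>] by simp
  qed
  show ?thesis
    unfolding form_integral_def
  proof (rule the_equality)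
    obtain F \<rho> where "partition_of_unity X A F \<rho>" using partition_of_unity_exists[OF X] by blast
    then show "\<exists>F \<rho>. partition_of_unity X A F \<rho> \<and> 0 = (\<Sum>c\<in>F. LINT z:chart_image c|lborel.
        complex_of_real (\<rho> c (chart_inv c z)) * top_density (\<eta> c z))"
      using *[of F \<rho>] by (intro exI[of _ F] exI[of _ \<rho>]) simp
  next
    fix I
    assume "\<exists>F \<rho>. partition_of_unity X A F \<rho> \<and> I = (\<Sum>c\<in>F. LINT z:chart_image c|lborel.
        complex_of_real (\<rho> c (chart_inv c z)) * top_density (\<eta> c z))"
    then obtain F \<rho> where "partition_of_unity X A F \<rho>" "I = (\<Sum>c\<in>F. LINT z:chart_image c|lborel.
        complex_of_real (\<rho> c (chart_inv c z)) * top_density (\<eta> c z))" by blast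
    with *[OF this(1)] show "I = 0" by simp
  qed
qed

end

section \<open>The curvature of a metric on the anticanonical bundle\<close>

lemma differentiable_prod:
  fixes f :: "_ \<Rightarrow> _ \<Rightarrow> complex"
  assumes "\<And>i. i \<in> I \<Longrightarrow> f i differentiable at z"
  shows "(\<lambda>w. \<Prod>i\<in>I. f i w) differentiable at z"
  using assms by (induction I rule: infinite_finite_induct) auto

lemma wirtinger_prod:
  assumes "finite I" "\<And>i. i \<in> I \<Longrightarrow> f i differentiable at z"
  shows "wirtinger a (\<lambda>w. \<Prod>i\<in>I. f i w) z = (\<Sum>i\<in>I. wirtinger a (f i) z * (\<Prod>j\<in>I - {i}. f j z))"
  using assms
proof (induction I rule: finite_induct)
  case (insert i I)
  have "(\<lambda>w. \<Prod>i\<in>I. f i w) differentiable at z"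
    using insert by (intro differentiable_prod) auto
  moreover have "(\<Prod>j\<in>insert i I - {k}. f j z) = f i z * (\<Prod>j\<in>I - {k}. f j z)" if "k \<in> I" for k
  proof -
    have "insert i I - {k} = insert i (I - {k})" using that insert by auto
    then show ?thesis using insert by simp
  qed
  ultimately show ?case
    using insert by (simp add: wirtinger_mult sum_distrib_left mult_ac cong: sum.cong)
qed simp

text \<open>The Leibniz formula differentiated factor by factor: the derivative of a determinant is the sum
  over the rows of the determinants with that row differentiated.\<close>

lemma wirtinger_det:
  fixes H :: "complex^'n::finite \<Rightarrow> complex^'b::finite^'b"
  assumes "\<And>i j. (\<lambda>w. H w $ i $ j) differentiable at z"
  shows "wirtinger a (\<lambda>w. det (H w)) z
    = (\<Sum>k\<in>UNIV. det (\<chi> i. if i = k then (\<chi> j. wirtinger a (\<lambda>w. H w $ k $ j) z) else H z $ i))"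
proof -
  have "wirtinger a (\<lambda>w. det (H w)) z
    = (\<Sum>p\<in>{p. p permutes UNIV}. of_int (sign p) *
        (\<Sum>k\<in>UNIV. wirtinger a (\<lambda>w. H w $ k $ p k) z * (\<Prod>i\<in>UNIV - {k}. H z $ i $ p i)))"
    unfolding det_def
    by (simp add: wirtinger_sum wirtinger_cmult wirtinger_prod assms differentiable_prod)
  also have "\<dots> = (\<Sum>k\<in>UNIV. \<Sum>p\<in>{p. p permutes UNIV}. of_int (sign p) *
        (wirtinger a (\<lambda>w. H w $ k $ p k) z * (\<Prod>i\<in>UNIV - {k}. H z $ i $ p i)))"
    by (subst sum.swap) (simp add: sum_distrib_left)
  finally have 1: "wirtinger a (\<lambda>w. det (H w)) z = (\<Sum>k\<in>UNIV. \<Sum>p\<in>{p. p permutes UNIV}. of_int (sign p) *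
        (wirtinger a (\<lambda>w. H w $ k $ p k) z * (\<Prod>i\<in>UNIV - {k}. H z $ i $ p i)))" .
  have "wirtinger a (\<lambda>w. H w $ k $ p k) z * (\<Prod>i\<in>UNIV - {k}. H z $ i $ p i)
      = (\<Prod>i\<in>UNIV. (\<chi> i. if i = k then (\<chi> j. wirtinger a (\<lambda>w. H w $ k $ j) z) else H z $ i) $ i $ p i)" for k p
    by (subst prod.remove[of UNIV k]) (auto intro!: prod.cong)
  then show ?thesis unfolding 1 unfolding det_def by simp
qed

lemma wirtinger_ln:
  assumes "f differentiable at z" "f z > 0"
  shows "wirtinger a (\<lambda>w. of_real (ln (f w))) z = wirtinger a (\<lambda>w. of_real (f w)) z / of_real (f z)"
proof -
  have f: "(f has_derivative frechet_derivative f (at z)) (at z)" using assms frechet_derivative_works by blast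
  have 1: "((\<lambda>w. complex_of_real (f w)) has_derivative (\<lambda>v. of_real (frechet_derivative f (at z) v))) (at z)"
    by (rule bounded_linear.has_derivative[OF bounded_linear_of_real f])
  have 2: "((\<lambda>w. complex_of_real (ln (f w))) has_derivative (\<lambda>v. of_real (frechet_derivative f (at z) v * inverse (f z)))) (at z)"
    by (rule bounded_linear.has_derivative[OF bounded_linear_of_real has_derivative_ln[OF assms(2) f]])
  have alg: "(p * k - \<i> * (q * k)) / 2 = (p - \<i> * q) / 2 * k" "(p * k + \<i> * (q * k)) / 2 = (p + \<i> * q) / 2 * k"
    for p q k :: complex by (simp_all add: algebra_simps)
  show ?thesis
    unfolding wirtinger_eq[OF 1] wirtinger_eq[OF 2] wirtinger_part_def of_real_mult of_real_inverse
    by (cases a) (simp_all only: sum.case alg divide_inverse[of _ "of_real (f z)"])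
qed

text \<open>The covectors \<open>\<partial>\<bar>u\<close> and \<open>\<partial>\<partial>\<bar>u\<close> of a function \<open>u\<close>.\<close>

definition dbar_covec :: "(complex^'n::finite \<Rightarrow> complex) \<Rightarrow> complex^'n \<Rightarrow> 'n covec" where
  "dbar_covec u z xs = (case xs of [Inr j] \<Rightarrow> wirtinger (Inr j) u z | _ \<Rightarrow> 0)"

definition ddbar_covec :: "(complex^'n::finite \<Rightarrow> complex) \<Rightarrow> complex^'n \<Rightarrow> 'n covec" where
  "ddbar_covec u z xs = (case xs of
      [Inl i, Inr j] \<Rightarrow> wirtinger (Inl i) (wirtinger (Inr j) u) z
    | [Inr j, Inl i] \<Rightarrow> - wirtinger (Inl i) (wirtinger (Inr j) u) z
    | _ \<Rightarrow> 0)"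

lemma dbar_covec_simps [simp]:
  "dbar_covec u z [] = 0" "dbar_covec u z [Inl i] = 0" "dbar_covec u z [Inr j] = wirtinger (Inr j) u z"
  "dbar_covec u z (a # b # xs) = 0"
  by (auto simp: dbar_covec_def split: sum.split)

lemma ddbar_covec_simps [simp]:
  "ddbar_covec u z [] = 0" "ddbar_covec u z [a] = 0"
  "ddbar_covec u z [Inl i, Inl k] = 0" "ddbar_covec u z [Inr i, Inr k] = 0"
  "ddbar_covec u z [Inl i, Inr j] = wirtinger (Inl i) (wirtinger (Inr j) u) z"
  "ddbar_covec u z [Inr j, Inl i] = - wirtinger (Inl i) (wirtinger (Inr j) u) z"
  "ddbar_covec u z (a # b # c # xs) = 0"
  by (auto simp: ddbar_covec_def split: sum.split)

lemma covec_eqI_two: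
  assumes "\<alpha> [] = \<beta> []" "\<And>a. \<alpha> [a] = \<beta> [a]" "\<And>a b. \<alpha> [a, b] = \<beta> [a, b]"
    "\<And>a b c xs. \<alpha> (a # b # c # xs) = \<beta> (a # b # c # xs)"
  shows "\<alpha> = \<beta>"
proof
  fix xs show "\<alpha> xs = \<beta> xs"
    by (cases xs rule: remdups_adj.cases; (cases "tl (tl xs)")?) (use assms in auto)
qed

lemma dbar_covec_eq:
  assumes "u differentiable at z"
  shows "local_ext (\<lambda>a. \<not> isl a) (\<lambda>v ys. u v * covec_one ys) z = dbar_covec u z"
proof (rule covec_eqI_two)
  have *: "wirtinger a (\<lambda>v. u v * covec_one ys) z = wirtinger a u z * covec_one ys" for a ys
    using wirtinger_mult[OF assms, of "\<lambda>_. covec_one ys" a] by simp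
  show "local_ext (\<lambda>a. \<not> isl a) (\<lambda>v ys. u v * covec_one ys) z [a] = dbar_covec u z [a]" for a
    by (cases a) (simp_all add: local_ext_Cons contract_apply *, simp_all add: covec_one_def)
  show "local_ext (\<lambda>a. \<not> isl a) (\<lambda>v ys. u v * covec_one ys) z [a, b] = dbar_covec u z [a, b]" for a b
    by (simp add: local_ext_Cons contract_apply *) (simp add: covec_one_def)
  show "local_ext (\<lambda>a. \<not> isl a) (\<lambda>v ys. u v * covec_one ys) z (a # b # c # xs)
      = dbar_covec u z (a # b # c # xs)" for a b c xs
  proof -
    have "contract c (contract b (contract a (\<lambda>ys. u v * covec_one ys))) = (\<lambda>_. 0)" for v
      by (simp add: contract_def covec_one_def)
    then show ?thesis by (simp add: local_ext_Cons contract_apply *) (simp add: covec_one_def local_ext_def)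
  qed
qed simp

lemma local_ext_dbar_covec: "local_ext isl (dbar_covec u) z = ddbar_covec u z"
proof (rule covec_eqI_two)
  show "local_ext isl (dbar_covec u) z [a] = ddbar_covec u z [a]" for a
    by (simp add: local_ext_Cons contract_apply)
  show "local_ext isl (dbar_covec u) z [a, b] = ddbar_covec u z [a, b]" for a b
    by (cases a; cases b) (simp_all add: local_ext_Cons contract_apply)
  show "local_ext isl (dbar_covec u) z (a # b # c # xs) = ddbar_covec u z (a # b # c # xs)" for a b c xs
  proof -
    have "contract c (contract b (contract a (dbar_covec u v))) = (\<lambda>_. 0)" for v
      by (simp add: contract_def)
    then show ?thesis by (simp add: local_ext_Cons contract_apply) (simp add: local_ext_def)
  qed
qed simp

text \<open>The \<open>(0,2)\<close>-part of \<open>d\<partial>\<bar>u\<close> vanishes by the symmetry of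
  second derivatives.\<close>

lemma local_d_dbar_covec:
  assumes "open S" "smooth_on S u" "z \<in> S"
  shows "local_d (dbar_covec u) z = ddbar_covec u z"
proof (rule covec_eqI_two)
  show "local_d (dbar_covec u) z [a] = ddbar_covec u z [a]" for a
    by (simp add: local_ext_Cons contract_apply)
  show "local_d (dbar_covec u) z [a, b] = ddbar_covec u z [a, b]" for a b
    using wirtinger_commute[OF assms, of a b]
    by (cases a; cases b) (simp_all add: local_ext_Cons contract_apply)
  show "local_d (dbar_covec u) z (a # b # c # xs) = ddbar_covec u z (a # b # c # xs)" for a b c xs
  proof -
    have "contract c (contract b (contract a (dbar_covec u v))) = (\<lambda>_. 0)" for v
      by (simp add: contract_def)
    then show ?thesis by (simp add: local_ext_Cons contract_apply) (simp add: local_ext_def)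
  qed
qed simp

lemma smooth_covec_dbar:
  assumes "open S" "smooth_on S u" shows "smooth_covec S (dbar_covec u)"
  unfolding smooth_covec_def
proof
  fix xs
  have "smooth_on S (\<lambda>z. 0 :: complex)" by (rule smooth_on_const[OF assms(1)])
  moreover have "smooth_on S (\<lambda>z. wirtinger a u z)" for a by (rule smooth_on_wirtinger[OF assms])
  ultimately show "smooth_on S (\<lambda>z. dbar_covec u z xs)"
    by (cases xs; cases "tl xs"; cases "hd xs") auto
qed

lemma smooth_covec_ddbar:
  assumes "open S" "smooth_on S u" shows "smooth_covec S (ddbar_covec u)"
proof -
  have "local_ext isl (dbar_covec u) = ddbar_covec u" by (rule ext) (rule local_ext_dbar_covec)
  then show ?thesis using smooth_covec_local_ext[OF assms(1) smooth_covec_dbar[OF assms]] by metis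
qed

lemma ddbar_degree: "length xs \<noteq> 2 \<Longrightarrow> ddbar_covec u z xs = 0"
  by (auto simp: ddbar_covec_def split: list.split sum.split)

lemma alternating_ddbar: "alternating (ddbar_covec u z)"
proof (rule alternatingI)
  fix xs ys and a b :: "'a + 'a"
  show "ddbar_covec u z (xs @ [a, b] @ ys) = - ddbar_covec u z (xs @ [b, a] @ ys)"
    by (cases "xs = [] \<and> ys = []"; cases a; cases b) (auto simp: ddbar_degree)
qed

lemma pullback_pair:
  "pullback_at \<tau> z \<alpha> [a, b] = (\<Sum>k\<in>UNIV. \<Sum>l\<in>UNIV. jacobian \<tau> z k a * jacobian \<tau> z l b * \<alpha> [k, l])"
  by (simp add: pullback_Cons contract_apply sum_distrib_left mult_ac)

lemma pullback_zero_degree: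
  assumes "\<And>as. length as = length bs \<Longrightarrow> \<alpha> as = 0"
  shows "pullback_at \<tau> z \<alpha> bs = 0"
  unfolding pullback_at_def using assms by simp

lemma ddbar_add_pluriharmonic:
  assumes "open S" "z \<in> S" "smooth_on S f" "smooth_on S g"
    and "\<And>w. w \<in> S \<Longrightarrow> u w = f w + g w" and "\<And>i j. wirtinger (Inl i) (wirtinger (Inr j) g) z = 0"
  shows "ddbar_covec u z = ddbar_covec f z"
proof -
  have "wirtinger (Inl i) (wirtinger (Inr j) u) z = wirtinger (Inl i) (wirtinger (Inr j) f) z" for i j
  proof -
    have fg: "smooth_on S (\<lambda>w. f w + g w)" by (rule smooth_on_add[OF assms(1,3,4)])
    have u: "wirtinger (Inr j) u w = wirtinger (Inr j) f w + wirtinger (Inr j) g w" if "w \<in> S" for w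
    proof -
      have "wirtinger (Inr j) (\<lambda>w. f w + g w) w = wirtinger (Inr j) u w"
        by (rule wirtinger_cong[OF assms(1) that smooth_on_differentiable[OF fg that]]) (simp add: assms(5))
      then show ?thesis using wirtinger_add[OF smooth_on_differentiable[OF assms(3) that] smooth_on_differentiable[OF assms(4) that]]
        by simp
    qed
    have sm: "smooth_on S (wirtinger (Inr j) f)" "smooth_on S (wirtinger (Inr j) g)"
      using smooth_on_wirtinger[OF assms(1)] assms(3,4) by auto
    have "wirtinger (Inl i) (\<lambda>w. wirtinger (Inr j) f w + wirtinger (Inr j) g w) z = wirtinger (Inl i) (wirtinger (Inr j) u) z"
      by (rule wirtinger_cong[OF assms(1,2) smooth_on_differentiable[OF smooth_on_add[OF assms(1) sm] assms(2)]])
        (simp add: u)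
    then show ?thesis
      using wirtinger_add[OF smooth_on_differentiable[OF sm(1) assms(2)] smooth_on_differentiable[OF sm(2) assms(2)]]
        assms(6) by simp
  qed
  then show ?thesis by (simp add: fun_eq_iff ddbar_covec_def cong: sum.case_cong list.case_cong)
qed

text \<open>The logarithm of \<open>|g|\<^sup>2\<close> is pluriharmonic, because its \<open>\<partial>\<bar>\<close>-derivative, the logarithmic derivative of the
  conjugate of \<open>g\<close>, is antiholomorphic.\<close>

lemma log_norm_pluriharmonic:
  assumes S: "open S" "z \<in> S" and g: "smooth_on S g" "\<And>w. w \<in> S \<Longrightarrow> g w \<noteq> 0"
    and hol: "\<And>w j. w \<in> S \<Longrightarrow> wirtinger (Inr j) g w = 0"
  shows "wirtinger (Inl i) (wirtinger (Inr j) (\<lambda>w. of_real (ln ((cmod (g w))\<^sup>2)))) z = 0"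
proof -
  let ?v = "\<lambda>w. complex_of_real (ln ((cmod (g w))\<^sup>2))" and ?c = "\<lambda>w. cnj (g w)"
  have d: "g differentiable at w" "?c differentiable at w" if "w \<in> S" for w
    using smooth_on_differentiable[OF _ that] g(1) smooth_on_cnj[OF S(1) g(1)] by auto
  have nsq: "(cmod (g w))\<^sup>2 = g w \<bullet> g w" for w by (simp add: power2_norm_eq_inner)
  have smsq: "smooth_on S (\<lambda>w. (cmod (g w))\<^sup>2)" unfolding nsq by (intro smooth_on_inner S(1) g(1))
  have smv: "smooth_on S ?v"
    by (intro smooth_on_of_real smooth_on_ln S(1) smsq) (simp add: g(2))
  have smc: "smooth_on S ?c" by (rule smooth_on_cnj[OF S(1) g(1)])
  have eq: "wirtinger (Inr j) ?v w * ?c w = wirtinger (Inr j) ?c w" if w: "w \<in> S" for w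
  proof -
    have "wirtinger (Inr j) ?v w = wirtinger (Inr j) (\<lambda>w. of_real ((cmod (g w))\<^sup>2)) w / of_real ((cmod (g w))\<^sup>2)"
      by (rule wirtinger_ln[OF smooth_on_differentiable[OF smsq w]]) (simp add: g(2)[OF w])
    also have "(\<lambda>w. complex_of_real ((cmod (g w))\<^sup>2)) = (\<lambda>w. g w * ?c w)"
      by (rule ext) (rule complex_norm_square)
    also have "wirtinger (Inr j) (\<lambda>w. g w * ?c w) w = g w * wirtinger (Inr j) ?c w"
      using wirtinger_mult[OF d[OF w]] hol[OF w] by simp
    finally show ?thesis using g(2)[OF w] by simp
  qed
  have hol': "wirtinger (Inl i) ?c w = 0" if "w \<in> S" for w i
    using wirtinger_cnj[OF d(1)[OF that], of "Inl i"] hol[OF that] by (simp add: conj_index_def)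
  let ?P = "wirtinger (Inr j) ?v"
  have smP: "smooth_on S ?P" by (rule smooth_on_wirtinger[OF S(1) smv])
  have "wirtinger (Inl i) (\<lambda>w. ?P w * ?c w) z = wirtinger (Inl i) (wirtinger (Inr j) ?c) z"
    by (rule wirtinger_cong[OF S smooth_on_differentiable[OF smooth_on_mult[OF S(1) smP smc] S(2)]]) (rule eq)
  also have "\<dots> = wirtinger (Inr j) (wirtinger (Inl i) ?c) z" by (rule wirtinger_commute[OF S(1) smc S(2)])
  also have "\<dots> = wirtinger (Inr j) (\<lambda>_. 0) z"
    by (rule wirtinger_cong[OF S smooth_on_differentiable[OF smooth_on_wirtinger[OF S(1) smc] S(2)]]) (rule hol')
  also have "wirtinger (Inl i) (\<lambda>w. ?P w * ?c w) z = wirtinger (Inl i) ?P z * ?c z"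
    using wirtinger_mult[OF smooth_on_differentiable[OF smP S(2)] d(2)[OF S(2)]] hol'[OF S(2)] by simp
  finally show ?thesis using g(2)[OF S(2)] by simp
qed

context complex_mfd
begin

text \<open>The mixed second derivatives of a holomorphic map vanish, so they do not contribute to the chain rule
  for \<open>\<partial>\<partial>\<bar>\<close>.\<close>

lemma ddbar_pullback:
  assumes cd: "c \<in> A" "d \<in> A" "z \<in> overlap c d" and u: "smooth_on (chart_image d) u"
  shows "ddbar_covec (\<lambda>w. u (transition c d w)) z = pullback_at (transition c d) z (ddbar_covec u (transition c d z))"
proof -
  let ?\<tau> = "transition c d" and ?J = "jacobian (transition c d) z"
  note o = open_overlap[OF cd(1,2)] and sm\<tau> = smooth_transition[OF cd(1,2)] and img = transition_image[OF cd(1,2)]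
  note od = open_chart_image[OF cd(2)]
  have J0: "jacobian ?\<tau> w (Inl k) (Inr j) = 0" "jacobian ?\<tau> w (Inr k) (Inl j) = 0" if "w \<in> overlap c d" for w k j
    using jacobian_transition[OF cd(1,2) that] by auto
  have "wirtinger (Inl i) (wirtinger (Inr j) (\<lambda>w. u (?\<tau> w))) z
      = (\<Sum>k\<in>UNIV. \<Sum>l\<in>UNIV. ?J (Inl k) (Inl i) * ?J (Inr l) (Inr j) * wirtinger (Inl k) (wirtinger (Inr l) u) (?\<tau> z))" for i j
  proof -
    have "wirtinger (Inr j) (\<lambda>w. u (?\<tau> w)) w
        = (\<Sum>l\<in>UNIV. wirtinger (Inr l) u (?\<tau> w) * jacobian ?\<tau> w (Inr l) (Inr j))" if w: "w \<in> overlap c d" for w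
      using wirtinger_chain[OF smooth_on_differentiable[OF sm\<tau> w] smooth_on_differentiable[OF u], of "Inr j"] img w
        J0[OF w] by (auto simp: sum_index)
    moreover have sm: "smooth_on (overlap c d) (\<lambda>w. u (?\<tau> w))" by (rule smooth_on_compose[OF o od img u sm\<tau>])
    moreover have smu: "smooth_on (overlap c d) (\<lambda>w. wirtinger (Inr l) u (?\<tau> w))" for l
      by (rule smooth_on_compose[OF o od img smooth_on_wirtinger[OF od u] sm\<tau>])
    moreover have smJ: "smooth_on (overlap c d) (\<lambda>w. jacobian ?\<tau> w a b)" for a b
      by (rule smooth_jacobian[OF o od img sm\<tau>])
    ultimately have "wirtinger (Inl i) (wirtinger (Inr j) (\<lambda>w. u (?\<tau> w))) z
        = wirtinger (Inl i) (\<lambda>w. \<Sum>l\<in>UNIV. wirtinger (Inr l) u (?\<tau> w) * jacobian ?\<tau> w (Inr l) (Inr j)) z"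
      by (intro wirtinger_cong[OF o cd(3) smooth_on_differentiable[OF smooth_on_wirtinger[OF o sm] cd(3)]]) simp
    also have "\<dots> = (\<Sum>l\<in>UNIV. wirtinger (Inl i) (\<lambda>w. wirtinger (Inr l) u (?\<tau> w)) z * ?J (Inr l) (Inr j)
        + wirtinger (Inr l) u (?\<tau> z) * wirtinger (Inl i) (\<lambda>w. jacobian ?\<tau> w (Inr l) (Inr j)) z)"
      using smooth_on_differentiable[OF smu cd(3)] smooth_on_differentiable[OF smJ cd(3)]
      by (simp add: wirtinger_sum wirtinger_mult)
    also have "\<dots> = (\<Sum>l\<in>UNIV. \<Sum>k\<in>UNIV. ?J (Inl k) (Inl i) * ?J (Inr l) (Inr j) * wirtinger (Inl k) (wirtinger (Inr l) u) (?\<tau> z))"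
    proof (rule sum.cong[OF refl])
      fix l
      have "wirtinger (Inl i) (\<lambda>w. jacobian ?\<tau> w (Inr l) (Inr j)) z = wirtinger (Inr j) (\<lambda>w. jacobian ?\<tau> w (Inr l) (Inl i)) z"
        by (rule jacobian_symmetric[OF o od img sm\<tau> cd(3)])
      also have "\<dots> = wirtinger (Inr j) (\<lambda>_. 0) z"
        by (rule wirtinger_cong[OF o cd(3) smooth_on_differentiable[OF smJ cd(3)]]) (rule J0(2))
      finally have "wirtinger (Inl i) (\<lambda>w. jacobian ?\<tau> w (Inr l) (Inr j)) z = 0" by simp
      moreover have "wirtinger (Inl i) (\<lambda>w. wirtinger (Inr l) u (?\<tau> w)) z
          = (\<Sum>k\<in>UNIV. wirtinger (Inl k) (wirtinger (Inr l) u) (?\<tau> z) * ?J (Inl k) (Inl i))"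
        using wirtinger_chain[OF smooth_on_differentiable[OF sm\<tau> cd(3)]
            smooth_on_differentiable[OF smooth_on_wirtinger[OF od u]], where b = "Inl i"] img cd(3) J0[OF cd(3)]
        by (auto simp: sum_index)
      ultimately show "wirtinger (Inl i) (\<lambda>w. wirtinger (Inr l) u (?\<tau> w)) z * ?J (Inr l) (Inr j)
        + wirtinger (Inr l) u (?\<tau> z) * wirtinger (Inl i) (\<lambda>w. jacobian ?\<tau> w (Inr l) (Inr j)) z
        = (\<Sum>k\<in>UNIV. ?J (Inl k) (Inl i) * ?J (Inr l) (Inr j) * wirtinger (Inl k) (wirtinger (Inr l) u) (?\<tau> z))"
        by (simp add: sum_distrib_left sum_distrib_right mult_ac)
    qed
    finally show ?thesis by (subst sum.swap)
  qed
  note hess = this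
  show ?thesis
  proof (rule covec_eqI_two)
    show "ddbar_covec (\<lambda>w. u (?\<tau> w)) z [a, b] = pullback_at ?\<tau> z (ddbar_covec u (?\<tau> z)) [a, b]" for a b
    proof (cases a; cases b)
      fix j i assume "a = Inr j" "b = Inl i"
      moreover have "(\<Sum>l\<in>UNIV. \<Sum>k\<in>UNIV. ?J (Inr l) (Inr j) * ?J (Inl k) (Inl i) * f k l)
          = (\<Sum>k\<in>UNIV. \<Sum>l\<in>UNIV. ?J (Inl k) (Inl i) * ?J (Inr l) (Inr j) * f k l)" for f
        by (subst sum.swap) (simp add: mult_ac)
      ultimately show ?thesis by (simp add: pullback_pair sum_index hess J0[OF cd(3)] sum_negf)
    qed (simp_all add: pullback_pair sum_index hess J0[OF cd(3)])
  next
    have "pullback_at ?\<tau> z (ddbar_covec u (?\<tau> z)) bs = 0" if "length bs \<noteq> 2" for bs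
      by (rule pullback_zero_degree) (use that in \<open>simp add: ddbar_degree\<close>)
    then show "ddbar_covec (\<lambda>w. u (?\<tau> w)) z [] = pullback_at ?\<tau> z (ddbar_covec u (?\<tau> z)) []"
      "\<And>a. ddbar_covec (\<lambda>w. u (?\<tau> w)) z [a] = pullback_at ?\<tau> z (ddbar_covec u (?\<tau> z)) [a]"
      "\<And>a b e xs. ddbar_covec (\<lambda>w. u (?\<tau> w)) z (a # b # e # xs)
        = pullback_at ?\<tau> z (ddbar_covec u (?\<tau> z)) (a # b # e # xs)"
      by simp_all
  qed
qed

lemma metric_smooth_pos:
  assumes "anticanonical_metric A h" "c \<in> A"
  shows "smooth_on (chart_image c) (h c)" "\<And>z. z \<in> chart_image c \<Longrightarrow> 0 < h c z"
    "smooth_on (chart_image c) (\<lambda>z. complex_of_real (ln (h c z)))"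
proof -
  show *: "smooth_on (chart_image c) (h c)" "\<And>z. z \<in> chart_image c \<Longrightarrow> 0 < h c z"
    using assms by (auto simp: anticanonical_metric_def)
  show "smooth_on (chart_image c) (\<lambda>z. complex_of_real (ln (h c z)))"
    by (intro smooth_on_of_real smooth_on_ln open_chart_image assms(2) *)
qed

abbreviation "log_metric h c \<equiv> (\<lambda>z. complex_of_real (ln (h c z)))"

lemma curvature_eq:
  assumes h: "anticanonical_metric A h" and c: "c \<in> A" "z \<in> chart_image c"
  shows "anticanonical_curvature A h c z = (\<lambda>xs. - \<i> * ddbar_covec (log_metric h c) z xs)"
proof -
  note sm = metric_smooth_pos(3)[OF h c(1)]
  let ?U = "\<lambda>c z xs. complex_of_real (ln (h c z)) * covec_one xs"
  have bar: "delbar A ?U c w = dbar_covec (log_metric h c) w" if "w \<in> chart_image c" for w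
    using dbar_covec_eq[OF smooth_on_differentiable[OF sm that]] c(1) that
    by (simp add: delbar_def partial_ext_eq)
  have "del A (delbar A ?U) c z = local_ext isl (delbar A ?U c) z"
    using c by (simp add: del_def partial_ext_eq)
  also have "\<dots> = local_ext isl (dbar_covec (log_metric h c)) z"
  proof (rule local_ext_cong[symmetric, OF open_chart_image[OF c(1)] c(2)])
    show "covec_differentiable (dbar_covec (log_metric h c)) z"
      by (rule smooth_covec_differentiable[OF smooth_covec_dbar[OF open_chart_image[OF c(1)] sm] c(2)])
  qed (simp add: bar)
  finally show ?thesis by (simp add: anticanonical_curvature_def local_ext_dbar_covec)
qed

lemma curvature_zero: "\<not> (c \<in> A \<and> z \<in> chart_image c) \<Longrightarrow> anticanonical_curvature A h c z = 0"
  by (rule ext) (auto simp: anticanonical_curvature_def del_def partial_ext_def)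

lemma smooth_jacobian_det:
  assumes "c \<in> A" "d \<in> A"
  shows "smooth_on (overlap c d) (\<lambda>z. det (\<chi> k i. jacobian (transition c d) z (Inl k) (Inl i)))"
  by (intro smooth_on_det open_overlap assms)
    (simp add: smooth_jacobian[OF open_overlap[OF assms] open_chart_image[OF assms(2)]
        transition_image[OF assms] smooth_transition[OF assms]])

text \<open>The entries of the Jacobian are holomorphic, and the derivative of the determinant is a sum of
  determinants with a zero row.\<close>

lemma holomorphic_jacobian_det:
  assumes cd: "c \<in> A" "d \<in> A" "z \<in> overlap c d"
  shows "wirtinger (Inr j) (\<lambda>z. det (\<chi> k i. jacobian (transition c d) z (Inl k) (Inl i))) z = 0"
proof -
  let ?J = "jacobian (transition c d)"
  note o = open_overlap[OF cd(1,2)] and od = open_chart_image[OF cd(2)] and img = transition_image[OF cd(1,2)]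
    and sm = smooth_transition[OF cd(1,2)]
  have J0: "wirtinger (Inr j) (\<lambda>w. ?J w (Inl k) (Inl i)) z = 0" for k i
  proof -
    have "wirtinger (Inr j) (\<lambda>w. ?J w (Inl k) (Inl i)) z = wirtinger (Inl i) (\<lambda>w. ?J w (Inl k) (Inr j)) z"
      by (rule jacobian_symmetric[OF o od img sm cd(3)])
    also have "\<dots> = wirtinger (Inl i) (\<lambda>_. 0) z"
      by (rule wirtinger_cong[OF o cd(3) smooth_on_differentiable[OF smooth_jacobian[OF o od img sm] cd(3)]])
        (rule jacobian_transition(1)[OF cd(1,2)])
    finally show ?thesis by simp
  qed
  have "det (\<chi> l. if l = k then (\<chi> i. 0) else (\<chi> i. ?J z (Inl l) (Inl i))) = 0" for k
    by (rule det_zero_row(1)[of k]) (simp add: row_def vec_eq_iff zero_vec_def)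
  then show ?thesis
    using smooth_on_differentiable[OF smooth_jacobian[OF o od img sm] cd(3)]
    by (subst wirtinger_det) (simp_all add: J0 cong: if_cong)
qed

text \<open>Positivity of the metric on both sides of the transformation rule forces the Jacobian determinant
  to be nonzero.\<close>

lemma metric_jacobian_nonzero:
  assumes h: "anticanonical_metric A h" and cd: "c \<in> A" "d \<in> A" "z \<in> overlap c d"
  shows "det (\<chi> k i. jacobian (transition c d) z (Inl k) (Inl i)) \<noteq> 0"
proof
  assume "det (\<chi> k i. jacobian (transition c d) z (Inl k) (Inl i)) = 0"
  then have "h c z = 0" using h cd by (simp add: anticanonical_metric_def)
  moreover have "h c z > 0" using metric_smooth_pos(2)[OF h cd(1)] overlap_subset cd(3) by blast
  ultimately show False by simp
qed

text \<open>The transformation rule of the metric changes \<open>log h\<close> by \<open>log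
  |g|\<^sup>2\<close>, where \<open>g\<close> is the Jacobian determinant, and this function is
  pluriharmonic.\<close>

lemma curvature_form:
  assumes h: "anticanonical_metric A h"
  shows "anticanonical_curvature A h \<in> forms A"
proof (rule formsI)
  show "alternating (anticanonical_curvature A h c z)" if "c \<in> A" "z \<in> chart_image c" for c z
    unfolding curvature_eq[OF h that] by (rule alternating_cmult[OF alternating_ddbar])
  show "smooth_covec (chart_image c) (anticanonical_curvature A h c)" if c: "c \<in> A" for c
    unfolding smooth_covec_def
  proof
    fix xs
    have "smooth_on (chart_image c) (\<lambda>z. - \<i> * ddbar_covec (log_metric h c) z xs)"
      using smooth_covec_ddbar[OF open_chart_image[OF c] metric_smooth_pos(3)[OF h c]]
      by (intro smooth_on_mult smooth_on_const open_chart_image c) (simp add: smooth_covec_def)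
    then show "smooth_on (chart_image c) (\<lambda>z. anticanonical_curvature A h c z xs)"
      by (rule smooth_on_cong[OF open_chart_image[OF c], rotated]) (simp add: curvature_eq[OF h c])
  qed
  fix c d z bs assume cd: "c \<in> A" "d \<in> A" "z \<in> overlap c d"
  let ?\<tau> = "transition c d" and ?g = "\<lambda>z. det (\<chi> k i. jacobian (transition c d) z (Inl k) (Inl i))"
  note o = open_overlap[OF cd(1,2)] and od = open_chart_image[OF cd(2)] and img = transition_image[OF cd(1,2)]
    and smd = metric_smooth_pos[OF h cd(2)]
  note smg = smooth_jacobian_det[OF cd(1,2)] and gnz = metric_jacobian_nonzero[OF h cd(1,2)]
  have smn: "smooth_on (overlap c d) (\<lambda>w. complex_of_real (ln ((cmod (?g w))\<^sup>2)))"
  proof (intro smooth_on_of_real smooth_on_ln o)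
    show "smooth_on (overlap c d) (\<lambda>w. (cmod (?g w))\<^sup>2)"
      unfolding power2_norm_eq_inner by (intro smooth_on_inner o smg)
  qed (simp add: gnz)
  have "ddbar_covec (log_metric h c) z = ddbar_covec (\<lambda>w. log_metric h d (?\<tau> w)) z"
  proof (rule ddbar_add_pluriharmonic[OF o cd(3) _ smn])
    show "smooth_on (overlap c d) (\<lambda>w. log_metric h d (?\<tau> w))"
      by (rule smooth_on_compose[OF o od img smd(3) smooth_transition[OF cd(1,2)]])
    show "wirtinger (Inl i) (wirtinger (Inr j) (\<lambda>w. complex_of_real (ln ((cmod (?g w))\<^sup>2)))) z = 0" for i j
      by (rule log_norm_pluriharmonic[OF o cd(3) smg gnz holomorphic_jacobian_det[OF cd(1,2)]])
    fix w assume w: "w \<in> overlap c d"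
    have "h c w = (cmod (?g w))\<^sup>2 * h d (?\<tau> w)" using h cd w by (simp add: anticanonical_metric_def)
    moreover have "h d (?\<tau> w) > 0" using smd(2) img w by blast
    ultimately show "log_metric h c w = log_metric h d (?\<tau> w) + complex_of_real (ln ((cmod (?g w))\<^sup>2))"
      using gnz[OF w] by (simp add: ln_mult add.commute flip: of_real_add)
  qed
  also have "\<dots> = pullback_at ?\<tau> z (ddbar_covec (log_metric h d) (?\<tau> z))"
    by (rule ddbar_pullback[OF cd smd(3)])
  finally show "anticanonical_curvature A h c z bs = pullback_at ?\<tau> z (anticanonical_curvature A h d (?\<tau> z)) bs"
    using curvature_eq[OF h cd(1) subsetD[OF overlap_subset cd(3)]] curvature_eq[OF h cd(2) transition_in(2)[OF cd]]
    by (simp add: pullback_cmult[of _ _ "- \<i>", simplified])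
qed (rule curvature_zero)

lemma curvature_type:
  assumes h: "anticanonical_metric A h" and nz: "anticanonical_curvature A h c z xs \<noteq> 0"
  shows "length (filter isl xs) = 1" "length (filter (\<lambda>a. \<not> isl a) xs) = 1"
proof -
  have "c \<in> A \<and> z \<in> chart_image c" using nz curvature_zero[of c z h] by (metis zero_fun_apply)
  then have "ddbar_covec (log_metric h c) z xs \<noteq> 0" using nz curvature_eq[OF h, of c z] by auto
  then obtain i j where "xs = [Inl i, Inr j] \<or> xs = [Inr j, Inl i]"
    by (auto simp: ddbar_covec_def split: list.splits sum.splits)
  then show "length (filter isl xs) = 1" "length (filter (\<lambda>a. \<not> isl a) xs) = 1" by auto
qed

lemma curvature_pq_form: "anticanonical_metric A h \<Longrightarrow> anticanonical_curvature A h \<in> pq_forms A 1 1"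
  unfolding pq_forms_def using curvature_form curvature_type by blast

lemma length_filter_isl: "length xs = length (filter isl xs) + length (filter (\<lambda>a. \<not> isl a) xs)"
  by (rule sum_length_filter_compl[symmetric])

lemma curvature_degree:
  assumes "anticanonical_metric A h" "anticanonical_curvature A h c z xs \<noteq> 0"
  shows "length xs = 2"
  using curvature_type[OF assms] length_filter_isl[of xs] by simp

lemma curvature_two_form: "anticanonical_metric A h \<Longrightarrow> anticanonical_curvature A h \<in> k_forms A 2"
  unfolding k_forms_def mem_Collect_eq
  by (intro conjI allI impI) (erule curvature_form, erule curvature_degree, assumption)

text \<open>In each chart the curvature is the exterior derivative of \<open>-\<i> \<partial>\<bar> log
  h\<close>.\<close>

lemma curvature_closed:
  assumes h: "anticanonical_metric A h" shows "ext_d A (anticanonical_curvature A h) = 0"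
proof (intro ext)
  fix c z xs show "ext_d A (anticanonical_curvature A h) c z xs = 0 c z xs"
  proof (cases "c \<in> A \<and> z \<in> chart_image c")
    case True
    then have c: "c \<in> A" "z \<in> chart_image c" by auto
    note o = open_chart_image[OF c(1)] and sm = metric_smooth_pos(3)[OF h c(1)]
    let ?u = "log_metric h c"
    have smb: "smooth_covec (chart_image c) (dbar_covec ?u)" by (rule smooth_covec_dbar[OF o sm])
    have "local_d (anticanonical_curvature A h c) z xs = local_d (\<lambda>w xs. - \<i> * local_d (dbar_covec ?u) w xs) z xs"
      by (rule fun_cong[OF local_ext_cong[OF o c(2) form_differentiable[OF curvature_form[OF h] c]]])
        (simp add: curvature_eq[OF h c(1)] local_d_dbar_covec[OF o sm])
    also have "\<dots> = - \<i> * local_d (local_d (dbar_covec ?u)) z xs"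
      by (rule local_ext_cmult[OF smooth_covec_differentiable[OF smooth_covec_local_ext[OF o smb] c(2)]])
    finally show ?thesis using local_d_local_d[OF o c(2) smb] c by (simp add: ext_d_eq)
  qed (simp add: ext_d_zero)
qed

lemma ddbar_real:
  assumes S: "open S" "z \<in> S" "smooth_on S u" and real: "\<And>w. cnj (u w) = u w"
  shows "cnj (wirtinger (Inl i) (wirtinger (Inr j) u) z) = wirtinger (Inl j) (wirtinger (Inr i) u) z"
proof -
  have c: "wirtinger a u w = cnj (wirtinger (conj_index a) u w)" if "w \<in> S" for a w
    using wirtinger_cnj[OF smooth_on_differentiable[OF S(3) that], of a] real by simp
  have sm: "smooth_on S (wirtinger a u)" for a by (rule smooth_on_wirtinger[OF S(1,3)])
  have "wirtinger (Inr i) (wirtinger (Inl j) u) z = wirtinger (Inr i) (\<lambda>w. cnj (wirtinger (Inr j) u w)) z"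
    by (rule wirtinger_cong[OF S(1,2) smooth_on_differentiable[OF sm S(2)]]) (use c[of _ "Inl j"] in \<open>simp add: conj_index_def\<close>)
  also have "\<dots> = cnj (wirtinger (Inl i) (wirtinger (Inr j) u) z)"
    using wirtinger_cnj[OF smooth_on_differentiable[OF sm S(2)], of "Inr i"] by (simp add: conj_index_def)
  finally show ?thesis using wirtinger_commute[OF S(1,3,2)] by metis
qed

lemma curvature_real:
  assumes h: "anticanonical_metric A h" shows "anticanonical_curvature A h \<in> real_forms A"
proof -
  have "anticanonical_curvature A h c z (map conj_index xs) = cnj (anticanonical_curvature A h c z xs)" for c z xs
  proof (cases "c \<in> A \<and> z \<in> chart_image c")
    case True
    then have c: "c \<in> A" "z \<in> chart_image c" by auto
    have r: "cnj (wirtinger (Inl i) (wirtinger (Inr j) (log_metric h c)) z)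
        = wirtinger (Inl j) (wirtinger (Inr i) (log_metric h c)) z" for i j
      by (rule ddbar_real[OF open_chart_image[OF c(1)] c(2) metric_smooth_pos(3)[OF h c(1)]]) simp
    show ?thesis
    proof (cases "length xs = 2")
      case True
      then obtain a b where "xs = [a, b]" by (auto simp: numeral_2_eq_2 length_Suc_conv)
      then show ?thesis
        by (cases a; cases b) (simp_all add: curvature_eq[OF h c] conj_index_def r)
    next
      case False
      then show ?thesis by (simp add: curvature_eq[OF h c] ddbar_degree)
    qed
  qed (simp add: curvature_zero)
  then show ?thesis using curvature_form[OF h] by (simp add: real_forms_def)
qed

lemma curvature_de_rham_cocycle:
  "anticanonical_metric A h \<Longrightarrow> anticanonical_curvature A h \<in> de_rham_cocycles A 2"
  by (simp add: de_rham_cocycles_def curvature_real curvature_two_form curvature_closed)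

end

section \<open>Vanishing of the top Chern number\<close>

lemma length_filter_eq_size: "length (filter P xs) = size (filter_mset P (mset xs))"
  by (metis mset_filter size_mset)

lemma length_filter_top_index:
  "length (filter isl (top_index :: ('n + 'n::finite) list)) = CARD('n)"
  "length (filter (\<lambda>a. \<not> isl a) (top_index :: ('n + 'n) list)) = CARD('n)"
proof -
  have *: "length (filter P (top_index :: ('n + 'n) list)) = card {a. P a}" for P
    using distinct_card[of "filter P (top_index :: ('n + 'n) list)"] top_index[where ?'n = 'n] by simp
  have "{a :: 'n + 'n. isl a} = range Inl" "{a :: 'n + 'n. \<not> isl a} = range Inr"
    by (auto simp: isl_def image_iff) (metis sum.exhaust)
  then show "length (filter isl (top_index :: ('n + 'n) list)) = CARD('n)"
    "length (filter (\<lambda>a. \<not> isl a) (top_index :: ('n + 'n) list)) = CARD('n)"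
    unfolding * by (simp_all add: card_image)
qed

context complex_mfd
begin

lemma wedge_power_type:
  assumes "\<Theta> \<in> pq_forms A 1 1" "wedge_power \<Theta> k c z xs \<noteq> 0"
  shows "length (filter isl xs) = k \<and> length (filter (\<lambda>a. \<not> isl a) xs) = k"
  using assms(2)
proof (induction k arbitrary: xs)
  case 0
  then have "xs = []" by (auto simp: wedge_power_def fun_form_def covec_one_def split: if_splits)
  then show ?case by simp
next
  case (Suc k)
  have "\<exists>ys zs. mset ys + mset zs = mset xs \<and> \<Theta> c z ys \<noteq> 0 \<and> wedge_power \<Theta> k c z zs \<noteq> 0"
    using Suc.prems wedge_eq_0I[of xs "\<Theta> c z" "wedge_power \<Theta> k c z"]
    unfolding wedge_power_Suc wedge_form_def by blast
  then obtain ys zs where yz: "mset ys + mset zs = mset xs" "\<Theta> c z ys \<noteq> 0" "wedge_power \<Theta> k c z zs \<noteq> 0"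
    by blast
  have "length (filter P xs) = length (filter P ys) + length (filter P zs)" for P
    unfolding length_filter_eq_size yz(1)[symmetric] by simp
  moreover have "length (filter isl ys) = 1" "length (filter (\<lambda>a. \<not> isl a) ys) = 1"
    using assms(1) yz(2) unfolding pq_forms_def by blast+
  ultimately show ?case using Suc.IH[OF yz(3)] by simp
qed

lemma ext_d_scale: "\<omega> \<in> forms A \<Longrightarrow> ext_d A (scale_form k \<omega>) = scale_form k (ext_d A \<omega>)"
proof (intro ext)
  fix c z xs assume \<omega>: "\<omega> \<in> forms A"
  show "ext_d A (scale_form k \<omega>) c z xs = scale_form k (ext_d A \<omega>) c z xs"
  proof (cases "c \<in> A \<and> z \<in> chart_image c")
    case True
    then show ?thesis using local_ext_cmult[OF form_differentiable[OF \<omega>], of c z] by (simp add: ext_d_eq scale_form_def)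
  qed (simp add: ext_d_zero scale_form_def)
qed

text \<open>A \<open>1\<close>-form \<open>\<gamma>\<close> with \<open>\<Theta> = (d\<gamma>)\<^sup>1\<^sup>,\<^sup>1\<close> makes \<open>\<Theta>\<^sup>n\<close> the top degree part of
  \<open>d(\<gamma> \<and> \<Theta>\<^sup>n\<^sup>-\<^sup>1)\<close>: the other components of \<open>d\<gamma>\<close> are killed by \<open>\<Theta>\<^sup>n\<^sup>-\<^sup>1\<close> for reasons of type.\<close>

lemma wedge_power_top_exact:
  assumes \<Theta>: "\<Theta> \<in> pq_forms A 1 1" "ext_d A \<Theta> = 0" and \<gamma>: "\<gamma> \<in> forms A"
    and type: "\<And>i j. \<Theta> c z [Inl i, Inr j] = ext_d A \<gamma> c z [Inl i, Inr j]"
    and m: "CARD('n) = Suc m"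
  shows "wedge_power \<Theta> (Suc m) c z top_index = ext_d A (wedge_form \<gamma> (wedge_power \<Theta> m)) c z top_index"
proof -
  have \<Theta>f: "\<Theta> \<in> forms A" using \<Theta>(1) by (simp add: pq_forms_def)
  have "wedge (\<lambda>ys. ext_d A \<gamma> c z ys - \<Theta> c z ys) (wedge_power \<Theta> m c z) top_index = 0"
  proof (rule wedge_eq_0I)
    fix ys zs assume split: "mset ys + mset zs = mset (top_index :: ('n + 'n) list)"
    show "ext_d A \<gamma> c z ys - \<Theta> c z ys = 0 \<or> wedge_power \<Theta> m c z zs = 0"
    proof (rule disjCI)
      assume "wedge_power \<Theta> m c z zs \<noteq> 0"
      note zs = wedge_power_type[OF \<Theta>(1) this]
      have "length (filter P ys) + length (filter P zs) = length (filter P (top_index :: ('n + 'n) list))" for P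
        unfolding length_filter_eq_size split[symmetric] by simp
      from this[of isl] this[of "\<lambda>a. \<not> isl a"] zs m
      have ys: "length (filter isl ys) = 1" "length (filter (\<lambda>a. \<not> isl a) ys) = 1"
        by (simp_all add: length_filter_top_index)
      then have "length ys = 2" using sum_length_filter_compl[of isl ys] by simp
      then obtain a b where ab: "ys = [a, b]" by (auto simp: numeral_2_eq_2 length_Suc_conv)
      have alt: "\<omega> c z [Inr j, Inl i] = - \<omega> c z [Inl i, Inr j]" if "\<omega> \<in> forms A" for \<omega> i j
        using alternatingD[OF form_alternating[OF that, of c z], where xs = "[]" and ys = "[]" and a = "Inr j" and b = "Inl i"] by simp
      show "ext_d A \<gamma> c z ys - \<Theta> c z ys = 0"
        using ys ab type alt[OF \<Theta>f] alt[OF forms_ext_d[OF \<gamma>]] by (cases a; cases b) auto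
    qed
  qed
  then have "wedge (\<Theta> c z) (wedge_power \<Theta> m c z) top_index = wedge (ext_d A \<gamma> c z) (wedge_power \<Theta> m c z) top_index"
    by (simp add: wedge_diff_left)
  then show ?thesis
    using ext_d_wedge_closed[OF \<gamma> forms_wedge_power[OF \<Theta>f] closed_wedge_power[OF \<Theta>f \<Theta>(2)]]
    by (simp add: wedge_power_Suc wedge_form_def)
qed

text \<open>The power \<open>\<eta>\<^sup>n\<close> is exact in top degree, with primitive \<open>\<gamma>
  \<and> \<Theta>\<^sup>n\<^sup>-\<^sup>1 + \<mu>\<close>.\<close>

lemma form_integral_power:
  assumes X: "compact_space X"
    and \<Theta>: "\<Theta> \<in> pq_forms A 1 1" "ext_d A \<Theta> = 0" and \<gamma>: "\<gamma> \<in> forms A"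
    and type: "\<And>c z i j. \<Theta> c z [Inl i, Inr j] = ext_d A \<gamma> c z [Inl i, Inr j]"
    and \<eta>: "\<eta> \<in> forms A" "ext_d A \<eta> = 0" and \<sigma>: "\<sigma> \<in> forms A" "\<eta> - \<Theta> = ext_d A \<sigma>"
  shows "form_integral X A (form_power \<eta> CARD('n)) = 0"
proof -
  obtain m where m: "CARD('n) = Suc m" using zero_less_card_finite[where 'a = 'n] gr0_implies_Suc by blast
  have \<Theta>f: "\<Theta> \<in> forms A" using \<Theta>(1) by (simp add: pq_forms_def)
  have even: "\<Theta> c z xs = 0" if "odd (length xs)" for c z xs
  proof (rule ccontr)
    assume "\<Theta> c z xs \<noteq> 0"
    then have "length (filter isl xs) = 1" "length (filter (\<lambda>a. \<not> isl a) xs) = 1"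
      using \<Theta>(1) unfolding pq_forms_def by blast+
    then have "length xs = 2" using sum_length_filter_compl[of isl xs] by simp
    then show False using that by simp
  qed
  obtain \<mu> where \<mu>: "\<mu> \<in> forms A" "wedge_power \<eta> (Suc m) = wedge_power \<Theta> (Suc m) + ext_d A \<mu>"
    using wedge_power_exact[OF \<eta> \<Theta>f \<Theta>(2) even \<sigma>] by blast
  let ?\<nu> = "wedge_form \<gamma> (wedge_power \<Theta> m)"
  have \<nu>: "?\<nu> \<in> forms A" by (intro forms_wedge forms_wedge_power \<gamma> \<Theta>f)
  show ?thesis
  proof (rule form_integral_exact[OF X forms_add[OF \<nu> \<mu>(1)]])
    fix c z assume "c \<in> A" "z \<in> chart_image c"
    then have "top_density (form_power \<eta> CARD('n) c z) = top_density (wedge_power \<eta> (Suc m) c z)"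
      by (simp add: form_power_eq m)
    also have "\<dots> = top_density (ext_d A (?\<nu> + \<mu>) c z)"
      by (simp add: \<mu>(2) ext_d_add[OF \<nu> \<mu>(1)] top_density_eq wedge_power_top_exact[OF \<Theta> \<gamma> type m])
    finally show "top_density (form_power \<eta> CARD('n) c z) = top_density (ext_d A (?\<nu> + \<mu>) c z)" .
  qed
qed

lemma de_rham_cocycle_form: "\<omega> \<in> de_rham_cocycles A k \<Longrightarrow> \<omega> \<in> forms A \<and> ext_d A \<omega> = 0"
  by (simp add: de_rham_cocycles_def real_forms_def)

text \<open>The existence of a metric makes the first Chern class nonempty, so that the vanishing of the
  integrals of all its representatives determines the Chern number.\<close>

lemma top_chern_number_zero:
  assumes X: "compact_space X" and ex: "\<exists>h. anticanonical_metric A h"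
    and potential: "\<And>h. anticanonical_metric A h \<Longrightarrow> \<exists>\<gamma>\<in>forms A. \<forall>c z i j.
      anticanonical_curvature A h c z [Inl i, Inr j] = ext_d A \<gamma> c z [Inl i, Inr j]"
  shows "top_chern_number X A = 0"
proof -
  have zero: "form_integral X A (form_power \<eta> CARD('n)) = 0" if \<eta>: "\<eta> \<in> first_chern_class A" for \<eta>
  proof -
    obtain h where h: "anticanonical_metric A h" "(anticanonical_curvature A h, \<eta>) \<in> de_rham_rel A 2"
      using \<eta> by (auto simp: first_chern_class_def de_rham_class_def)
    let ?\<Theta> = "anticanonical_curvature A h"
    obtain \<gamma> where \<gamma>: "\<gamma> \<in> forms A" "\<And>c z i j. ?\<Theta> c z [Inl i, Inr j] = ext_d A \<gamma> c z [Inl i, Inr j]"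
      using potential[OF h(1)] by blast
    have \<eta>: "\<eta> \<in> forms A" "ext_d A \<eta> = 0" using h(2) de_rham_cocycle_form by (auto simp: de_rham_rel_def)
    obtain \<sigma> where \<sigma>: "\<sigma> \<in> forms A" "?\<Theta> - \<eta> = ext_d A \<sigma>"
      using h(2) by (auto simp: de_rham_rel_def real_forms_def)
    have "\<eta> - ?\<Theta> = - (?\<Theta> - \<eta>)" by simp
    also have "\<dots> = ext_d A (scale_form (-1) \<sigma>)"
      unfolding ext_d_scale[OF \<sigma>(1)] \<sigma>(2) by (simp add: scale_form_def fun_eq_iff)
    finally show ?thesis
      by (rule form_integral_power[OF X curvature_pq_form[OF h(1)] curvature_closed[OF h(1)] \<gamma> \<eta> forms_scale[OF \<sigma>(1)]])
  qed
  obtain h where h: "anticanonical_metric A h" using ex by blast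
  have "(0 :: ('a, 'n) mform) \<in> real_forms A" using forms_zero by (simp add: real_forms_def)
  moreover have "ext_d A (0 :: ('a, 'n) mform) = 0"
    by (auto simp: fun_eq_iff ext_d_def partial_ext_def zero_fun_def)
  moreover have "(0 :: ('a, 'n) mform) \<in> k_forms A 2" using forms_zero by (simp add: k_forms_def)
  ultimately have "(0 :: ('a, 'n) mform) \<in> ext_d A ` real_forms A \<inter> k_forms A 2" by force
  then have "anticanonical_curvature A h \<in> first_chern_class A"
    using h curvature_de_rham_cocycle[OF h]
    by (auto simp: first_chern_class_def de_rham_class_def de_rham_rel_def)
  then show ?thesis
    unfolding top_chern_number_def
    by (intro the_equality) (auto intro!: bexI simp: zero)
qed

section \<open>Vanishing first Aeppli-Chern class\<close>

text \<open>The curvature is closed and of type \<open>(1,1)\<close>, so the component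
  \<open>\<partial>\<bar>\<Theta>\<close> of \<open>d\<Theta>\<close> vanishes by itself. The proof
  reads off from each nonzero term of \<open>d\<Theta>\<close> how many holomorphic directions there
  are.\<close>

lemma curvature_aeppli_cocycle:
  assumes h: "anticanonical_metric A h" shows "anticanonical_curvature A h \<in> aeppli_cocycles A 1 1"
proof -
  let ?\<Theta> = "anticanonical_curvature A h"
  have "delbar A ?\<Theta> c z xs = 0" for c z xs
  proof -
    let ?t = "\<lambda>i. (-1) ^ i * wirtinger (xs ! i) (\<lambda>w. ?\<Theta> c w (take i xs @ drop (Suc i) xs)) z"
    have nz: "length (filter isl xs) = (if isl (xs ! i) then 2 else 1)"
      if i: "i < length xs" and d: "wirtinger (xs ! i) (\<lambda>w. ?\<Theta> c w (take i xs @ drop (Suc i) xs)) z \<noteq> 0" for i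
    proof -
      obtain w where "?\<Theta> c w (take i xs @ drop (Suc i) xs) \<noteq> 0"
        using d wirtinger_const[of "xs ! i" 0 z] by fastforce
      from curvature_type(1)[OF h this]
      have "length (filter isl (take i xs @ drop (Suc i) xs)) = 1" .
      moreover have "length (filter isl xs) = length (filter isl (take i xs @ xs ! i # drop (Suc i) xs))"
        using id_take_nth_drop[OF i] by simp
      ultimately show ?thesis by simp
    qed
    have neutral: "?t i = 0" if i: "i < length xs" and ne: "isl (xs ! i) \<longleftrightarrow> length (filter isl xs) = 1" for i
      using nz[OF i] ne by (cases "isl (xs ! i)") auto
    show ?thesis
    proof (cases "c \<in> A \<and> z \<in> chart_image c \<and> length (filter isl xs) = 1")
      case True
      have "sum ?t {i. i < length xs \<and> \<not> isl (xs ! i)} = sum ?t {i. i < length xs \<and> True}"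
        by (rule sum.mono_neutral_left) (use neutral True in auto)
      then have "delbar A ?\<Theta> c z xs = ext_d A ?\<Theta> c z xs"
        using True by (simp add: delbar_def ext_d_def partial_ext_def)
      then show ?thesis using curvature_closed[OF h] by simp
    next
      case False
      show ?thesis
      proof (cases "c \<in> A \<and> z \<in> chart_image c")
        case True
        then have "sum ?t {i. i < length xs \<and> \<not> isl (xs ! i)} = 0"
          by (intro sum.neutral) (use neutral False in auto)
        then show ?thesis using True by (simp add: delbar_def partial_ext_def)
      qed (auto simp: delbar_def partial_ext_def)
    qed
  qed
  then have "delbar A ?\<Theta> = 0" by (simp add: fun_eq_iff)
  moreover have "del A (0 :: ('a, 'n) mform) = 0"
    by (auto simp: fun_eq_iff del_def partial_ext_def zero_fun_def)
  ultimately show ?thesis using curvature_pq_form[OF h] by (simp add: aeppli_cocycles_def)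
qed

lemma zero_aeppli:
  "(0 :: ('a, 'n) mform) \<in> aeppli_cocycles A 1 1" "(0 :: ('a, 'n) mform) \<in> aeppli_coboundaries A 1 1"
proof -
  have z: "del A (0 :: ('a, 'n) mform) = 0" "delbar A (0 :: ('a, 'n) mform) = 0"
    by (auto simp: fun_eq_iff del_def delbar_def partial_ext_def zero_fun_def)
  have pq: "(0 :: ('a, 'n) mform) \<in> pq_forms A 1 1" using forms_zero by (simp add: pq_forms_def)
  show "(0 :: ('a, 'n) mform) \<in> aeppli_cocycles A 1 1" using z pq by (simp add: aeppli_cocycles_def)
  have "(0 :: ('a, 'n) mform) \<in> del A ` forms A \<inter> pq_forms A 1 1" "(0 :: ('a, 'n) mform) \<in> delbar A ` forms A \<inter> pq_forms A 1 1"
    using z pq forms_zero by force+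
  from set_plus_intro[OF this] show "(0 :: ('a, 'n) mform) \<in> aeppli_coboundaries A 1 1"
    by (simp add: aeppli_coboundaries_def)
qed

lemma ext_d_pair:
  assumes "c \<in> A" "z \<in> chart_image c"
  shows "ext_d A \<gamma> c z [Inl i, Inr j] = wirtinger (Inl i) (\<lambda>w. \<gamma> c w [Inr j]) z - wirtinger (Inr j) (\<lambda>w. \<gamma> c w [Inl i]) z"
  using assms by (simp add: ext_d_eq local_ext_Cons contract_apply)

text \<open>On directions of type \<open>(1,1)\<close>, \<open>\<partial>\<alpha>\<close> depends only on the
  \<open>(0,1)\<close>-part of \<open>\<alpha>\<close> and \<open>\<partial>\<bar>\<beta>\<close>
  only on the \<open>(1,0)\<close>-part of \<open>\<beta>\<close>. With these parts in place of the
  forms, both derivatives become full exterior derivatives there.\<close>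

lemma aeppli_coboundary_potential:
  assumes "\<Theta> \<in> aeppli_coboundaries A 1 1"
  shows "\<exists>\<gamma>\<in>forms A. \<forall>c z i j. \<Theta> c z [Inl i, Inr j] = ext_d A \<gamma> c z [Inl i, Inr j]"
proof -
  obtain \<alpha> \<beta> where ab: "\<alpha> \<in> forms A" "\<beta> \<in> forms A" "\<Theta> = del A \<alpha> + delbar A \<beta>"
    using assms by (auto simp: aeppli_coboundaries_def elim!: set_plus_elim)
  let ?\<gamma> = "one_form_part (\<lambda>a. \<not> isl a) \<alpha> + one_form_part isl \<beta>"
  have "\<Theta> c z [Inl i, Inr j] = ext_d A ?\<gamma> c z [Inl i, Inr j]" for c z i j
  proof (cases "c \<in> A \<and> z \<in> chart_image c")
    case True
    then show ?thesis
      by (simp add: ab(3) ext_d_pair one_form_part_Cons del_def delbar_def partial_ext_eq local_ext_Cons contract_apply)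
  next
    case False
    then show ?thesis by (simp add: ab(3) del_def delbar_def partial_ext_zero ext_d_zero)
  qed
  moreover have "?\<gamma> \<in> forms A" by (intro forms_add forms_one_form_part ab) auto
  ultimately show ?thesis by blast
qed

text \<open>The class of \<open>0\<close> contains \<open>0\<close>, so its equality with the first
  Aeppli-Chern class also provides a metric on the anticanonical bundle.\<close>

lemma aeppli_flat_chern_number:
  assumes X: "compact_space X" and flat: "first_aeppli_chern_class A = aeppli_class A 1 1 0"
  shows "top_chern_number X A = 0"
proof (rule top_chern_number_zero[OF X])
  have "0 \<in> aeppli_class A 1 1 0" using zero_aeppli by (simp add: aeppli_class_def aeppli_rel_def)
  then have "0 \<in> first_aeppli_chern_class A" using flat by simp
  then show "\<exists>h. anticanonical_metric A h" by (auto simp: first_aeppli_chern_class_def)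
  fix h assume h: "anticanonical_metric A h"
  let ?\<Theta> = "anticanonical_curvature A h"
  have "?\<Theta> \<in> first_aeppli_chern_class A"
    using h curvature_aeppli_cocycle[OF h] zero_aeppli(2)
    by (auto simp: first_aeppli_chern_class_def aeppli_class_def aeppli_rel_def)
  then have "0 - ?\<Theta> \<in> aeppli_coboundaries A 1 1" using flat by (simp add: aeppli_class_def aeppli_rel_def)
  from aeppli_coboundary_potential[OF this] obtain \<gamma> where \<gamma>: "\<gamma> \<in> forms A"
    "\<And>c z i j. (0 - ?\<Theta>) c z [Inl i, Inr j] = ext_d A \<gamma> c z [Inl i, Inr j]" by blast
  have "?\<Theta> c z [Inl i, Inr j] = ext_d A (scale_form (-1) \<gamma>) c z [Inl i, Inr j]" for c z i j
  proof -
    have "- ?\<Theta> c z [Inl i, Inr j] = ext_d A \<gamma> c z [Inl i, Inr j]" using \<gamma>(2)[of c z i j] by simp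
    then have "?\<Theta> c z [Inl i, Inr j] = - ext_d A \<gamma> c z [Inl i, Inr j]" by (metis minus_minus)
    then show ?thesis unfolding ext_d_scale[OF \<gamma>(1)] by (simp add: scale_form_def)
  qed
  then show "\<exists>\<gamma>\<in>forms A. \<forall>c z i j. ?\<Theta> c z [Inl i, Inr j] = ext_d A \<gamma> c z [Inl i, Inr j]"
    using forms_scale[OF \<gamma>(1)] by blast
qed

end

section \<open>Hermitian matrices\<close>

text \<open>A vector in the kernel of the transpose is isotropic for the Hermitian form.\<close>

lemma hermitian_posdef_det_nonzero:
  assumes "hermitian_posdef H" shows "det H \<noteq> 0"
proof -
  have "\<forall>x. transpose H *v x = 0 \<longrightarrow> x = 0"
  proof (intro allI impI, rule ccontr)
    fix x assume x: "transpose H *v x = 0" "x \<noteq> 0"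
    have "(\<Sum>i\<in>UNIV. \<Sum>j\<in>UNIV. H $ i $ j * x $ i * cnj (x $ j))
        = (\<Sum>j\<in>UNIV. (transpose H *v x) $ j * cnj (x $ j))"
      by (subst sum.swap) (simp add: matrix_vector_mult_def transpose_def sum_distrib_right)
    also have "\<dots> = 0" unfolding x(1) by simp
    finally have "(\<Sum>i\<in>UNIV. \<Sum>j\<in>UNIV. H $ i $ j * x $ i * cnj (x $ j)) = 0" .
    moreover have "0 < Re (\<Sum>i\<in>UNIV. \<Sum>j\<in>UNIV. H $ i $ j * x $ i * cnj (x $ j))"
      using assms x(2) unfolding hermitian_posdef_def by blast
    ultimately show False by simp
  qed
  then have "\<exists>B. B ** transpose H = mat 1" by (simp add: matrix_left_invertible_ker)
  then have "det (transpose H) \<noteq> 0" by (metis det_I det_mul mult_zero_right zero_neq_one)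
  then show ?thesis by (simp add: det_transpose)
qed

lemma hermitian_posdef_det_real:
  assumes "hermitian_posdef H" shows "Im (det H) = 0"
proof -
  have "transpose H = (\<chi> i j. cnj (H $ i $ j))"
    using assms unfolding hermitian_posdef_def transpose_def vec_eq_iff vec_lambda_beta by blast
  then have "det (transpose H) = cnj (det H)" by (simp only: det_cnj)
  then show ?thesis by (simp add: det_transpose complex_eq_iff)
qed

text \<open>The determinant does not vanish on the segment from the identity matrix to \<open>H\<close>, which consists
  of positive definite matrices.\<close>

lemma hermitian_posdef_det_pos:
  fixes H :: "complex^'n::finite^'n"
  assumes H: "hermitian_posdef H" shows "Re (det H) > 0"
proof -
  define M where "M t = (\<chi> i j. of_real (1 - t) * (if i = j then 1 else 0) + of_real t * H $ i $ j)" for t :: real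
  have pos: "hermitian_posdef (M t)" if t: "0 \<le> t" "t \<le> 1" for t
    unfolding hermitian_posdef_def
  proof (intro conjI allI impI)
    fix i j
    have "H $ j $ i = cnj (H $ i $ j)" using H unfolding hermitian_posdef_def by blast
    then show "M t $ j $ i = cnj (M t $ i $ j)" by (simp add: M_def)
  next
    fix v :: "complex^'n" assume v: "v \<noteq> 0"
    let ?q = "\<lambda>N :: complex^'n^'n. Re (\<Sum>i\<in>UNIV. \<Sum>j\<in>UNIV. N $ i $ j * v $ i * cnj (v $ j))"
    have "(\<Sum>i\<in>UNIV. \<Sum>j\<in>UNIV. M t $ i $ j * v $ i * cnj (v $ j))
        = of_real (1 - t) * (\<Sum>i\<in>UNIV. v $ i * cnj (v $ i))
          + of_real t * (\<Sum>i\<in>UNIV. \<Sum>j\<in>UNIV. H $ i $ j * v $ i * cnj (v $ j))"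
    proof -
      have "M t $ i $ j * v $ i * cnj (v $ j) = of_real (1 - t) * (if i = j then v $ i * cnj (v $ j) else 0)
          + of_real t * (H $ i $ j * v $ i * cnj (v $ j))" for i j
        by (simp add: M_def algebra_simps)
      then have "(\<Sum>i\<in>UNIV. \<Sum>j\<in>UNIV. M t $ i $ j * v $ i * cnj (v $ j))
        = of_real (1 - t) * (\<Sum>i\<in>UNIV. \<Sum>j\<in>UNIV. if i = j then v $ i * cnj (v $ j) else 0)
          + of_real t * (\<Sum>i\<in>UNIV. \<Sum>j\<in>UNIV. H $ i $ j * v $ i * cnj (v $ j))"
        by (simp only: sum.distrib sum_distrib_left)
      then show ?thesis by simp
    qed
    moreover have "(\<Sum>i\<in>UNIV. v $ i * cnj (v $ i)) = of_real (\<Sum>i\<in>UNIV. (cmod (v $ i))\<^sup>2)"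
      by (simp only: complex_norm_square[symmetric] of_real_sum)
    ultimately have q: "?q (M t) = (1 - t) * (\<Sum>i\<in>UNIV. (cmod (v $ i))\<^sup>2) + t * ?q H"
      by simp
    have Q: "?q H > 0" using H v unfolding hermitian_posdef_def by blast
    obtain k where k: "v $ k \<noteq> 0" using v by (auto simp: vec_eq_iff)
    have N: "(\<Sum>i\<in>UNIV. (cmod (v $ i))\<^sup>2) > 0" by (rule sum_pos2[of UNIV k]) (auto simp: k)
    have "0 < (1 - t) * x + t * y" if "0 < x" "0 < y" for x y :: real
      using that t by (cases "t = 0") (auto intro: add_nonneg_pos)
    from this[OF N Q] show "0 < ?q (M t)" unfolding q .
  qed
  let ?f = "\<lambda>t. Re (det (M t))"
  have nz: "?f t \<noteq> 0" if "0 \<le> t" "t \<le> 1" for t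
    using hermitian_posdef_det_nonzero[OF pos[OF that]] hermitian_posdef_det_real[OF pos[OF that]]
    by (simp add: complex_eq_iff)
  have cont: "continuous_on {0..1} ?f"
    unfolding det_def M_def by (intro continuous_intros)
  have "M 0 = mat 1" by (simp add: M_def mat_def vec_eq_iff)
  then have "?f 0 = 1" by simp
  have "?f 1 > 0"
  proof (rule ccontr)
    assume "\<not> ?f 1 > 0"
    then obtain t where "0 \<le> t" "t \<le> 1" "?f t = 0"
      using IVT2'[of ?f 1 0 0] cont \<open>?f 0 = 1\<close> by auto
    then show False using nz by blast
  qed
  moreover have "M 1 = H" by (simp add: M_def vec_eq_iff)
  ultimately show ?thesis by simp
qed

text \<open>Cramer's rule: the new row is the combination of the rows of \<open>H\<close> with the
  coefficients \<open>(H\<^sup>T)\<^sup>-\<^sup>1 r\<close>.\<close>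

lemma det_replace_row:
  fixes H :: "complex^'n::finite^'n"
  assumes "det H \<noteq> 0"
  shows "det (\<chi> i. if i = k then r else H $ i) = (\<Sum>l\<in>UNIV. matrix_inv (transpose H) $ k $ l * r $ l) * det H"
proof -
  let ?x = "matrix_inv (transpose H) *v r"
  have inv: "invertible (transpose H)" using assms by (simp add: invertible_det_nz det_transpose)
  have "transpose H *v ?x = r" using matrix_inv_inverse(1)[OF inv] by (simp add: matrix_vector_mul_assoc)
  moreover have "(\<Sum>i\<in>UNIV. y $ i *s row i H) = transpose H *v y" for y
    unfolding matrix_vector_mult_def transpose_def by (simp add: row_def vec_eq_iff mult.commute)
  ultimately have "(\<Sum>i\<in>UNIV. ?x $ i *s row i H) = r" by simp
  moreover have "row i H = H $ i" for i by (simp add: row_def vec_eq_iff)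
  ultimately have "det (\<chi> i. if i = k then r else H $ i) = ?x $ k * det H"
    using cramer_lemma_transpose[of k ?x H] by (simp only: cong: if_cong)
  then show ?thesis by (simp add: matrix_vector_mult_def)
qed

text \<open>Jacobi's formula, with the inverse of the transpose as in \<^const>\<open>inverse_metric\<close>.\<close>

lemma jacobi_formula:
  fixes H :: "complex^'n::finite \<Rightarrow> complex^'n^'n"
  assumes "\<And>i j. (\<lambda>w. H w $ i $ j) differentiable at z" "det (H z) \<noteq> 0"
  shows "wirtinger a (\<lambda>w. det (H w)) z
    = (\<Sum>k\<in>UNIV. \<Sum>l\<in>UNIV. inverse_metric H k l z * wirtinger a (\<lambda>w. H w $ k $ l) z) * det (H z)"
  unfolding wirtinger_det[OF assms(1)] det_replace_row[OF assms(2)] inverse_metric_def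
  by (simp add: sum_distrib_right)

section \<open>Levi-Civita Ricci-flat metrics\<close>

lemma sum_rotate: "(\<Sum>k\<in>K. \<Sum>l\<in>L. \<Sum>a\<in>B. G k l a) = (\<Sum>a\<in>B. \<Sum>k\<in>K. \<Sum>l\<in>L. G k l a)"
proof -
  have "(\<Sum>k\<in>K. \<Sum>l\<in>L. \<Sum>a\<in>B. G k l a) = (\<Sum>k\<in>K. \<Sum>a\<in>B. \<Sum>l\<in>L. G k l a)"
    by (intro sum.cong refl sum.swap)
  also have "\<dots> = (\<Sum>a\<in>B. \<Sum>k\<in>K. \<Sum>l\<in>L. G k l a)" by (rule sum.swap)
  finally show ?thesis .
qed

lemma pullback_triple:
  "pullback_at \<tau> z \<alpha> [a, b, e] = (\<Sum>k\<in>UNIV. \<Sum>l\<in>UNIV. \<Sum>m\<in>UNIV.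
    jacobian \<tau> z k a * (jacobian \<tau> z l b * jacobian \<tau> z m e * \<alpha> [k, l, m]))"
  by (simp add: pullback_Cons contract_apply sum_distrib_left mult_ac)

locale hermitian_mfd = complex_mfd X A for X :: "'a topology" and A :: "('a, 'n::finite) chart set" +
  fixes \<omega> :: "('a, 'n) mform"
  assumes metric: "hermitian_metric A \<omega>"
begin

abbreviation H :: "('a, 'n) chart \<Rightarrow> complex^'n \<Rightarrow> complex^'n^'n" where
  "H \<equiv> metric_matrix \<omega>"

lemma metric_form: "\<omega> \<in> forms A"
  using metric by (simp add: hermitian_metric_def pq_forms_def)

lemma metric_type:
  "\<omega> c z [Inl i, Inl k] = 0" "\<omega> c z [Inr i, Inr k] = 0"
proof -
  have *: "\<omega> c z xs = 0" if "length (filter isl xs) \<noteq> 1" for xs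
    using metric that unfolding hermitian_metric_def pq_forms_def by blast
  show "\<omega> c z [Inl i, Inl k] = 0" "\<omega> c z [Inr i, Inr k] = 0" by (rule *, simp)+
qed

lemma metric_coeff: "\<omega> c z [Inl i, Inr j] = \<i> * H c z $ i $ j" "\<omega> c z [Inr j, Inl i] = - (\<i> * H c z $ i $ j)"
  using alternatingD[OF form_alternating[OF metric_form, of c z], where xs = "[]" and ys = "[]" and a = "Inr j" and b = "Inl i"]
  by (simp_all add: metric_matrix_def)

lemma posdef: "c \<in> A \<Longrightarrow> z \<in> chart_image c \<Longrightarrow> hermitian_posdef (H c z)"
  using metric by (simp add: hermitian_metric_def)

lemma det_metric_nonzero: "c \<in> A \<Longrightarrow> z \<in> chart_image c \<Longrightarrow> det (H c z) \<noteq> 0"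
  using hermitian_posdef_det_nonzero posdef by blast

lemma smooth_metric_matrix:
  assumes "c \<in> A" shows "smooth_on (chart_image c) (\<lambda>z. H c z $ i $ j)"
proof -
  have "smooth_on (chart_image c) (\<lambda>z. - \<i> * \<omega> c z [Inl i, Inr j])"
    using form_smooth[OF metric_form assms]
    by (intro smooth_on_mult smooth_on_const open_chart_image assms) (simp add: smooth_covec_def)
  then show ?thesis by (simp add: metric_matrix_def)
qed

lemma smooth_inverse_metric: "c \<in> A \<Longrightarrow> smooth_on (chart_image c) (inverse_metric (H c) k l)"
  unfolding inverse_metric_def[abs_def]
proof (rule smooth_on_matrix_inv)
  assume c: "c \<in> A"
  show "open (chart_image c)" by (rule open_chart_image[OF c])
  show "smooth_on (chart_image c) (\<lambda>z. transpose (H c z) $ i $ j)" for i j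
    using smooth_metric_matrix[OF c, of j i] by (simp add: transpose_def)
  show "det (transpose (H c z)) \<noteq> 0" if "z \<in> chart_image c" for z
    using det_metric_nonzero[OF c that] by (simp add: det_transpose)
qed

definition det_metric :: "('a, 'n) chart \<Rightarrow> complex^'n \<Rightarrow> real" where
  "det_metric c z = Re (det (H c z))"

lemma of_real_det_metric: "c \<in> A \<Longrightarrow> z \<in> chart_image c \<Longrightarrow> complex_of_real (det_metric c z) = det (H c z)"
  using hermitian_posdef_det_real[OF posdef] by (simp add: det_metric_def complex_eq_iff)

text \<open>The metric has type \<open>(1,1)\<close>, so its matrix changes by the holomorphic Jacobian and
  its conjugate only.\<close>

lemma metric_transition:
  assumes "c \<in> A" "d \<in> A" "z \<in> overlap c d"
  defines "J \<equiv> \<chi> k i. jacobian (transition c d) z (Inl k) (Inl i)"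
  shows "H c z = transpose J ** H d (transition c d z) ** (\<chi> i j. cnj (J $ i $ j))"
proof -
  let ?\<tau> = "transition c d"
  have "H c z $ i $ j = (\<Sum>k\<in>UNIV. \<Sum>l\<in>UNIV. J $ k $ i * cnj (J $ l $ j) * H d (?\<tau> z) $ k $ l)" for i j
  proof -
    have "\<i> * H c z $ i $ j = pullback_at ?\<tau> z (\<omega> d (?\<tau> z)) [Inl i, Inr j]"
      using form_pullback[OF metric_form assms(1-3)] metric_coeff(1)[of c z i j] by simp
    also have "\<dots> = \<i> * (\<Sum>k\<in>UNIV. \<Sum>l\<in>UNIV. J $ k $ i * cnj (J $ l $ j) * H d (?\<tau> z) $ k $ l)"
      using jacobian_transition[OF assms(1-3)]
      by (simp add: pullback_pair sum_index metric_type metric_coeff J_def sum_distrib_left mult_ac)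
    finally show ?thesis by simp
  qed
  moreover have "(transpose J ** H d (?\<tau> z) ** (\<chi> i j. cnj (J $ i $ j))) $ i $ j
      = (\<Sum>k\<in>UNIV. \<Sum>l\<in>UNIV. J $ k $ i * cnj (J $ l $ j) * H d (?\<tau> z) $ k $ l)" for i j
  proof -
    have "(transpose J ** H d (?\<tau> z) ** (\<chi> i j. cnj (J $ i $ j))) $ i $ j
        = (\<Sum>l\<in>UNIV. (\<Sum>k\<in>UNIV. J $ k $ i * H d (?\<tau> z) $ k $ l) * cnj (J $ l $ j))"
      by (simp add: matrix_matrix_mult_def transpose_def)
    also have "\<dots> = (\<Sum>l\<in>UNIV. \<Sum>k\<in>UNIV. J $ k $ i * cnj (J $ l $ j) * H d (?\<tau> z) $ k $ l)"
      by (simp add: sum_distrib_left mult_ac)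
    finally show ?thesis by (simp only: sum.swap[of _ UNIV UNIV, where g = "\<lambda>l k. J $ k $ i * cnj (J $ l $ j) * H d (?\<tau> z) $ k $ l"])
  qed
  ultimately show ?thesis by (simp add: vec_eq_iff)
qed

lemma det_metric_anticanonical: "anticanonical_metric A det_metric"
  unfolding anticanonical_metric_def
proof (intro conjI ballI)
  fix c assume c: "c \<in> A"
  show "smooth_on (chart_image c) (det_metric c)"
    unfolding det_metric_def[abs_def]
    by (intro smooth_on_Re smooth_on_det open_chart_image c smooth_metric_matrix)
  show "0 < det_metric c z" if "z \<in> chart_image c" for z
    using hermitian_posdef_det_pos[OF posdef[OF c that]] by (simp add: det_metric_def)
  fix d z assume d: "d \<in> A" "z \<in> overlap c d"
  let ?J = "\<chi> k i. jacobian (transition c d) z (Inl k) (Inl i)"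
  have "det (H c z) = (det ?J * cnj (det ?J)) * det (H d (transition c d z))"
    unfolding metric_transition[OF c d] using det_cnj[of ?J] by (simp add: det_mul det_transpose)
  then have "det (H c z) = of_real ((cmod (det ?J))\<^sup>2) * det (H d (transition c d z))"
    by (simp only: complex_norm_square)
  then show "det_metric c z = (cmod (det ?J))\<^sup>2 * det_metric d (transition c d z)"
    by (simp add: det_metric_def)
qed

text \<open>The inverse metric is a contravariant tensor. Multiplying the transformed inverse by the matrix
  that it should invert gives a matrix that fixes the invertible matrix \<open>J\<close> from the
  left.\<close>

lemma inverse_metric_transition:
  assumes cd: "c \<in> A" "d \<in> A" "z \<in> overlap c d"
  defines "J \<equiv> \<chi> k i. jacobian (transition c d) z (Inl k) (Inl i)"
  shows "(\<Sum>k\<in>UNIV. \<Sum>l\<in>UNIV. J $ k' $ k * inverse_metric (H c) k l z * cnj (J $ l' $ l))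
    = inverse_metric (H d) k' l' (transition c d z)"
proof -
  let ?\<tau> = "transition c d" and ?Jc = "\<chi> i j. cnj (J $ i $ j)"
  let ?Hc = "transpose (H c z)" and ?Hd = "transpose (H d (?\<tau> z))"
  let ?M = "J ** matrix_inv ?Hc ** transpose ?Jc"
  have tr: "?Hc = transpose ?Jc ** ?Hd ** J"
    using metric_transition[OF cd] by (simp add: J_def matrix_transpose_mul matrix_mul_assoc)
  have z: "z \<in> chart_image c" using overlap_subset cd(3) by blast
  have invc: "invertible ?Hc" using det_metric_nonzero[OF cd(1) z] by (simp add: invertible_det_nz det_transpose)
  have invd: "invertible ?Hd"
    using det_metric_nonzero[OF cd(2) transition_in(2)[OF cd]] by (simp add: invertible_det_nz det_transpose)
  have "det J \<noteq> 0" using metric_jacobian_nonzero[OF det_metric_anticanonical cd] by (simp add: J_def)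
  then have invJ: "invertible J" by (simp add: invertible_det_nz)
  have "?M ** ?Hd ** J = J ** (matrix_inv ?Hc ** ?Hc)"
    by (subst tr) (simp add: matrix_mul_assoc)
  then have "?M ** ?Hd ** J = J" using matrix_inv_inverse(2)[OF invc] by simp
  then have "?M ** ?Hd ** (J ** matrix_inv J) = J ** matrix_inv J" by (simp add: matrix_mul_assoc)
  then have "?M ** ?Hd = mat 1" using matrix_inv_inverse(1)[OF invJ] by simp
  then have "?M ** ?Hd ** matrix_inv ?Hd = matrix_inv ?Hd" by simp
  then have "?M = matrix_inv ?Hd"
    using matrix_inv_inverse(1)[OF invd] by (simp flip: matrix_mul_assoc)
  then have "?M $ k' $ l' = inverse_metric (H d) k' l' (?\<tau> z)" by (simp add: inverse_metric_def)
  moreover have "?M $ k' $ l' = (\<Sum>k\<in>UNIV. \<Sum>l\<in>UNIV. J $ k' $ k * inverse_metric (H c) k l z * cnj (J $ l' $ l))"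
    by (subst sum.swap) (simp add: matrix_matrix_mult_def transpose_def[of ?Jc] inverse_metric_def sum_distrib_right)
  ultimately show ?thesis by simp
qed

text \<open>The contraction of \<open>d\<omega>\<close> with \<open>\<omega>\<close>, that is, the torsion \<open>1\<close>-form (up to a factor, the Lee
  form) of the metric.\<close>

definition torsion_form :: "('a, 'n) mform" where
  "torsion_form c z xs = (case xs of
      [a] \<Rightarrow> - \<i> * (\<Sum>k\<in>UNIV. \<Sum>l\<in>UNIV. inverse_metric (H c) k l z * ext_d A \<omega> c z [a, Inl k, Inr l])
    | _ \<Rightarrow> 0)"

lemma torsion_form_simps:
  "torsion_form c z [] = 0"
  "torsion_form c z [a] = - \<i> * (\<Sum>k\<in>UNIV. \<Sum>l\<in>UNIV. inverse_metric (H c) k l z * ext_d A \<omega> c z [a, Inl k, Inr l])"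
  "torsion_form c z (a # b # xs) = 0"
  by (simp_all add: torsion_form_def)

text \<open>Contraction of the tensor \<open>d\<omega>\<close> with the contravariant tensor \<open>h\<^bsup>k
  l\<bar>\<^esup>\<close> is independent of the chart.\<close>

lemma forms_torsion: "torsion_form \<in> forms A"
proof (rule formsI)
  note d\<omega> = forms_ext_d[OF metric_form]
  show "torsion_form c z = 0" if "\<not> (c \<in> A \<and> z \<in> chart_image c)" for c z
    using ext_d_zero[OF that] by (intro ext) (simp add: torsion_form_def split: list.split)
  show "alternating (torsion_form c z)" for c z
    by (rule alternating_degree_one) (auto simp: torsion_form_def split: list.split)
  show "smooth_covec (chart_image c) (torsion_form c)" if c: "c \<in> A" for c
    unfolding smooth_covec_def
  proof
    fix xs
    have "smooth_on (chart_image c) (\<lambda>z. - \<i> * (\<Sum>k\<in>UNIV. \<Sum>l\<in>UNIV. inverse_metric (H c) k l z * ext_d A \<omega> c z [a, Inl k, Inr l]))" for a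
      using form_smooth[OF d\<omega> c] smooth_inverse_metric[OF c]
      by (intro smooth_on_mult smooth_on_sum smooth_on_const open_chart_image c) (auto simp: smooth_covec_def)
    moreover have "smooth_on (chart_image c) (\<lambda>z. 0 :: complex)" by (rule smooth_on_const[OF open_chart_image[OF c]])
    ultimately show "smooth_on (chart_image c) (\<lambda>z. torsion_form c z xs)"
      by (cases xs; cases "tl xs") (auto simp: torsion_form_simps)
  qed
  fix c d z bs assume cd: "c \<in> A" "d \<in> A" "z \<in> overlap c d"
  let ?\<tau> = "transition c d" and ?J = "jacobian (transition c d) z"
  show "torsion_form c z bs = pullback_at ?\<tau> z (torsion_form d (?\<tau> z)) bs"
  proof (cases "length bs = 1")
    case True
    then obtain b where b: "bs = [b]" by (auto simp: length_Suc_conv)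
    let ?T = "\<lambda>a k l. ext_d A \<omega> d (?\<tau> z) [a, Inl k, Inr l]" and ?g = "\<lambda>k l. inverse_metric (H c) k l z"
    have T: "ext_d A \<omega> c z [b, Inl k, Inr l] = (\<Sum>a\<in>UNIV. \<Sum>k'\<in>UNIV. \<Sum>l'\<in>UNIV.
        ?J a b * (?J (Inl k') (Inl k) * cnj (?J (Inl l') (Inl l)) * ?T a k' l'))" for k l
      using form_pullback[OF d\<omega> cd] jacobian_transition[OF cd]
      by (simp add: pullback_triple sum_index[of "\<lambda>a. \<Sum>m\<in>UNIV. _ a m"] sum_index[of "\<lambda>m. _ * (_ * _ m * _ m)"])
    have "(\<Sum>k\<in>UNIV. \<Sum>l\<in>UNIV. ?g k l * ext_d A \<omega> c z [b, Inl k, Inr l])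
      = (\<Sum>k\<in>UNIV. \<Sum>l\<in>UNIV. \<Sum>a\<in>UNIV. \<Sum>k'\<in>UNIV. \<Sum>l'\<in>UNIV.
          ?J a b * (?J (Inl k') (Inl k) * ?g k l * cnj (?J (Inl l') (Inl l)) * ?T a k' l'))"
      unfolding T by (simp add: sum_distrib_left mult_ac)
    also have "\<dots> = (\<Sum>a\<in>UNIV. \<Sum>k'\<in>UNIV. \<Sum>l'\<in>UNIV. \<Sum>k\<in>UNIV. \<Sum>l\<in>UNIV.
          ?J a b * (?J (Inl k') (Inl k) * ?g k l * cnj (?J (Inl l') (Inl l)) * ?T a k' l'))"
      by (rule trans[OF sum_rotate], rule sum.cong[OF refl], rule trans[OF sum_rotate], rule sum.cong[OF refl],
        rule sum_rotate)
    also have "\<dots> = (\<Sum>a\<in>UNIV. ?J a b * (\<Sum>k'\<in>UNIV. \<Sum>l'\<in>UNIV.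
        (\<Sum>k\<in>UNIV. \<Sum>l\<in>UNIV. ?J (Inl k') (Inl k) * ?g k l * cnj (?J (Inl l') (Inl l))) * ?T a k' l'))"
      by (simp add: sum_distrib_left sum_distrib_right)
    also have "\<dots> = (\<Sum>a\<in>UNIV. ?J a b * (\<Sum>k'\<in>UNIV. \<Sum>l'\<in>UNIV. inverse_metric (H d) k' l' (?\<tau> z) * ?T a k' l'))"
      using inverse_metric_transition[OF cd] by simp
    finally show ?thesis
      by (simp add: b torsion_form_simps pullback_Cons contract_apply sum_distrib_left mult_ac)
  next
    case False
    have "torsion_form c z as = 0" if "length as \<noteq> 1" for c z as
      using that by (cases as; cases "tl as") (auto simp: torsion_form_simps)
    then show ?thesis using False by (simp add: pullback_zero_degree)
  qed
qed

lemma torsion_form_Inl: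
  assumes c: "c \<in> A" "z \<in> chart_image c"
  shows "torsion_form c z [Inl i] = (\<Sum>k\<in>UNIV. \<Sum>l\<in>UNIV. inverse_metric (H c) k l z *
    (wirtinger (Inl i) (\<lambda>w. H c w $ k $ l) z - wirtinger (Inl k) (\<lambda>w. H c w $ i $ l) z))"
proof -
  have d: "(\<lambda>w. H c w $ k $ l) differentiable at z" for k l
    by (rule smooth_on_differentiable[OF smooth_metric_matrix[OF c(1)] c(2)])
  have "ext_d A \<omega> c z [Inl i, Inl k, Inr l]
      = \<i> * (wirtinger (Inl i) (\<lambda>w. H c w $ k $ l) z - wirtinger (Inl k) (\<lambda>w. H c w $ i $ l) z)" for k l
    by (simp add: ext_d_eq c local_ext_Cons contract_apply metric_type metric_coeff wirtinger_cmult d algebra_simps)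
  then show ?thesis by (simp add: torsion_form_simps sum_distrib_left mult_ac)
qed

lemma torsion_form_Inr:
  assumes c: "c \<in> A" "z \<in> chart_image c"
  shows "torsion_form c z [Inr j] = (\<Sum>k\<in>UNIV. \<Sum>l\<in>UNIV. inverse_metric (H c) k l z *
    (wirtinger (Inr j) (\<lambda>w. H c w $ k $ l) z - wirtinger (Inr l) (\<lambda>w. H c w $ k $ j) z))"
proof -
  have d: "(\<lambda>w. H c w $ k $ l) differentiable at z" for k l
    by (rule smooth_on_differentiable[OF smooth_metric_matrix[OF c(1)] c(2)])
  have "ext_d A \<omega> c z [Inr j, Inl k, Inr l]
      = \<i> * (wirtinger (Inr j) (\<lambda>w. H c w $ k $ l) z - wirtinger (Inr l) (\<lambda>w. H c w $ k $ j) z)" for k l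
    by (simp add: ext_d_eq c local_ext_Cons contract_apply metric_type metric_coeff wirtinger_cmult wirtinger_uminus d algebra_simps)
  then show ?thesis by (simp add: torsion_form_simps sum_distrib_left mult_ac)
qed

abbreviation "log_det c \<equiv> (\<lambda>z. complex_of_real (ln (det_metric c z)))"

text \<open>Jacobi's formula identifies the logarithmic derivative of the determinant with a trace.\<close>

lemma wirtinger_log_det:
  assumes c: "c \<in> A" "z \<in> chart_image c"
  shows "wirtinger a (log_det c) z
    = (\<Sum>k\<in>UNIV. \<Sum>l\<in>UNIV. inverse_metric (H c) k l z * wirtinger a (\<lambda>w. H c w $ k $ l) z)"
proof -
  note sp = metric_smooth_pos[OF det_metric_anticanonical c(1)]
  have smr: "smooth_on (chart_image c) (\<lambda>w. complex_of_real (det_metric c w))"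
    by (rule smooth_on_of_real[OF open_chart_image[OF c(1)] sp(1)])
  have "wirtinger a (log_det c) z = wirtinger a (\<lambda>w. of_real (det_metric c w)) z / of_real (det_metric c z)"
    by (rule wirtinger_ln[OF smooth_on_differentiable[OF sp(1) c(2)] sp(2)[OF c(2)]])
  also have "wirtinger a (\<lambda>w. of_real (det_metric c w)) z = wirtinger a (\<lambda>w. det (H c w)) z"
    by (rule wirtinger_cong[OF open_chart_image[OF c(1)] c(2) smooth_on_differentiable[OF smr c(2)]])
      (rule of_real_det_metric[OF c(1)])
  also have "\<dots> = (\<Sum>k\<in>UNIV. \<Sum>l\<in>UNIV. inverse_metric (H c) k l z * wirtinger a (\<lambda>w. H c w $ k $ l) z) * det (H c z)"
    by (rule jacobi_formula[OF smooth_on_differentiable[OF smooth_metric_matrix[OF c(1)] c(2)] det_metric_nonzero[OF c]])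
  finally show ?thesis using of_real_det_metric[OF c] det_metric_nonzero[OF c] by simp
qed

text \<open>The coefficient contains \<open>\<partial>\<^sub>kh\<^bsub>i l\<bar>\<^esub>\<close>, and the
  torsion is its difference to the term \<open>\<partial>\<^sub>ih\<^bsub>k l\<bar>\<^esub>\<close>
  of the logarithmic derivative.\<close>

lemma trace_lc_gamma:
  assumes "c \<in> A" "z \<in> chart_image c"
  shows "(\<Sum>k\<in>UNIV. lc_gamma (H c) i k k z) = wirtinger (Inl i) (log_det c) z - 1/2 * torsion_form c z [Inl i]"
  unfolding lc_gamma_def wirtinger_log_det[OF assms] torsion_form_Inl[OF assms]
  by (simp add: sum_distrib_left sum_subtractf[symmetric] algebra_simps)

lemma trace_lc_gamma_bar:
  assumes "c \<in> A" "z \<in> chart_image c"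
  shows "(\<Sum>k\<in>UNIV. lc_gamma_bar (H c) j k k z) = 1/2 * torsion_form c z [Inr j]"
  unfolding lc_gamma_bar_def torsion_form_Inr[OF assms] by (simp add: sum_distrib_left)

lemma smooth_lc_gamma:
  assumes "c \<in> A"
  shows "smooth_on (chart_image c) (lc_gamma (H c) i j k)" "smooth_on (chart_image c) (lc_gamma_bar (H c) i j k)"
  unfolding lc_gamma_def[abs_def] lc_gamma_bar_def[abs_def]
  by (intro smooth_on_mult smooth_on_sum smooth_on_const smooth_on_add smooth_on_diff smooth_on_wirtinger
      smooth_inverse_metric smooth_metric_matrix open_chart_image assms)+

text \<open>The quadratic terms cancel in the trace, since the two sums differ by an exchange of the summation
  indices and \<open>\<Gamma>\<^bsub>ij\<^esub>\<^sup>k\<close> is symmetric in \<open>i\<close> and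
  \<open>j\<close>.\<close>

lemma trace_lc_curvature:
  assumes c: "c \<in> A" "z \<in> chart_image c"
  shows "(\<Sum>k\<in>UNIV. lc_curvature (H c) i j k k z)
    = - (wirtinger (Inl i) (wirtinger (Inr j) (log_det c)) z
        - 1/2 * wirtinger (Inr j) (\<lambda>w. torsion_form c w [Inl i]) z
        - 1/2 * wirtinger (Inl i) (\<lambda>w. torsion_form c w [Inr j]) z)"
proof -
  note o = open_chart_image[OF c(1)] and sml = metric_smooth_pos(3)[OF det_metric_anticanonical c(1)]
  let ?G = "\<lambda>i k l. lc_gamma (H c) i k l" and ?B = "\<lambda>i k l. lc_gamma_bar (H c) i k l"
  have dG: "?G i k l differentiable at z" "?B i k l differentiable at z" for i k l
    using smooth_on_differentiable[OF smooth_lc_gamma(1)[OF c(1)] c(2)] smooth_on_differentiable[OF smooth_lc_gamma(2)[OF c(1)] c(2)]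
    by auto
  have dt: "(\<lambda>w. torsion_form c w xs) differentiable at z" for xs
    using form_differentiable[OF forms_torsion c] by (simp add: covec_differentiable_def)
  have dl: "wirtinger a (log_det c) differentiable at z" for a
    by (rule smooth_on_differentiable[OF smooth_on_wirtinger[OF o sml] c(2)])
  have quad: "(\<Sum>k\<in>UNIV. \<Sum>s\<in>UNIV. ?G i k s z * ?B j s k z) = (\<Sum>k\<in>UNIV. \<Sum>s\<in>UNIV. ?B j k s z * ?G s i k z)"
  proof -
    have "?G s i k z = ?G i s k z" for s k by (simp add: lc_gamma_def add.commute)
    then show ?thesis by (subst sum.swap) (simp add: mult.commute)
  qed
  have "(\<Sum>k\<in>UNIV. wirtinger (Inr j) (?G i k k) z) = wirtinger (Inr j) (\<lambda>w. \<Sum>k\<in>UNIV. ?G i k k w) z"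
    by (simp add: wirtinger_sum dG)
  also have "\<dots> = wirtinger (Inr j) (\<lambda>w. wirtinger (Inl i) (log_det c) w - 1/2 * torsion_form c w [Inl i]) z"
    by (rule wirtinger_cong[OF o c(2)]) (simp_all add: dG differentiable_sum trace_lc_gamma[OF c(1)])
  also have "\<dots> = wirtinger (Inr j) (wirtinger (Inl i) (log_det c)) z - 1/2 * wirtinger (Inr j) (\<lambda>w. torsion_form c w [Inl i]) z"
    using dt dl by (simp only: wirtinger_diff differentiable_mult differentiable_const wirtinger_cmult)
  also have "wirtinger (Inr j) (wirtinger (Inl i) (log_det c)) z = wirtinger (Inl i) (wirtinger (Inr j) (log_det c)) z"
    by (rule wirtinger_commute[OF o sml c(2)])
  finally have G: "(\<Sum>k\<in>UNIV. wirtinger (Inr j) (?G i k k) z) = wirtinger (Inl i) (wirtinger (Inr j) (log_det c)) z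
      - 1/2 * wirtinger (Inr j) (\<lambda>w. torsion_form c w [Inl i]) z" .
  have "(\<Sum>k\<in>UNIV. wirtinger (Inl i) (?B j k k) z) = wirtinger (Inl i) (\<lambda>w. \<Sum>k\<in>UNIV. ?B j k k w) z"
    by (simp add: wirtinger_sum dG)
  also have "\<dots> = wirtinger (Inl i) (\<lambda>w. 1/2 * torsion_form c w [Inr j]) z"
    by (rule wirtinger_cong[OF o c(2)]) (simp_all add: dG differentiable_sum trace_lc_gamma_bar[OF c(1)])
  also have "\<dots> = 1/2 * wirtinger (Inl i) (\<lambda>w. torsion_form c w [Inr j]) z" by (rule wirtinger_cmult[OF dt])
  finally have B: "(\<Sum>k\<in>UNIV. wirtinger (Inl i) (?B j k k) z) = 1/2 * wirtinger (Inl i) (\<lambda>w. torsion_form c w [Inr j]) z" .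
  show ?thesis
    unfolding lc_curvature_def sum_negf sum_subtractf sum.distrib G B quad by simp
qed

lemma lc_ricci_coeff:
  assumes "c \<in> A" "z \<in> chart_image c"
  shows "lc_ricci A \<omega> c z [Inl i, Inr j] = \<i> * (\<Sum>k\<in>UNIV. lc_curvature (H c) i j k k z)"
proof -
  have "wedge (coord_covec (Inl i')) (coord_covec (Inr j')) [Inl i, Inr j] = (if i = i' then if j = j' then 1 else 0 else 0)" for i' j' :: 'n
    by (simp add: wedge_Cons contract_apply parity_sign_def coord_covec_def)
  then have "(\<Sum>i'\<in>UNIV. \<Sum>j'\<in>UNIV. R i' j' * wedge (coord_covec (Inl i')) (coord_covec (Inr j')) [Inl i, Inr j])
      = (\<Sum>i'\<in>UNIV. if i = i' then (\<Sum>j'\<in>UNIV. if j = j' then R i' j' else 0) else 0)" for R :: "'n \<Rightarrow> 'n \<Rightarrow> complex"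
    by (intro sum.cong refl) (simp add: if_distrib[of "\<lambda>x. _ * x"] cong: if_cong)
  then show ?thesis using assms by (simp add: lc_ricci_def)
qed

text \<open>The signs of the two parts of \<open>\<gamma>\<close> are opposite, because
  \<open>(d\<gamma>)\<^bsub>i j\<bar>\<^esub> = \<partial>\<^sub>i\<gamma>\<^bsub>j\<bar>\<^esub> -
  \<partial>\<^bsub>j\<bar>\<^esub>\<gamma>\<^sub>i\<close> is a difference and the Ricci curvature
  contains a sum.\<close>

lemma ricci_flat_potential:
  assumes flat: "lc_ricci_flat A \<omega>"
  shows "\<exists>\<gamma>\<in>forms A. \<forall>c z i j. anticanonical_curvature A det_metric c z [Inl i, Inr j] = ext_d A \<gamma> c z [Inl i, Inr j]"
proof -
  let ?\<gamma> = "scale_form (- \<i> / 2) (one_form_part (\<lambda>a. \<not> isl a) torsion_form) + scale_form (\<i> / 2) (one_form_part isl torsion_form)"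
  have "?\<gamma> \<in> forms A" by (intro forms_add forms_scale forms_one_form_part forms_torsion) auto
  moreover have "anticanonical_curvature A det_metric c z [Inl i, Inr j] = ext_d A ?\<gamma> c z [Inl i, Inr j]" for c z i j
  proof (cases "c \<in> A \<and> z \<in> chart_image c")
    case True
    then have c: "c \<in> A" "z \<in> chart_image c" by auto
    have dt: "(\<lambda>w. torsion_form c w xs) differentiable at z" for xs
      using form_differentiable[OF forms_torsion c] by (simp add: covec_differentiable_def)
    have "(\<Sum>k\<in>UNIV. lc_curvature (H c) i j k k z) = 0"
      using flat lc_ricci_coeff[OF c, of i j] by (simp add: lc_ricci_flat_def)
    then have "wirtinger (Inl i) (wirtinger (Inr j) (log_det c)) z
        = 1/2 * wirtinger (Inr j) (\<lambda>w. torsion_form c w [Inl i]) z + 1/2 * wirtinger (Inl i) (\<lambda>w. torsion_form c w [Inr j]) z"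
      unfolding trace_lc_curvature[OF c] by (simp add: algebra_simps)
    moreover have "ext_d A ?\<gamma> c z [Inl i, Inr j] = wirtinger (Inl i) (\<lambda>w. (- \<i> / 2) * torsion_form c w [Inr j]) z
        - wirtinger (Inr j) (\<lambda>w. (\<i> / 2) * torsion_form c w [Inl i]) z"
      by (simp add: ext_d_pair[OF c] scale_form_def one_form_part_Cons)
    ultimately show ?thesis
      unfolding curvature_eq[OF det_metric_anticanonical c] wirtinger_cmult[OF dt] by (simp add: algebra_simps)
  next
    case False
    then show ?thesis by (simp add: curvature_zero ext_d_zero)
  qed
  ultimately show ?thesis by blast
qed

end

context complex_mfd
begin

text \<open>The factors from the transformation rule cancel in the quotient of two metrics, so its logarithm
  is a function on the manifold.\<close>

lemma metric_ratio:
  assumes "anticanonical_metric A h" "anticanonical_metric A h'" "c \<in> A" "d \<in> A" "p \<in> fst c" "p \<in> fst d"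
  shows "ln (h c (snd c p)) - ln (h' c (snd c p)) = ln (h d (snd d p)) - ln (h' d (snd d p))"
proof -
  let ?z = "snd c p" and ?w = "snd d p"
  let ?J = "(cmod (det (\<chi> k i. jacobian (transition c d) ?z (Inl k) (Inl i))))\<^sup>2"
  have z: "?z \<in> overlap c d" using assms by (auto simp: overlap_def)
  have t: "transition c d ?z = ?w" using assms by (simp add: transition_def chart_inv_chart)
  have "?w \<in> chart_image d" using assms by (auto simp: chart_image_def)
  then have pos: "h d ?w > 0" "h' d ?w > 0" using metric_smooth_pos(2) assms by blast+
  have J: "?J > 0" using metric_jacobian_nonzero[OF assms(1,3,4) z] by simp
  have "h c ?z = ?J * h d ?w" "h' c ?z = ?J * h' d ?w"
    using assms(1-4) z t unfolding anticanonical_metric_def by force+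
  then show ?thesis using ln_mult_pos[OF J pos(1)] ln_mult_pos[OF J pos(2)] by simp
qed

text \<open>The curvatures of two metrics differ by \<open>\<partial>\<close> of the form \<open>-\<i> \<partial>\<bar> f\<close>, where \<open>f\<close> is the logarithm of
  their ratio, a global function.\<close>

lemma change_metric_potential:
  assumes h: "anticanonical_metric A h" and h': "anticanonical_metric A h'"
    and \<gamma>: "\<gamma> \<in> forms A" "\<And>c z i j. anticanonical_curvature A h c z [Inl i, Inr j] = ext_d A \<gamma> c z [Inl i, Inr j]"
  shows "\<exists>\<gamma>\<in>forms A. \<forall>c z i j. anticanonical_curvature A h' c z [Inl i, Inr j] = ext_d A \<gamma> c z [Inl i, Inr j]"
proof -
  \<comment> \<open>By \<open>metric_ratio\<close> the value does not depend on the chart that is chosen at \<open>p\<close>.\<close>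
  define f where "f p = (let c = (SOME c. c \<in> A \<and> p \<in> fst c) in
      complex_of_real (ln (h' c (snd c p)) - ln (h c (snd c p))))" for p
  have f: "f (chart_inv c z) = log_metric h' c z - log_metric h c z" if c: "c \<in> A" "z \<in> chart_image c" for c z
  proof -
    let ?p = "chart_inv c z" and ?d = "SOME d. d \<in> A \<and> chart_inv c z \<in> fst d"
    have p: "?p \<in> fst c" using chart_inv_in[OF c(2)] .
    then have d: "?d \<in> A \<and> ?p \<in> fst ?d" using someI_ex[of "\<lambda>d. d \<in> A \<and> ?p \<in> fst d"] c by blast
    show ?thesis
      using metric_ratio[OF h' h c(1) conjunct1[OF d] p conjunct2[OF d]] chart_chart_inv[OF c(2)]
      by (simp add: f_def Let_def flip: of_real_diff)
  qed
  have sm: "smooth_on (chart_image c) (\<lambda>z. log_metric h' c z - log_metric h c z)" if "c \<in> A" for c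
    by (intro smooth_on_diff metric_smooth_pos(3) h h' open_chart_image that)
  have "smooth_fun f"
    unfolding smooth_fun_def
    by (intro ballI, rule smooth_on_cong[OF open_chart_image _ sm]) (simp_all add: f)
  then have F: "fun_form f \<in> forms A" by (rule forms_fun_form)
  let ?\<beta> = "scale_form (- \<i>) (one_form_part (\<lambda>a. \<not> isl a) (ext_d A (fun_form f)))"
  have \<beta>: "?\<beta> \<in> forms A" by (intro forms_scale forms_one_form_part forms_ext_d F) auto
  have "anticanonical_curvature A h' c z [Inl i, Inr j] = ext_d A (\<gamma> + ?\<beta>) c z [Inl i, Inr j]" for c z i j
  proof (cases "c \<in> A \<and> z \<in> chart_image c")
    case True
    then have c: "c \<in> A" "z \<in> chart_image c" by auto
    note o = open_chart_image[OF c(1)]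
    let ?u' = "log_metric h' c" and ?u = "log_metric h c"
    have smu: "smooth_on (chart_image c) ?u'" "smooth_on (chart_image c) ?u"
      using metric_smooth_pos(3)[OF h' c(1)] metric_smooth_pos(3)[OF h c(1)] by auto
    have smw: "smooth_on (chart_image c) (wirtinger (Inr j) ?u')" "smooth_on (chart_image c) (wirtinger (Inr j) ?u)"
      using smooth_on_wirtinger[OF o] smu by auto
    have e: "ext_d A (fun_form f) c w [Inr j] = wirtinger (Inr j) ?u' w - wirtinger (Inr j) ?u w" if w: "w \<in> chart_image c" for w
    proof -
      have "ext_d A (fun_form f) c w [Inr j] = wirtinger (Inr j) (\<lambda>v. fun_form f c v []) w"
        using c w by (simp add: ext_d_eq local_ext_Cons)
      also have "\<dots> = wirtinger (Inr j) (\<lambda>v. ?u' v - ?u v) w"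
        by (rule wirtinger_cong[OF o w])
          (use form_differentiable[OF F c(1) w] in \<open>auto simp: covec_differentiable_def fun_form_def c(1) f covec_one_def\<close>)
      also have "\<dots> = wirtinger (Inr j) ?u' w - wirtinger (Inr j) ?u w"
        by (rule wirtinger_diff[OF smooth_on_differentiable[OF smu(1) w] smooth_on_differentiable[OF smu(2) w]])
      finally show ?thesis .
    qed
    have de: "(\<lambda>w. ext_d A (fun_form f) c w [Inr j]) differentiable at z"
      using form_differentiable[OF forms_ext_d[OF F] c] by (simp add: covec_differentiable_def)
    have "wirtinger (Inl i) (\<lambda>w. ext_d A (fun_form f) c w [Inr j]) z
        = wirtinger (Inl i) (\<lambda>w. wirtinger (Inr j) ?u' w - wirtinger (Inr j) ?u w) z"
      by (rule wirtinger_cong[OF o c(2) de e])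
    also have "\<dots> = wirtinger (Inl i) (wirtinger (Inr j) ?u') z - wirtinger (Inl i) (wirtinger (Inr j) ?u) z"
      by (rule wirtinger_diff[OF smooth_on_differentiable[OF smw(1) c(2)] smooth_on_differentiable[OF smw(2) c(2)]])
    finally have d2: "wirtinger (Inl i) (\<lambda>w. ext_d A (fun_form f) c w [Inr j]) z
      = wirtinger (Inl i) (wirtinger (Inr j) ?u') z - wirtinger (Inl i) (wirtinger (Inr j) ?u) z" .
    have "ext_d A ?\<beta> c z [Inl i, Inr j] = - \<i> * (wirtinger (Inl i) (wirtinger (Inr j) ?u') z - wirtinger (Inl i) (wirtinger (Inr j) ?u) z)"
      unfolding ext_d_pair[OF c] scale_form_def one_form_part_Cons
      using wirtinger_cmult[OF de, of "Inl i" "- \<i>"] d2 by simp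
    then have "anticanonical_curvature A h' c z [Inl i, Inr j]
        = anticanonical_curvature A h c z [Inl i, Inr j] + ext_d A ?\<beta> c z [Inl i, Inr j]"
      by (simp add: curvature_eq[OF h c] curvature_eq[OF h' c] right_diff_distrib)
    then show ?thesis unfolding ext_d_add[OF \<gamma>(1) \<beta>] \<gamma>(2) by simp
  next
    case False
    then show ?thesis by (simp add: curvature_zero ext_d_zero)
  qed
  then show ?thesis using forms_add[OF \<gamma>(1) \<beta>] by blast
qed

end

context hermitian_mfd
begin

lemma ricci_flat_chern_number:
  assumes "compact_space X" "lc_ricci_flat A \<omega>"
  shows "top_chern_number X A = 0"
  using top_chern_number_zero[OF assms(1)] det_metric_anticanonical
    ricci_flat_potential[OF assms(2)] change_metric_potential[OF det_metric_anticanonical]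
  by blast

end

theorem corollary5p1:
  fixes X :: "'a topology" and A :: "('a, 'n::finite) chart set"
  assumes "complex_manifold X A" and "compact_space X"
  shows "(first_aeppli_chern_class A = aeppli_class A 1 1 0 \<longrightarrow> top_chern_number X A = 0) \<and>
         ((\<exists>\<omega>. hermitian_metric A \<omega> \<and> lc_ricci_flat A \<omega>) \<longrightarrow> top_chern_number X A = 0)"
proof (intro conjI impI)
  interpret complex_mfd X A by unfold_locales (rule assms(1))
  assume "first_aeppli_chern_class A = aeppli_class A 1 1 0"
  then show "top_chern_number X A = 0" by (rule aeppli_flat_chern_number[OF assms(2)])
next
  assume "\<exists>\<omega>. hermitian_metric A \<omega> \<and> lc_ricci_flat A \<omega>"
  then obtain \<omega> where \<omega>: "hermitian_metric A \<omega>" "lc_ricci_flat A \<omega>" by blast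
  interpret hermitian_mfd X A \<omega> by unfold_locales (rule assms(1), rule \<omega>(1))
  show "top_chern_number X A = 0" by (rule ricci_flat_chern_number[OF assms(2) \<omega>(2)])
qed

end
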